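(* Consider the stochastic $K$-armed bandit problem with arm means $\mu_1,\dots,\mu_K\in[0,1]$ and a time horizon $T>0$ that is known to the algorithm. Let $\mu_*=\max_{i\in[K]}\mu_i$, $\Delta_i=\mu_*-\mu_i$, and $\Delta=\min_{i:\Delta_i>0}\Delta_i$. For any $\gamma>0$ and any $T>0$, there exists an algorithm (which may depend on $T$ and $\gamma$) that uses $O(1)$ words of space and achieves pseudo-regret \[ \overline{\Psi}_T = O\left(\sum_{i:\Delta_i>0}\frac{1}{\Delta_i}\left(\log^{\gamma}\frac{1}{\Delta_i}+\frac{\log(\Delta_i/\Delta)}{\gamma\log\log(\Delta_i/\Delta)}\right)\log T\right). \]
   Context: Stochastic bandit model: there are $K$ arms; arm $i\in[K]$ has a distribution $\mathcal{D}_i$ supported on $[0,1]$ with mean $\mu_i$. At each time step $t=1,2,\dots,T$ the player chooses an arm $I_t\in[K]$ (depending only on past observations and internal randomness) and receives reward $X_{I_t,t}$, where the rewards $X_{i,t}$ are drawn from $\mathcal{D}_i$ independently across $i$ and $t$. The pseudo-regret is $\overline{\Psi}_T=\max_{i\in[K]}\left(\mathbb{E}\left[\sum_{t=1}^T X_{i,t}\right]-\mathbb{E}\left[\sum_{t=1}^T X_{I_t,t}\right]\right)$. Space is measured in words in the word-RAM model: each input value (such as $K$, $T$, a reward) and each variable occupies $O(1)$ words of $O(\log(KT))$ bits. The $O(\cdot)$ hides an absolute constant independent of $\gamma$, $K$, $T$ and the arm distributions.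
   Formalization: The factors log(1/Δ_i), log T and the denominator log log(Δ_i/Δ) are read as max(1, ·); literally the bound is undefined for Δ_i = Δ and is zero (hence false) for T = 1, and its first term vanishes for Δ_i = 1. *)

theory Defs
  imports "HOL-Probability.Probability" "HOL-Library.While_Combinator"
begin

section \<open>Stochastic bandits\<close>

text \<open>
  Arms are \<open>0, \<dots>, K - 1\<close>; \<open>D i\<close> is the reward distribution of arm \<open>i\<close>.
\<close>

definition bandit_instance :: "nat \<Rightarrow> (nat \<Rightarrow> real measure) \<Rightarrow> bool" where
  "bandit_instance K D \<longleftrightarrow>
     (\<forall>i<K. real_distribution (D i) \<and> (AE x in D i. x \<in> {0..1}))"

definition arm_mean :: "(nat \<Rightarrow> real measure) \<Rightarrow> nat \<Rightarrow> real" where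
  "arm_mean D i = (\<integral>x. x \<partial>D i)"

definition best_mean :: "nat \<Rightarrow> (nat \<Rightarrow> real measure) \<Rightarrow> real" where
  "best_mean K D = Max (arm_mean D ` {..<K})"

definition gap :: "nat \<Rightarrow> (nat \<Rightarrow> real measure) \<Rightarrow> nat \<Rightarrow> real" where
  "gap K D i = best_mean K D - arm_mean D i"

text \<open>Only used when some gap is positive; several arms may be optimal.\<close>

definition min_gap :: "nat \<Rightarrow> (nat \<Rightarrow> real measure) \<Rightarrow> real" where
  "min_gap K D = Min {gap K D i | i. i < K \<and> gap K D i > 0}"

text \<open>
  A sample point is a pair \<open>(x, u)\<close>: \<open>x (i, t)\<close> is the reward that arm \<open>i\<close> has in store
  at time \<open>t\<close>, and \<open>u t\<close> is the \<open>w\<close>-bit random word handed to the player at time \<open>t\<close>.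
  All of these are independent.
\<close>

definition bandit_space ::
  "nat \<Rightarrow> nat \<Rightarrow> nat \<Rightarrow> (nat \<Rightarrow> real measure) \<Rightarrow> ((nat \<times> nat \<Rightarrow> real) \<times> (nat \<Rightarrow> nat)) measure" where
  "bandit_space w K T D =
     (\<Pi>\<^sub>M p\<in>{..<K} \<times> {1..T}. D (fst p)) \<Otimes>\<^sub>M
     (\<Pi>\<^sub>M t\<in>{1..T}. measure_pmf (pmf_of_set {..<2 ^ w}))"


section \<open>Word-RAM programs\<close>

text \<open>
  The memory is a list of cells, each holding one \<open>w\<close>-bit word.  All arithmetic is modulo
  \<open>2 ^ w\<close>, addresses may be computed, a read outside the memory yields \<open>0\<close> and a write
  outside it has no effect, so the length of the list is a hard bound on the space used.
\<close>

type_synonym mem = "nat list"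

datatype exp =
    Imm nat
  | Load exp
  | Add exp exp
  | Sub exp exp
  | Mul exp exp
  | Quot exp exp
  | Rem exp exp
  | Less exp exp

datatype prog =
    Skip
  | Store exp exp
  | Seq prog prog
  | Cond exp prog prog
  | Loop exp prog

primrec eval_exp :: "nat \<Rightarrow> mem \<Rightarrow> exp \<Rightarrow> nat" where
  "eval_exp w m (Imm n) = n mod 2 ^ w"
| "eval_exp w m (Load a) = (if eval_exp w m a < length m then m ! eval_exp w m a else 0)"
| "eval_exp w m (Add a b) = (eval_exp w m a + eval_exp w m b) mod 2 ^ w"
| "eval_exp w m (Sub a b) = (eval_exp w m a + 2 ^ w - eval_exp w m b) mod 2 ^ w"
| "eval_exp w m (Mul a b) = (eval_exp w m a * eval_exp w m b) mod 2 ^ w"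
| "eval_exp w m (Quot a b) = eval_exp w m a div eval_exp w m b"
| "eval_exp w m (Rem a b) = eval_exp w m a mod eval_exp w m b"
| "eval_exp w m (Less a b) = (if eval_exp w m a < eval_exp w m b then 1 else 0)"

text \<open>The result is \<open>None\<close> iff the program does not terminate.\<close>

primrec exec :: "nat \<Rightarrow> prog \<Rightarrow> mem \<Rightarrow> mem option" where
  "exec w Skip m = Some m"
| "exec w (Store a b) m = Some (m[eval_exp w m a := eval_exp w m b])"
| "exec w (Seq p q) m = Option.bind (exec w p m) (exec w q)"
| "exec w (Cond b p q) m = (if eval_exp w m b \<noteq> 0 then exec w p m else exec w q m)"
| "exec w (Loop b p) m =
     Option.bind
       (while_option
          (\<lambda>r. case r of None \<Rightarrow> False | Some m' \<Rightarrow> eval_exp w m' b \<noteq> 0)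
          (\<lambda>r. Option.bind r (exec w p))
          (Some m))
       (\<lambda>r. r)"

text \<open>
  The length of the program text.  Immediate operands count as one word, since only their
  residue modulo \<open>2 ^ w\<close> matters.
\<close>

primrec exp_length :: "exp \<Rightarrow> nat" where
  "exp_length (Imm n) = 1"
| "exp_length (Load a) = 1 + exp_length a"
| "exp_length (Add a b) = 1 + exp_length a + exp_length b"
| "exp_length (Sub a b) = 1 + exp_length a + exp_length b"
| "exp_length (Mul a b) = 1 + exp_length a + exp_length b"
| "exp_length (Quot a b) = 1 + exp_length a + exp_length b"
| "exp_length (Rem a b) = 1 + exp_length a + exp_length b"
| "exp_length (Less a b) = 1 + exp_length a + exp_length b"

primrec prog_length :: "prog \<Rightarrow> nat" where
  "prog_length Skip = 1"
| "prog_length (Store a b) = 1 + exp_length a + exp_length b"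
| "prog_length (Seq p q) = 1 + prog_length p + prog_length q"
| "prog_length (Cond b p q) = 1 + exp_length b + prog_length p + prog_length q"
| "prog_length (Loop b p) = 1 + exp_length b + prog_length p"

lemma eval_exp_word:
  assumes "w > 0" "\<forall>v\<in>set m. v < 2 ^ w"
  shows "eval_exp w m e < 2 ^ w"
proof (induction e)
  case (Quot a b)
  then show ?case
    by (auto intro: le_less_trans[OF div_le_dividend])
next
  case (Rem a b)
  then show ?case
    by (auto intro: le_less_trans[OF mod_less_eq_dividend])
qed (use assms in \<open>auto simp: nth_mem\<close>)

lemma exec_words:
  assumes "w > 0" "exec w p m = Some m'" "\<forall>v\<in>set m. v < 2 ^ w"
  shows "length m' = length m \<and> (\<forall>v\<in>set m'. v < 2 ^ w)"
  using assms(2,3)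
proof (induction p arbitrary: m m')
  case (Store a b)
  then have "m' = m[eval_exp w m a := eval_exp w m b]" by simp
  moreover have "eval_exp w m b < 2 ^ w"
    using eval_exp_word[OF assms(1) Store.prems(2)] .
  ultimately show ?case
    using Store.prems(2) set_update_subset_insert[of m "eval_exp w m a" "eval_exp w m b"]
    by auto
next
  case (Seq p q)
  from Seq.prems(1) obtain m1 where m1: "exec w p m = Some m1" "exec w q m1 = Some m'"
    by (auto simp: Option.bind_eq_Some_conv)
  from Seq.IH(1)[OF m1(1) Seq.prems(2)] Seq.IH(2)[OF m1(2)] show ?case by simp
next
  case (Loop b p)
  let ?I = "\<lambda>r. \<forall>m'. r = Some m' \<longrightarrow> length m' = length m \<and> (\<forall>v\<in>set m'. v < 2 ^ w)"
  from Loop.prems(1) obtain r where r: "r = Some m'" and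
    wh: "while_option (\<lambda>r. case r of None \<Rightarrow> False | Some m' \<Rightarrow> eval_exp w m' b \<noteq> 0)
           (\<lambda>r. Option.bind r (exec w p)) (Some m) = Some r"
    by (auto simp: Option.bind_eq_Some_conv)
  have step: "?I (Option.bind s (exec w p))" if "?I s" for s
  proof (intro allI impI)
    fix m2 assume "Option.bind s (exec w p) = Some m2"
    then obtain m1 where "s = Some m1" "exec w p m1 = Some m2"
      by (auto simp: Option.bind_eq_Some_conv)
    with that Loop.IH[of m1 m2] show "length m2 = length m \<and> (\<forall>v\<in>set m2. v < 2 ^ w)"
      by simp
  qed
  have "?I r"
    by (rule while_option_rule[OF _ wh, where P = ?I]) (rule step, assumption, simp add: Loop.prems(2))
  then show ?case using r by blast
qed (auto split: if_splits)


section \<open>Playing a bandit with a program\<close>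

text \<open>
  A player is a program that is run once per time step.  It communicates through fixed cells:
  after the run, cell 0 holds the arm to be pulled; before the run, cell 1 holds the reward of
  the previous pull and cell 2 a fresh random word.  Initially cells 3 and 4 hold the inputs
  \<open>K\<close> and \<open>T\<close>, and all other cells are \<open>0\<close>.  Nothing but the memory is kept from one time step
  to the next.
\<close>

text \<open>\<open>c \<cdot> \<lceil>log\<^sub>2 (K T + 1)\<rceil>\<close> bits per word, so that \<open>K\<close> and \<open>T\<close> fit into a word if \<open>c > 0\<close>.\<close>

definition word_bits :: "nat \<Rightarrow> nat \<Rightarrow> nat \<Rightarrow> nat" where
  "word_bits c K T = c * nat \<lceil>log 2 (real (K * T + 1))\<rceil>"

definition init_mem :: "nat \<Rightarrow> nat \<Rightarrow> nat \<Rightarrow> mem" where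
  "init_mem S K T = (replicate S 0)[3 := K, 4 := T]"

text \<open>
  A reward in \<open>[0, 1]\<close> is presented to the player as one word, in fixed-point representation.
  The final \<open>mod\<close> is irrelevant for rewards in \<open>[0, 1]\<close>.
\<close>

definition reward_word :: "nat \<Rightarrow> real \<Rightarrow> nat" where
  "reward_word w x = nat \<lfloor>x * (2 ^ w - 1)\<rfloor> mod 2 ^ w"

text \<open>
  \<open>run p S w K T (x, u) t\<close> is the memory after \<open>t\<close> time steps, the reward of the last pull being
  already recorded; \<open>None\<close> if some run of the program has not terminated.
\<close>

primrec run :: "prog \<Rightarrow> nat \<Rightarrow> nat \<Rightarrow> nat \<Rightarrow> nat \<Rightarrow> (nat \<times> nat \<Rightarrow> real) \<times> (nat \<Rightarrow> nat) \<Rightarrow> nat \<Rightarrow> mem option" where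
  "run p S w K T \<omega> 0 = Some (init_mem S K T)"
| "run p S w K T \<omega> (Suc t) =
     Option.bind (run p S w K T \<omega> t) (\<lambda>m.
     Option.bind (exec w p (m[2 := snd \<omega> (Suc t) mod 2 ^ w])) (\<lambda>m'.
     Some (m'[1 := reward_word w (fst \<omega> (m' ! 0, Suc t))])))"

definition chosen_arm ::
  "prog \<Rightarrow> nat \<Rightarrow> nat \<Rightarrow> nat \<Rightarrow> nat \<Rightarrow> nat \<Rightarrow> (nat \<times> nat \<Rightarrow> real) \<times> (nat \<Rightarrow> nat) \<Rightarrow> nat" where
  "chosen_arm p S w K T t \<omega> = the (run p S w K T \<omega> t) ! 0"

text \<open>Whatever happens, the program terminates and pulls an existing arm at every time step.\<close>

definition legal_player :: "prog \<Rightarrow> nat \<Rightarrow> nat \<Rightarrow> nat \<Rightarrow> nat \<Rightarrow> bool" where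
  "legal_player p S w K T \<longleftrightarrow>
     (\<forall>\<omega>. \<forall>t\<in>{1..T}. run p S w K T \<omega> t \<noteq> None \<and> chosen_arm p S w K T t \<omega> < K)"

definition pseudo_regret ::
  "prog \<Rightarrow> nat \<Rightarrow> nat \<Rightarrow> nat \<Rightarrow> nat \<Rightarrow> (nat \<Rightarrow> real measure) \<Rightarrow> real" where
  "pseudo_regret p S w K T D =
     Max ((\<lambda>i. (\<integral>\<omega>. (\<Sum>t=1..T. fst \<omega> (i, t)) \<partial>bandit_space w K T D)
             - (\<integral>\<omega>. (\<Sum>t=1..T. fst \<omega> (chosen_arm p S w K T t \<omega>, t)) \<partial>bandit_space w K T D))
          ` {..<K})"


section \<open>Logarithms in asymptotic bounds\<close>

text \<open>
  The usual convention that a logarithm in a bound is never smaller than 1.  Without it the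
  bound would vanish for \<open>T = 1\<close> or \<open>\<Delta>\<^sub>i = 1\<close>, and the iterated logarithm would be negative or
  undefined for ratios close to 1.
\<close>

definition log_ge1 :: "real \<Rightarrow> real" where
  "log_ge1 x = max 1 (ln x)"

end

theory Submission
  imports Defs "HOL-Library.Discrete_Functions"
begin

text \<open>
  Let \<open>T \<le> 4 ^ R \<le> 4 T\<close>.  The player proceeds in rounds \<open>r < R\<close> and plays one session with every arm
  in every round.  A session climbs through the levels \<open>m \<le> r\<close>: at level \<open>m\<close> the empirical mean of
  about \<open>4 ^ m\<close> pulls is compared with the bar, a lower estimate of the largest mean, and the arm is
  dropped once it lies more than \<open>2 / 2 ^ m\<close> below the bar.  A session with an arm of gap \<open>1 / 2 ^ k\<close> thus
  ends near level \<open>k\<close>, and an arm that survives level \<open>r\<close> may raise the bar.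

  At levels \<open>m \<ge> (focus + r) / 2\<close> the sample has size \<open>256 (R + 1) 4 ^ m\<close>, so that with high
  probability none of these tests fails; at lower levels its size is \<open>16 \<cdot> 4 ^ m (1 + slack)\<close>, and a test fails with
  small constant probability.  The focus approaches the level \<open>h\<close> of the smallest positive gap, and the
  slack \<open>sqrt (min m (focus - m))\<close> makes the failure probabilities of a session sum up to less than
  \<open>1 / 64\<close>.  A failure spoils only the round in which it occurs, so the number of consecutive spoiled
  rounds has a geometric tail, which beats the factor that the delay costs.  Hence an arm of gap
  \<open>1 / 2 ^ k\<close> is pulled \<open>O (4 ^ k (R + 1) (1 + sqrt (min k (h - k))))\<close> times in expectation.  The width
  \<open>sqrt (min k (h - k))\<close> is below the bracket of the theorem for all \<open>\<gamma>\<close> at once, so the player need not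
  know \<open>\<gamma>\<close>.
\<close>

section \<open>The player\<close>

text \<open>Constant memory cannot record which arms were dropped, so every arm is tried again in
  each of the \<open>R\<close> rounds, and \<open>R\<close> is of order log T. A session with an arm
  of level k may thus cost about 4^k in every round, but a further factor \<open>R + 1\<close> for
  certainty only O(1) times. The threshold (focus + r) / 2 achieves this: certain tests cost a
  session \<open>R + 1\<close> times 16^k / 2^(f + r) = 4^k 2^(k - f) 2^(k - r), a geometric series
  in r once f is not far below k. The other tests must be allowed to fail. The slack vanishes at
  level 0 and at the focus, yet makes exp (- 32 (1 + slack)) summable over the levels. Recovery
  takes two rounds, one for the best arm to lift the bar and one for arm i to attract the focus.
  Such a pair is spoiled with probability at most 2 / 64, and waiting for another pair multiplies
  the cost by 4^2, so the expected factor is a series of ratio 16 / 32. Bar and focus change only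
  between sessions; hence the sample sizes of a session are fixed by its past, and Hoeffding's
  inequality applies to its rewards.\<close>

definition slack :: "nat \<Rightarrow> nat \<Rightarrow> nat" where
  "slack f m = (if m \<le> f then floor_sqrt (min m (f - m)) else m - f)"

text \<open>The factor 16 gives the Hoeffding exponent 32 (1 + slack) for a deviation of 2^-m. The
  factor 256 gives 8 (R + 1) for a deviation of 2^-m / 8, hence a failure probability of order
  256^-(R + 1).\<close>

definition quota :: "nat \<Rightarrow> nat \<Rightarrow> nat \<Rightarrow> nat \<Rightarrow> nat" where
  "quota R f r m = 4 ^ m * (if 2 * m < f + r then 16 * (1 + slack f m) else 256 * (R + 1))"

text \<open>Fine enough that a rounding error of two units stays below 1/32 of 2^-m at all levels m
  \<le> R, and coarse enough that products of a few such numbers fit into a word.\<close>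

definition grid :: "nat \<Rightarrow> nat" where
  "grid R = 64 * 4 ^ R"

text \<open>
  Rewards are quantized to multiples of \<open>1 / grid R\<close>; \<open>gain\<close> and \<open>bar\<close> are in units of the grid.  The
  inequalities below are free of divisions, as a word-RAM program checks them.
\<close>

record player =
  arm :: nat  pulls :: nat  gain :: nat  level :: nat
  stage :: nat  bar :: nat  focus :: nat  champ :: nat

definition next_arm :: "nat \<Rightarrow> player \<Rightarrow> player" where
  "next_arm K \<sigma> =
     (if arm \<sigma> + 1 < K then \<sigma>\<lparr>arm := arm \<sigma> + 1, pulls := 0, gain := 0, level := 0\<rparr>
      else \<sigma>\<lparr>arm := 0, stage := stage \<sigma> + 1, pulls := 0, gain := 0, level := 0\<rparr>)"

definition fails :: "nat \<Rightarrow> nat \<Rightarrow> nat \<Rightarrow> nat \<Rightarrow> nat \<Rightarrow> bool" where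
  "fails R v n s m \<longleftrightarrow> s * 2 ^ m + 2 * n * grid R < v * n * 2 ^ m"

text \<open>A sample is kept when the level rises. The bar is lifted only to 2^-m below the sample
  mean, so that it remains a lower estimate. The focus moves upon a rejection by a certain test
  whose mean is at most 16 / 2^m below the bar, which is evidence of a gap of order 2^-m.\<close>

definition play_step :: "nat \<Rightarrow> nat \<Rightarrow> player \<Rightarrow> nat \<Rightarrow> player" where
  "play_step K R \<sigma> z =
     (if R \<le> stage \<sigma> then \<sigma>
      else let n = pulls \<sigma> + 1; s = gain \<sigma> + z; m = level \<sigma> in
        if n \<noteq> quota R (focus \<sigma>) (stage \<sigma>) m then \<sigma>\<lparr>pulls := n, gain := s\<rparr>
        else if fails R (bar \<sigma>) n s m then
          next_arm K (\<sigma>\<lparr>focus :=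
            if focus \<sigma> + stage \<sigma> \<le> 2 * m \<and> bar \<sigma> * n * 2 ^ m \<le> s * 2 ^ m + 16 * n * grid R
            then m else focus \<sigma>\<rparr>)
        else if m < stage \<sigma> then \<sigma>\<lparr>pulls := n, gain := s, level := m + 1\<rparr>
        else next_arm K
          (if (bar \<sigma> + 1) * n * 2 ^ m + n * grid R \<le> s * 2 ^ m
           then \<sigma>\<lparr>bar := (s * 2 ^ m - n * grid R) div (n * 2 ^ m), champ := arm \<sigma>\<rparr>
           else \<sigma>))"

definition pull :: "nat \<Rightarrow> player \<Rightarrow> nat" where
  "pull R \<sigma> = (if stage \<sigma> < R then arm \<sigma> else champ \<sigma>)"

definition start :: player where
  "start = \<lparr>arm = 0, pulls = 0, gain = 0, level = 0, stage = 0, bar = 0, focus = 0, champ = 0\<rparr>"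

primrec traj :: "nat \<Rightarrow> nat \<Rightarrow> (nat \<times> nat \<Rightarrow> nat) \<Rightarrow> nat \<Rightarrow> player" where
  "traj K R y 0 = start"
| "traj K R y (Suc t) = play_step K R (traj K R y t) (y (pull R (traj K R y t), Suc t))"

definition psum :: "(nat \<times> nat \<Rightarrow> nat) \<Rightarrow> nat \<Rightarrow> nat \<Rightarrow> nat \<Rightarrow> nat" where
  "psum y a s n = (\<Sum>l=1..n. y (a, s + l))"

text \<open>The state in which the running session began: within a session nothing changes but the
  three cleared fields.\<close>

definition fresh :: "player \<Rightarrow> player" where
  "fresh \<sigma> = \<sigma>\<lparr>pulls := 0, gain := 0, level := 0\<rparr>"

text \<open>Rank of a session in the lexicographic order of round and arm; each end of a session
  raises it by exactly one.\<close>

definition pos :: "nat \<Rightarrow> player \<Rightarrow> nat" where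
  "pos K \<sigma> = stage \<sigma> * K + arm \<sigma>"

section \<open>Regularity of slack and quota in the level\<close>

lemma floor_sqrt_Suc_le: "floor_sqrt (Suc n) \<le> Suc (floor_sqrt n)"
  by (simp add: floor_sqrt_Suc)

lemma floor_sqrt_lipschitz: "m \<le> n + d \<Longrightarrow> floor_sqrt m \<le> floor_sqrt n + d"
proof (induction d arbitrary: m)
  case 0
  then show ?case by (simp add: mono_floor_sqrt')
next
  case (Suc d)
  show ?case
  proof (cases "m = 0")
    case False
    then obtain m' where m': "m = Suc m'" by (cases m) auto
    with Suc.prems have "m' \<le> n + d" by simp
    from Suc.IH[OF this] floor_sqrt_Suc_le[of m'] m' show ?thesis by simp
  qed simp
qed

text \<open>\<open>min m (f - m)\<close> moves by at most one and \<open>floor_sqrt\<close> is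
  1-Lipschitz; past the focus the slack grows by exactly one, starting from 0 at f. Linear growth
  per level is negligible against the powers of 4.\<close>

lemma slack_Suc_le: "slack f (Suc m) \<le> Suc (slack f m)"
  unfolding slack_def
  using floor_sqrt_lipschitz[of "min (Suc m) (f - Suc m)" "min m (f - m)" 1]
  by (auto simp: min_def split: if_splits)

lemma slack_le_Suc: "slack f m \<le> Suc (slack f (Suc m))"
  unfolding slack_def
  using floor_sqrt_lipschitz[of "min m (f - m)" "min (Suc m) (f - Suc m)" 1]
  by (auto simp: min_def split: if_splits)

lemma slack_add_le: "slack f (m + j) \<le> slack f m + j"
  by (induction j) (auto intro: order_trans[OF slack_Suc_le])

lemma slack_le_max: "slack f m \<le> max f m"
  unfolding slack_def using floor_sqrt_le[of "min m (f - m)"] by auto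

lemma quota_pos: "quota R f r m > 0"
  by (simp add: quota_def)

lemma quota_le: "m \<le> R \<Longrightarrow> f \<le> R \<Longrightarrow> quota R f r m \<le> 4 ^ m * (256 * (R + 1))"
  using slack_le_max[of f m] by (auto simp: quota_def)

lemma quota_ge: "m \<le> R \<Longrightarrow> f \<le> R \<Longrightarrow> 16 * 4 ^ m * (1 + slack f m) \<le> quota R f r m"
proof -
  assume a: "m \<le> R" "f \<le> R"
  have "16 * (1 + slack f m) \<le> (if 2 * m < f + r then 16 * (1 + slack f m) else 256 * (R + 1))"
    using slack_le_max[of f m] a by auto
  from mult_left_mono[OF this, of "4 ^ m"]
  have "4 ^ m * (16 * (1 + slack f m)) \<le> quota R f r m" unfolding quota_def by simp
  then show ?thesis by (simp add: algebra_simps)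
qed

text \<open>A step tests \<open>n = quota\<close>, so a level whose quota had already been exceeded
  would never end. The factor 4 outweighs a slack that drops by at most one: 1 + slack at m is at
  most 2 + slack at m + 1, below 4 (1 + slack at m + 1).\<close>

lemma quota_mono_Suc:
  assumes "m < R" "f \<le> R"
  shows "quota R f r m < quota R f r (Suc m)"
proof -
  have "16 * (1 + slack f m) < 4 * (16 * (1 + slack f (Suc m)))"
    using slack_le_Suc[of f m] by simp
  moreover have "slack f m \<le> R" using slack_le_max[of f m] assms by simp
  ultimately have "(if 2 * m < f + r then 16 * (1 + slack f m) else 256 * (R + 1))
     < 4 * (if 2 * Suc m < f + r then 16 * (1 + slack f (Suc m)) else 256 * (R + 1))"
    by auto
  then have "4 ^ m * (if 2 * m < f + r then 16 * (1 + slack f m) else 256 * (R + 1))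
     < 4 ^ m * (4 * (if 2 * Suc m < f + r then 16 * (1 + slack f (Suc m)) else 256 * (R + 1)))"
    by (intro mult_strict_left_mono) auto
  then show ?thesis unfolding quota_def by (simp only: power_Suc mult.assoc mult.left_commute)
qed

section \<open>Trajectories and the invariant of a running session\<close>

lemma psum_0 [simp]: "psum y a s 0 = 0"
  by (simp add: psum_def)

lemma psum_Suc: "psum y a s (Suc n) = psum y a s n + y (a, s + Suc n)"
  by (simp add: psum_def)

lemma traj_cong:
  assumes "\<And>p. snd p \<le> t \<Longrightarrow> y p = y' p"
  shows "traj K R y t = traj K R y' t"
  using assms
proof (induction t)
  case (Suc t)
  have "traj K R y t = traj K R y' t" using Suc by simp
  with Suc.prems show ?case by simp
qed simp

text \<open>The session occupies the times \<open>t - pulls + 1\<close> to \<open>t\<close> and is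
  determined by the state at its start. The last clause recovers from the current state every test
  passed so far, with the quotas and the bar of the start.\<close>

definition inv :: "nat \<Rightarrow> nat \<Rightarrow> (nat \<times> nat \<Rightarrow> nat) \<Rightarrow> nat \<Rightarrow> player \<Rightarrow> bool" where
  "inv K R y t \<sigma> \<longleftrightarrow>
     arm \<sigma> < K \<and> champ \<sigma> < K \<and> stage \<sigma> \<le> R \<and> focus \<sigma> \<le> stage \<sigma> \<and> level \<sigma> \<le> stage \<sigma> \<and>
     pulls \<sigma> \<le> t \<and> pulls \<sigma> < quota R (focus \<sigma>) (stage \<sigma>) (level \<sigma>) \<and>
     traj K R y (t - pulls \<sigma>) = fresh \<sigma> \<and>
     gain \<sigma> = psum y (arm \<sigma>) (t - pulls \<sigma>) (pulls \<sigma>) \<and>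
     (\<forall>m<level \<sigma>. quota R (focus \<sigma>) (stage \<sigma>) m \<le> pulls \<sigma> \<and>
        \<not> fails R (bar \<sigma>) (quota R (focus \<sigma>) (stage \<sigma>) m)
            (psum y (arm \<sigma>) (t - pulls \<sigma>) (quota R (focus \<sigma>) (stage \<sigma>) m)) m)"

lemma inv_next_arm:
  assumes "arm \<sigma> < K" "champ \<sigma> < K" "stage \<sigma> < R" "focus \<sigma> \<le> stage \<sigma>"
    and "traj K R y t = next_arm K \<sigma>"
  shows "inv K R y t (next_arm K \<sigma>)"
  using assms unfolding inv_def next_arm_def fresh_def by (auto simp: quota_pos)

lemma inv_traj:
  assumes "K > 0"
  shows "inv K R y t (traj K R y t)"
proof (induction t)
  case 0
  show ?case using assms by (simp add: inv_def start_def fresh_def quota_pos)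
next
  case (Suc t)
  define \<sigma> where "\<sigma> = traj K R y t"
  define z where "z = y (pull R \<sigma>, Suc t)"
  have step: "traj K R y (Suc t) = play_step K R \<sigma> z" by (simp add: \<sigma>_def z_def)
  have I: "inv K R y t \<sigma>" using Suc by (simp add: \<sigma>_def)
  define n where "n = pulls \<sigma> + 1"
  define s where "s = gain \<sigma> + z"
  define m where "m = level \<sigma>"
  define q where "q = quota R (focus \<sigma>) (stage \<sigma>)"
  show ?case
  proof (cases "R \<le> stage \<sigma>")
    case True
    then have eq: "traj K R y (Suc t) = \<sigma>" using step by (simp add: play_step_def)
    have "stage \<sigma> = R" using I True by (simp add: inv_def)
    \<comment> \<open>A frozen state must be its own fresh state: the last round can end only
      through \<open>next_arm\<close>, which clears the counters.\<close>
    have p0: "pulls (traj K R y u) = 0 \<and> level (traj K R y u) = 0 \<and> gain (traj K R y u) = 0" if "R \<le> stage (traj K R y u)" for u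
      using that
    proof (induction u)
      case 0
      then show ?case by (simp add: start_def)
    next
      case (Suc u)
      show ?case
      proof (cases "R \<le> stage (traj K R y u)")
        case True
        then show ?thesis using Suc by (simp add: play_step_def)
      next
        case False
        with Suc.prems show ?thesis
          by (auto simp: play_step_def Let_def next_arm_def split: if_splits)
      qed
    qed
    from p0[of t] True have "pulls \<sigma> = 0" "level \<sigma> = 0" "gain \<sigma> = 0" by (auto simp: \<sigma>_def)
    then have "fresh \<sigma> = \<sigma>" by (simp add: fresh_def)
    then show ?thesis using I eq \<open>pulls \<sigma> = 0\<close> \<open>level \<sigma> = 0\<close> unfolding inv_def
      by (simp del: traj.simps)
  next
    case False
    have pl: "pull R \<sigma> = arm \<sigma>" using False by (simp add: pull_def)
    have le: "pulls \<sigma> \<le> t" and tr: "traj K R y (t - pulls \<sigma>) = fresh \<sigma>"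
      and g: "gain \<sigma> = psum y (arm \<sigma>) (t - pulls \<sigma>) (pulls \<sigma>)"
      and lt: "pulls \<sigma> < q m" and mst: "m \<le> stage \<sigma>" and fst': "focus \<sigma> \<le> stage \<sigma>"
      and old: "\<And>m'. m' < m \<Longrightarrow> q m' \<le> pulls \<sigma> \<and>
        \<not> fails R (bar \<sigma>) (q m') (psum y (arm \<sigma>) (t - pulls \<sigma>) (q m')) m'"
      using I by (auto simp: inv_def m_def q_def)
    have sn: "s = psum y (arm \<sigma>) (t - pulls \<sigma>) n"
      using g le by (simp add: s_def n_def z_def pl psum_Suc)
    have base: "Suc t - n = t - pulls \<sigma>" by (simp add: n_def)
    consider (go) "n \<noteq> q m" | (rej) "n = q m" "fails R (bar \<sigma>) n s m"
      | (up) "n = q m" "\<not> fails R (bar \<sigma>) n s m" "m < stage \<sigma>"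
      | (acc) "n = q m" "\<not> fails R (bar \<sigma>) n s m" "\<not> m < stage \<sigma>" by blast
    then show ?thesis
    proof cases
      case go
      then have eq: "traj K R y (Suc t) = \<sigma>\<lparr>pulls := n, gain := s\<rparr>"
        unfolding step play_step_def Let_def using False by (simp add: n_def s_def m_def q_def)
      have "n < q m" using go lt by (simp add: n_def)
      then show ?thesis unfolding eq using I old sn base le tr
        unfolding inv_def by (auto simp: fresh_def m_def q_def n_def intro: le_SucI)
    next
      case rej
      define \<sigma>2 where "\<sigma>2 = \<sigma>\<lparr>focus :=
            if focus \<sigma> + stage \<sigma> \<le> 2 * m \<and> bar \<sigma> * n * 2 ^ m \<le> s * 2 ^ m + 16 * n * grid R
            then m else focus \<sigma>\<rparr>"
      have eq: "traj K R y (Suc t) = next_arm K \<sigma>2"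
        unfolding step play_step_def Let_def n_def[symmetric] s_def[symmetric] m_def[symmetric]
        using rej False by (simp add: q_def \<sigma>2_def)
      show ?thesis unfolding eq
        by (rule inv_next_arm[OF _ _ _ _ eq]) (use I False mst fst' in \<open>simp_all add: inv_def \<sigma>2_def\<close>)
    next
      case up
      then have eq: "traj K R y (Suc t) = \<sigma>\<lparr>pulls := n, gain := s, level := m + 1\<rparr>"
        unfolding step play_step_def Let_def using False by (simp add: n_def s_def m_def q_def)
      have qq: "q m < q (Suc m)"
        unfolding q_def using up(3) I by (intro quota_mono_Suc) (auto simp: inv_def)
      have old': "q m' \<le> n \<and> \<not> fails R (bar \<sigma>) (q m') (psum y (arm \<sigma>) (t - pulls \<sigma>) (q m')) m'"
        if "m' < Suc m" for m'
      proof (cases "m' = m")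
        case True
        then show ?thesis using up(1,2) sn by simp
      next
        case False
        then show ?thesis using old[of m'] that by (simp add: n_def)
      qed
      have "n < q (Suc m)" using qq up(1) by simp
      moreover have "n \<le> Suc t" using le by (simp add: n_def)
      ultimately show ?thesis
        unfolding eq inv_def using I[unfolded inv_def] tr up(3) sn base old'[unfolded q_def]
        by (intro conjI allI impI) (simp_all add: fresh_def q_def m_def del: traj.simps)
    next
      case acc
      define \<sigma>2 where "\<sigma>2 = (if (bar \<sigma> + 1) * n * 2 ^ m + n * grid R \<le> s * 2 ^ m
           then \<sigma>\<lparr>bar := (s * 2 ^ m - n * grid R) div (n * 2 ^ m), champ := arm \<sigma>\<rparr>
           else \<sigma>)"
      have eq: "traj K R y (Suc t) = next_arm K \<sigma>2"
        unfolding step play_step_def Let_def n_def[symmetric] s_def[symmetric] m_def[symmetric]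
        using acc False by (simp add: q_def \<sigma>2_def)
      show ?thesis unfolding eq
        by (rule inv_next_arm[OF _ _ _ _ eq]) (use I False mst fst' in \<open>simp_all add: inv_def \<sigma>2_def\<close>)
    qed
  qed
qed

section \<open>Ranks of sessions and the integer tests as inequalities between means\<close>

lemma pos_next_arm: "arm \<sigma> < K \<Longrightarrow> pos K (next_arm K \<sigma>) = pos K \<sigma> + 1"
  by (auto simp: pos_def next_arm_def)

lemma next_arm_sel [simp]:
  "pulls (next_arm K \<sigma>) = 0" "bar (next_arm K \<sigma>) = bar \<sigma>" "focus (next_arm K \<sigma>) = focus \<sigma>"
  "champ (next_arm K \<sigma>) = champ \<sigma>"
  by (auto simp: next_arm_def)

lemma divide_pos_cancel:
  fixes a b c :: real
  assumes "0 < c"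
  shows "a / c \<le> b / c \<longleftrightarrow> a \<le> b" "a / c < b / c \<longleftrightarrow> a < b"
  using assms by (simp_all add: divide_le_cancel divide_less_cancel)

lemma fails_iff:
  assumes "n > 0"
  shows "fails R v n s m \<longleftrightarrow> real s / (real n * real (grid R)) + 2 / 2 ^ m < real v / real (grid R)"
proof -
  have Q: "real (grid R) > 0" by (simp add: grid_def)
  have "fails R v n s m \<longleftrightarrow> real (s * 2 ^ m + 2 * n * grid R) < real (v * n * 2 ^ m)"
    unfolding fails_def by (simp only: of_nat_less_iff)
  also have "\<dots> \<longleftrightarrow> (real s * 2 ^ m + 2 * real n * real (grid R)) / (real n * real (grid R) * 2 ^ m)
      < (real v * real n * 2 ^ m) / (real n * real (grid R) * 2 ^ m)"
    using assms Q by (subst divide_pos_cancel(2)) (auto simp: algebra_simps)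
  also have "(real s * 2 ^ m + 2 * real n * real (grid R)) / (real n * real (grid R) * 2 ^ m)
      = real s / (real n * real (grid R)) + 2 / 2 ^ m"
    using assms Q by (simp add: field_simps)
  also have "(real v * real n * 2 ^ m) / (real n * real (grid R) * 2 ^ m) = real v / real (grid R)"
    using assms Q by simp
  finally show ?thesis .
qed

lemma le_window_iff:
  assumes "n > 0"
  shows "v * n * 2 ^ m \<le> s * 2 ^ m + c * n * grid R \<longleftrightarrow>
     real v / real (grid R) \<le> real s / (real n * real (grid R)) + real c / 2 ^ m"
proof -
  have Q: "real (grid R) > 0" by (simp add: grid_def)
  have "v * n * 2 ^ m \<le> s * 2 ^ m + c * n * grid R \<longleftrightarrow>
      real (v * n * 2 ^ m) \<le> real (s * 2 ^ m + c * n * grid R)"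
    by (simp only: of_nat_le_iff)
  also have "\<dots> \<longleftrightarrow> (real v * real n * 2 ^ m) / (real n * real (grid R) * 2 ^ m)
     \<le> (real s * 2 ^ m + real c * real n * real (grid R)) / (real n * real (grid R) * 2 ^ m)"
    using assms Q by (subst divide_pos_cancel(1)) (auto simp: algebra_simps)
  also have "(real s * 2 ^ m + real c * real n * real (grid R)) / (real n * real (grid R) * 2 ^ m)
      = real s / (real n * real (grid R)) + real c / 2 ^ m"
    using assms Q by (simp add: field_simps)
  also have "(real v * real n * 2 ^ m) / (real n * real (grid R) * 2 ^ m) = real v / real (grid R)"
    using assms Q by simp
  finally show ?thesis .
qed

lemma raise_iff:
  assumes "n > 0"
  shows "(v + 1) * n * 2 ^ m + n * grid R \<le> s * 2 ^ m \<longleftrightarrow>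
     real v / real (grid R) + 1 / real (grid R) + 1 / 2 ^ m \<le> real s / (real n * real (grid R))"
proof -
  have Q: "real (grid R) > 0" by (simp add: grid_def)
  have "(v + 1) * n * 2 ^ m + n * grid R \<le> s * 2 ^ m \<longleftrightarrow>
      real ((v + 1) * n * 2 ^ m + n * grid R) \<le> real (s * 2 ^ m)"
    by (simp only: of_nat_le_iff)
  also have "\<dots> \<longleftrightarrow> ((real v + 1) * real n * 2 ^ m + real n * real (grid R)) / (real n * real (grid R) * 2 ^ m)
     \<le> (real s * 2 ^ m) / (real n * real (grid R) * 2 ^ m)"
    using assms Q by (subst divide_pos_cancel(1)) (auto simp: algebra_simps)
  also have "((real v + 1) * real n * 2 ^ m + real n * real (grid R)) / (real n * real (grid R) * 2 ^ m)
      = real v / real (grid R) + 1 / real (grid R) + 1 / 2 ^ m"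
    using assms Q by (simp add: field_simps)
  also have "(real s * 2 ^ m) / (real n * real (grid R) * 2 ^ m) = real s / (real n * real (grid R))"
    using assms Q by simp
  finally show ?thesis .
qed

text \<open>Rounding down to the grid loses less than one unit; the second assumption makes the
  truncated subtraction exact.\<close>

lemma raised_bounds:
  assumes "n > 0" "n * grid R \<le> s * 2 ^ m"
  defines "v \<equiv> (s * 2 ^ m - n * grid R) div (n * 2 ^ m)"
  shows "real v / real (grid R) \<le> real s / (real n * real (grid R)) - 1 / 2 ^ m"
    "real s / (real n * real (grid R)) - 1 / 2 ^ m - 1 / real (grid R) \<le> real v / real (grid R)"
proof -
  have Q: "real (grid R) > 0" by (simp add: grid_def)
  define a where "a = real s / (real n * real (grid R)) - 1 / 2 ^ m"
  have d: "n * 2 ^ m > 0" using assms by simp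
  have e: "real (s * 2 ^ m - n * grid R) = a * real (grid R) * (real n * 2 ^ m)"
    using assms(1,2) Q by (simp add: a_def of_nat_diff field_simps)
  have "v * (n * 2 ^ m) \<le> s * 2 ^ m - n * grid R" by (simp add: v_def)
  then have "real (v * (n * 2 ^ m)) \<le> a * real (grid R) * (real n * 2 ^ m)"
    unfolding e[symmetric] by (simp only: of_nat_le_iff)
  then have "real v * (real n * 2 ^ m) \<le> a * real (grid R) * (real n * 2 ^ m)" by simp
  then have 1: "real v \<le> a * real (grid R)" using d assms(1) by (subst (asm) mult_le_cancel_right) auto
  have "s * 2 ^ m - n * grid R < (v + 1) * (n * 2 ^ m)"
    unfolding v_def using dividend_less_times_div[OF d, of "s * 2 ^ m - n * grid R"] by (simp add: algebra_simps)
  then have "a * real (grid R) * (real n * 2 ^ m) < real ((v + 1) * (n * 2 ^ m))"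
    unfolding e[symmetric] by (simp only: of_nat_less_iff)
  then have "a * real (grid R) * (real n * 2 ^ m) < (real v + 1) * (real n * 2 ^ m)" by (simp add: algebra_simps)
  then have 2: "a * real (grid R) < real v + 1" using d assms(1) by (subst (asm) mult_less_cancel_right) auto
  from 1 show "real v / real (grid R) \<le> real s / (real n * real (grid R)) - 1 / 2 ^ m"
    using Q unfolding a_def[symmetric] by (simp add: divide_simps)
  from 2 show "real s / (real n * real (grid R)) - 1 / 2 ^ m - 1 / real (grid R) \<le> real v / real (grid R)"
    using pos_le_divide_eq[OF Q, of a "real v + 1"] unfolding a_def[symmetric]
    by (simp add: add_divide_distrib)
qed

text \<open>Rising to the next level counts as going on, since it touches neither the rank nor bar,
  focus and champion. What remains are the two ways in which a session can end.\<close>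

lemma traj_cases:
  assumes "stage (traj K R y u) < R" "K > 0"
  defines "\<sigma> \<equiv> traj K R y u"
  defines "\<sigma>' \<equiv> traj K R y (Suc u)"
  defines "n \<equiv> pulls \<sigma> + 1"
  defines "m \<equiv> level \<sigma>"
  defines "S \<equiv> psum y (arm \<sigma>) (u - pulls \<sigma>) n"
  obtains
    (go) "pos K \<sigma>' = pos K \<sigma>" "pulls \<sigma>' = n" "bar \<sigma>' = bar \<sigma>" "focus \<sigma>' = focus \<sigma>" "champ \<sigma>' = champ \<sigma>"
  | (reject) "n = quota R (focus \<sigma>) (stage \<sigma>) m" "fails R (bar \<sigma>) n S m"
      "\<sigma>' = next_arm K (\<sigma>\<lparr>focus :=
            if focus \<sigma> + stage \<sigma> \<le> 2 * m \<and> bar \<sigma> * n * 2 ^ m \<le> S * 2 ^ m + 16 * n * grid R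
            then m else focus \<sigma>\<rparr>)"
      "pos K \<sigma>' = pos K \<sigma> + 1"
  | (accept) "n = quota R (focus \<sigma>) (stage \<sigma>) m" "\<not> fails R (bar \<sigma>) n S m" "m = stage \<sigma>"
      "\<sigma>' = next_arm K
          (if (bar \<sigma> + 1) * n * 2 ^ m + n * grid R \<le> S * 2 ^ m
           then \<sigma>\<lparr>bar := (S * 2 ^ m - n * grid R) div (n * 2 ^ m), champ := arm \<sigma>\<rparr>
           else \<sigma>)"
      "pos K \<sigma>' = pos K \<sigma> + 1"
proof -
  have I: "inv K R y u \<sigma>" unfolding \<sigma>_def by (rule inv_traj[OF assms(2)])
  have pl: "pull R \<sigma> = arm \<sigma>" using assms(1) by (simp add: pull_def \<sigma>_def)
  have le: "pulls \<sigma> \<le> u" and a: "arm \<sigma> < K" and lv: "m \<le> stage \<sigma>" using I by (auto simp: inv_def m_def)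
  have S: "S = gain \<sigma> + y (arm \<sigma>, Suc u)"
    using I by (simp add: inv_def S_def n_def psum_Suc)
  have eq: "\<sigma>' = play_step K R \<sigma> (y (arm \<sigma>, Suc u))" by (simp add: \<sigma>'_def \<sigma>_def[symmetric] pl)
  have lt: "\<not> R \<le> stage \<sigma>" using assms(1) by (simp add: \<sigma>_def)
  consider (go) "n \<noteq> quota R (focus \<sigma>) (stage \<sigma>) m"
    | (rej) "n = quota R (focus \<sigma>) (stage \<sigma>) m" "fails R (bar \<sigma>) n S m"
    | (up) "n = quota R (focus \<sigma>) (stage \<sigma>) m" "\<not> fails R (bar \<sigma>) n S m" "m < stage \<sigma>"
    | (acc) "n = quota R (focus \<sigma>) (stage \<sigma>) m" "\<not> fails R (bar \<sigma>) n S m" "\<not> m < stage \<sigma>" by blast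
  then show ?thesis
  proof cases
    case go
    then show ?thesis using that(1) eq lt
      unfolding play_step_def Let_def n_def[symmetric] m_def[symmetric] S[symmetric]
      by (auto simp: pos_def)
  next
    case up
    then show ?thesis using that(1) eq lt
      unfolding play_step_def Let_def n_def[symmetric] m_def[symmetric] S[symmetric]
      by (auto simp: pos_def)
  next
    case rej
    then have e: "\<sigma>' = next_arm K (\<sigma>\<lparr>focus :=
            if focus \<sigma> + stage \<sigma> \<le> 2 * m \<and> bar \<sigma> * n * 2 ^ m \<le> S * 2 ^ m + 16 * n * grid R
            then m else focus \<sigma>\<rparr>)"
      using eq lt
      unfolding play_step_def Let_def n_def[symmetric] m_def[symmetric] S[symmetric] by simp
    moreover have "pos K \<sigma>' = pos K \<sigma> + 1"
      unfolding e by (subst pos_next_arm) (auto simp: a pos_def)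
    ultimately show ?thesis using that(2) rej by blast
  next
    case acc
    then have e: "\<sigma>' = next_arm K
          (if (bar \<sigma> + 1) * n * 2 ^ m + n * grid R \<le> S * 2 ^ m
           then \<sigma>\<lparr>bar := (S * 2 ^ m - n * grid R) div (n * 2 ^ m), champ := arm \<sigma>\<rparr>
           else \<sigma>)"
      using eq lt
      unfolding play_step_def Let_def n_def[symmetric] m_def[symmetric] S[symmetric] by simp
    moreover have "pos K \<sigma>' = pos K \<sigma> + 1"
      unfolding e by (subst pos_next_arm) (auto simp: a pos_def)
    ultimately show ?thesis using that(3) acc lv by (metis le_neq_implies_less)
  qed
qed

lemma traj_frozen: "R \<le> stage (traj K R y u) \<Longrightarrow> traj K R y (Suc u) = traj K R y u"
  by (simp add: play_step_def)

lemma pos_Suc: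
  assumes "K > 0"
  shows "pos K (traj K R y (Suc u)) = pos K (traj K R y u) \<or>
         pos K (traj K R y (Suc u)) = pos K (traj K R y u) + 1"
proof (cases "stage (traj K R y u) < R")
  case True
  from traj_cases[OF this assms] show ?thesis by metis
next
  case False
  then show ?thesis using traj_frozen[of R K y u] by (simp del: traj.simps)
qed

lemma pos_mono:
  assumes "K > 0" "u \<le> t"
  shows "pos K (traj K R y u) \<le> pos K (traj K R y t)"
  using assms(2)
proof (induction rule: dec_induct)
  case (step n)
  have "pos K (traj K R y n) \<le> pos K (traj K R y (Suc n))"
    using pos_Suc[OF assms(1), of R y n] by (elim disjE) (simp_all only: order_refl le_add1)
  with step.IH show ?case by (rule order_trans)
qed simp

lemma pos_eqD:
  assumes "stage \<sigma> * K + arm \<sigma> = r * K + a" "arm \<sigma> < K" "a < K"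
  shows "stage \<sigma> = r" "arm \<sigma> = a"
proof -
  have "(stage \<sigma> * K + arm \<sigma>) div K = stage \<sigma>" "(r * K + a) div K = r"
    "(stage \<sigma> * K + arm \<sigma>) mod K = arm \<sigma>" "(r * K + a) mod K = a" using assms(2,3) by auto
  then show "stage \<sigma> = r" "arm \<sigma> = a" using assms(1) by auto
qed

text \<open>The rank starts at 0 and moves in unit steps, so each smaller rank was left at some
  time; this provides the last step of any earlier session.\<close>

lemma pos_passed:
  assumes "K > 0" "p < pos K (traj K R y t)"
  obtains u where "u < t" "pos K (traj K R y u) = p" "pos K (traj K R y (Suc u)) = p + 1"
  using assms(2)
proof (induction t arbitrary: thesis)
  case 0
  then show ?case by (simp add: start_def pos_def)
next
  case (Suc t)
  show ?case
  proof (cases "p < pos K (traj K R y t)")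
    case True
    from Suc.IH[OF _ True] Suc.prems(1) show ?thesis by (metis less_Suc_eq)
  next
    case False
    then show ?thesis using Suc.prems(1)[of t] Suc.prems(2) pos_Suc[OF assms(1), of R y t] by auto
  qed
qed

text \<open>Within a session \<open>pulls\<close> is positive after the first step, so a sum over
  all times at which a given session begins has at most one nonzero term.\<close>

lemma start_unique:
  assumes "K > 0" "pulls (traj K R y s) = 0" "pulls (traj K R y s') = 0"
    "pos K (traj K R y s) = pos K (traj K R y s')" "stage (traj K R y s) < R"
  shows "s = s'"
proof -
  have *: False if "s < s'" "pulls (traj K R y s') = 0"
    "pos K (traj K R y s) = pos K (traj K R y s')" "stage (traj K R y s') < R" for s s'
  proof -
    have "s < s'" by (rule that(1))
    then obtain d where d: "s' = Suc (s + d)" using less_imp_Suc_add by blast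
    define u where "u = s + d"
    have u: "s' = Suc u" "s \<le> u" by (simp_all add: d u_def)
    have p: "pos K (traj K R y u) = pos K (traj K R y (Suc u))"
      using pos_mono[OF assms(1) u(2), of R y] pos_mono[OF assms(1), of u "Suc u" R y] that(3) u(1) by simp
    have st: "stage (traj K R y u) < R"
    proof (rule ccontr)
      assume "\<not> ?thesis"
      then have "traj K R y (Suc u) = traj K R y u" by (intro traj_frozen) auto
      with that(4) u(1) \<open>\<not> ?thesis\<close> show False by simp
    qed
    from traj_cases[OF st assms(1)] show False
      by (cases) (use p that(2) u(1) in auto)
  qed
  have "stage (traj K R y s') = stage (traj K R y s)"
    using pos_eqD(1)[of "traj K R y s'" K "stage (traj K R y s)" "arm (traj K R y s)"] assms(4)
      inv_traj[OF assms(1), of R y s] inv_traj[OF assms(1), of R y s'] by (simp add: pos_def inv_def)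
  then show ?thesis using *[of s s'] *[of s' s] assms by (metis linorder_neqE_nat)
qed

section \<open>Plays in which the confident tests are accurate\<close>

text \<open>The deterministic part. \<open>\<nu>\<close> is the scaled mean of the quantized
  rewards, which the samples estimate; \<open>\<mu>\<close> is the true mean, in which the regret is
  measured.\<close>

locale game =
  fixes K T R opt :: nat and \<nu> \<mu> :: "nat \<Rightarrow> real"
  assumes K_pos: "K > 0"
    and opt_less: "opt < K"
    and opt_max: "\<And>i. i < K \<Longrightarrow> \<mu> i \<le> \<mu> opt"
    and \<mu>_nonneg: "\<And>i. i < K \<Longrightarrow> 0 \<le> \<mu> i"
    and \<nu>_close: "\<And>i. i < K \<Longrightarrow> \<bar>\<nu> i - \<mu> i\<bar> \<le> 2 / real (grid R)"
begin

abbreviation tr where "tr \<equiv> traj K R"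

definition est :: "(nat \<times> nat \<Rightarrow> nat) \<Rightarrow> nat \<Rightarrow> nat \<Rightarrow> nat \<Rightarrow> real" where
  "est y a s n = real (psum y a s n) / (real n * real (grid R))"

definition confident :: "nat \<Rightarrow> nat" where
  "confident m = 4 ^ m * (256 * (R + 1))"

text \<open>Demanded at every time s and not just where a session begins, so that its complement is
  a plain union over pairs of a fixed time and a level.\<close>

definition good :: "(nat \<times> nat \<Rightarrow> nat) \<Rightarrow> bool" where
  "good y \<longleftrightarrow> (\<forall>s m. m \<le> R \<longrightarrow> s + confident m \<le> T \<longrightarrow> stage (tr y s) < R \<longrightarrow>
     \<bar>est y (arm (tr y s)) s (confident m) - \<nu> (arm (tr y s))\<bar> \<le> 1 / (8 * 2 ^ m))"

text \<open>Only errors downwards are recorded: they can drop the best arm or hide an arm from the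
  focus. An error upwards merely prolongs a session and is paid for by
  \<open>survive\<close>.\<close>

definition unlucky :: "(nat \<times> nat \<Rightarrow> nat) \<Rightarrow> nat \<Rightarrow> (nat \<times> nat) set" where
  "unlucky y t = {(j, r). \<exists>u<t. stage (tr y u) = r \<and> r < R \<and> arm (tr y u) = j \<and>
     pulls (tr y u) + 1 = quota R (focus (tr y u)) r (level (tr y u)) \<and>
     2 * level (tr y u) < focus (tr y u) + r \<and>
     est y j (u - pulls (tr y u)) (pulls (tr y u) + 1) < \<nu> j - 1 / 2 ^ level (tr y u)}"

definition V :: "player \<Rightarrow> real" where
  "V \<sigma> = real (bar \<sigma>) / real (grid R)"

lemma grid_ge: "m \<le> R \<Longrightarrow> 2 / real (grid R) \<le> 1 / 32 * (1 / 2 ^ m)"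
proof -
  assume "m \<le> R"
  then have "(2::real) ^ m \<le> 4 ^ R"
    by (intro order_trans[OF power_increasing[of m R "2::real"] power_mono]) auto
  then show ?thesis by (simp add: grid_def field_simps)
qed

lemma grid_ge': "m \<le> R \<Longrightarrow> 1 / real (grid R) \<le> 1 / 64 * (1 / 2 ^ m)"
  using grid_ge[of m] by simp

lemma inv: "inv K R y t (tr y t)"
  by (rule inv_traj[OF K_pos])

lemma invD:
  "arm (tr y t) < K" "champ (tr y t) < K" "stage (tr y t) \<le> R" "focus (tr y t) \<le> stage (tr y t)"
  "level (tr y t) \<le> stage (tr y t)" "pulls (tr y t) \<le> t"
  "tr y (t - pulls (tr y t)) = fresh (tr y t)"
  "m < level (tr y t) \<Longrightarrow> quota R (focus (tr y t)) (stage (tr y t)) m \<le> pulls (tr y t)"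
  "m < level (tr y t) \<Longrightarrow>
    \<not> fails R (bar (tr y t)) (quota R (focus (tr y t)) (stage (tr y t)) m)
            (psum y (arm (tr y t)) (t - pulls (tr y t)) (quota R (focus (tr y t)) (stage (tr y t)) m)) m"
  using inv[of y t] unfolding inv_def by blast+

lemma unlucky_mono: "s \<le> t \<Longrightarrow> unlucky y s \<subseteq> unlucky y t"
  unfolding unlucky_def using order_less_le_trans by blast

lemma quota_confident: "f + r \<le> 2 * m \<Longrightarrow> quota R f r m = confident m"
  by (simp add: quota_def confident_def)

text \<open>The error 1/8 granted by \<open>good\<close> and the rounding error 1/32 add up to less
  than 1/4 of 2^-m. The sample is the one begun at \<open>u - pulls\<close>, where the state is the
  fresh one.\<close>

lemma confident_est:
  assumes "good y" "u < T" "stage (tr y u) < R" "m \<le> R"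
    and "focus (tr y u) + stage (tr y u) \<le> 2 * m"
    and "quota R (focus (tr y u)) (stage (tr y u)) m \<le> pulls (tr y u) + 1"
  defines "e \<equiv> est y (arm (tr y u)) (u - pulls (tr y u)) (quota R (focus (tr y u)) (stage (tr y u)) m)"
  shows "\<bar>e - \<mu> (arm (tr y u))\<bar> \<le> 1 / 4 * (1 / 2 ^ m)"
proof -
  define s where "s = u - pulls (tr y u)"
  have s: "tr y s = fresh (tr y u)" unfolding s_def by (rule invD)
  have "s + confident m \<le> T"
    using assms(2,6) invD(6)[of y u] quota_confident[OF assms(5)] by (simp add: s_def)
  moreover have "stage (tr y s) < R" using assms(3) by (simp add: s fresh_def)
  ultimately have "\<bar>est y (arm (tr y s)) s (confident m) - \<nu> (arm (tr y s))\<bar> \<le> 1 / (8 * 2 ^ m)"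
    using assms(1,4) unfolding good_def by blast
  then have 1: "\<bar>e - \<nu> (arm (tr y u))\<bar> \<le> 1 / 8 * (1 / 2 ^ m)"
    using quota_confident[OF assms(5)] s by (simp add: e_def s_def[symmetric] fresh_def)
  have 2: "\<bar>\<nu> (arm (tr y u)) - \<mu> (arm (tr y u))\<bar> \<le> 1 / 32 * (1 / 2 ^ m)"
    using \<nu>_close[OF invD(1)[of y u]] grid_ge[OF assms(4)] by linarith
  show ?thesis
  proof -
    have "0 < 1 / (2::real) ^ m" by simp
    with 1 2 show ?thesis unfolding abs_le_iff by linarith
  qed
qed

lemma fails_est:
  "n > 0 \<Longrightarrow> fails R (bar \<sigma>) n (psum y a s n) m \<longleftrightarrow> est y a s n + 2 * (1 / 2 ^ m) < V \<sigma>"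
  by (simp add: fails_iff est_def V_def)

lemma bar_mono_step: "bar (tr y u) \<le> bar (tr y (Suc u))"
proof (cases "stage (tr y u) < R")
  case True
  show ?thesis
  proof (cases rule: traj_cases[OF True K_pos])
    case 3
    note accept = 3
    let ?P = "2 ^ level (tr y u) :: nat" and ?n = "pulls (tr y u) + 1"
    let ?S = "psum y (arm (tr y u)) (u - pulls (tr y u)) ?n"
    show ?thesis
    proof (cases "(bar (tr y u) + 1) * ?n * ?P + ?n * grid R \<le> ?S * ?P")
      case T: True
      have "bar (tr y u) * (?n * ?P) \<le> ?S * ?P - ?n * grid R"
        using T by (simp add: algebra_simps)
      then have "bar (tr y u) \<le> (?S * ?P - ?n * grid R) div (?n * ?P)"
        by (subst less_eq_div_iff_mult_less_eq) auto
      then show ?thesis using accept(4) T by simp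
    next
      case False
      then show ?thesis using accept(4) by simp
    qed
  qed simp_all
next
  case False
  then show ?thesis using traj_frozen[of R K y u] by (simp del: traj.simps)
qed

lemma bar_mono: "s \<le> t \<Longrightarrow> bar (tr y s) \<le> bar (tr y t)"
  by (rule lift_Suc_mono_le[of "\<lambda>u. bar (tr y u)"]) (rule bar_mono_step)

lemma V_mono: "s \<le> t \<Longrightarrow> V (tr y s) \<le> V (tr y t)"
  using bar_mono by (simp add: V_def divide_right_mono)

text \<open>An arm is accepted at level m = stage, and the focus never exceeds the stage, so the
  deciding test is confident. Its error is below 2^-m, the amount by which the new bar stays under
  the sample mean.\<close>

lemma V_le_champ:
  assumes "good y" "t \<le> T"
  shows "V (tr y t) \<le> \<mu> (champ (tr y t))"
  using assms(2)
proof (induction t)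
  case 0
  then show ?case using \<mu>_nonneg[of 0] K_pos by (simp add: V_def start_def)
next
  case (Suc u)
  then have IH: "V (tr y u) \<le> \<mu> (champ (tr y u))" and uT: "u < T" by auto
  show ?case
  proof (cases "stage (tr y u) < R")
    case True
    show ?thesis
    proof (cases rule: traj_cases[OF True K_pos])
      case 1
    note go = 1
      then show ?thesis using IH by (simp add: V_def)
    next
      case 2
    note reject = 2
      then show ?thesis using IH by (simp add: V_def)
    next
      case 3
    note accept = 3
      let ?m = "level (tr y u)" and ?n = "pulls (tr y u) + 1" and ?a = "arm (tr y u)"
      let ?S = "psum y ?a (u - pulls (tr y u)) ?n"
      show ?thesis
      proof (cases "(bar (tr y u) + 1) * ?n * 2 ^ ?m + ?n * grid R \<le> ?S * 2 ^ ?m")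
        case T: True
        have b: "?n * grid R \<le> ?S * 2 ^ ?m" using T by (rule add_leD2)
        have "\<bar>est y ?a (u - pulls (tr y u)) ?n - \<mu> ?a\<bar> \<le> 1 / 4 * (1 / 2 ^ ?m)"
          using confident_est[OF assms(1) uT True, of ?m] accept(1,3) True invD(4)[of y u] by simp
        moreover have "V (tr y (Suc u)) \<le> est y ?a (u - pulls (tr y u)) ?n - 1 / 2 ^ ?m"
          using raised_bounds(1)[OF _ b] T accept(4) by (simp add: V_def est_def)
        moreover have "0 < 1 / (2::real) ^ ?m" by simp
        ultimately have "V (tr y (Suc u)) \<le> \<mu> ?a" by linarith
        then show ?thesis using accept(4) T by simp
      next
        case False
        then show ?thesis using accept(4) IH by (simp add: V_def)
      qed
    qed
  next
    case False
    then show ?thesis using traj_frozen[of R K y u] IH by (simp del: traj.simps)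
  qed
qed

lemma V_le_opt: "good y \<Longrightarrow> t \<le> T \<Longrightarrow> V (tr y t) \<le> \<mu> opt"
  using V_le_champ[of y t] opt_max[OF invD(2)[of y t]] by simp

text \<open>The round in which the arm was last fully sampled controls the accuracy of the bar.\<close>

lemma V_ge_after_opt:
  assumes "good y" "t \<le> T" "r < R" "r * K + opt < pos K (tr y t)" "(opt, r) \<notin> unlucky y t"
  shows "\<mu> opt - 3 / 2 * (1 / 2 ^ r) \<le> V (tr y t)"
proof -
  obtain u where u: "u < t" "pos K (tr y u) = r * K + opt" "pos K (tr y (Suc u)) = r * K + opt + 1"
    using pos_passed[OF K_pos assms(4)] by blast
  have st: "stage (tr y u) = r" "arm (tr y u) = opt"
    using pos_eqD[OF _ invD(1) opt_less, of y u r] u(2) by (auto simp: pos_def)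
  have lt: "stage (tr y u) < R" using st assms(3) by simp
  have uT: "u < T" using u assms(2) by simp
  let ?m = "level (tr y u)" and ?n = "pulls (tr y u) + 1"
  let ?e = "est y opt (u - pulls (tr y u)) ?n"
  have Vo: "V (tr y u) \<le> \<mu> opt" using V_le_opt[OF assms(1)] uT by simp
  have mr: "?m \<le> r" using invD(5)[of y u] st by simp
  have p: "0 < 1 / (2::real) ^ ?m" by simp
  have "\<mu> opt - 3 / 2 * (1 / 2 ^ r) \<le> V (tr y (Suc u))"
  proof (cases rule: traj_cases[OF lt K_pos])
    case 1
    note go = 1
    then show ?thesis using u by simp
  next
    case 2
    note reject = 2
    have f: "?e + 2 * (1 / 2 ^ ?m) < V (tr y u)"
      using reject(2) st by (simp add: fails_est)
    show ?thesis
    proof (cases "2 * ?m < focus (tr y u) + r")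
      case True
      \<comment> \<open>The bar is at most \<open>\<mu> opt\<close>, so rejecting the best arm takes
        an error of nearly 2 / 2^m, which an unconfident test records as unlucky.\<close>
      have "\<nu> opt \<ge> \<mu> opt - 1 / 32 * (1 / 2 ^ ?m)"
        using \<nu>_close[OF opt_less] grid_ge[of ?m] mr assms(3) by (auto simp: abs_le_iff)
      then have "?e < \<nu> opt - 1 / 2 ^ ?m" using f Vo p by linarith
      then have "(opt, r) \<in> unlucky y t"
        unfolding unlucky_def using u(1) st assms(3) True reject(1) by auto
      with assms(5) show ?thesis by simp
    next
      case False
      then have "\<bar>?e - \<mu> opt\<bar> \<le> 1 / 4 * (1 / 2 ^ ?m)"
        using confident_est[OF assms(1) uT lt, of ?m] reject(1) st mr assms(3) by simp
      then show ?thesis using f Vo p by linarith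
    qed
  next
    case 3
    note accept = 3
    have e: "\<bar>?e - \<mu> opt\<bar> \<le> 1 / 4 * (1 / 2 ^ ?m)"
      using confident_est[OF assms(1) uT lt, of ?m] accept(1,3) lt invD(4)[of y u] st by simp
    have g: "1 / real (grid R) \<le> 1 / 64 * (1 / 2 ^ ?m)"
      using grid_ge'[of ?m] mr assms(3) by simp
    let ?S = "psum y opt (u - pulls (tr y u)) ?n"
    have "\<mu> opt - 3 / 2 * (1 / 2 ^ ?m) \<le> V (tr y (Suc u))"
    proof (cases "(bar (tr y u) + 1) * ?n * 2 ^ ?m + ?n * grid R \<le> ?S * 2 ^ ?m")
      case T: True
      have b: "?n * grid R \<le> ?S * 2 ^ ?m" using T by (rule add_leD2)
      have "?e - 1 / 2 ^ ?m - 1 / real (grid R) \<le> V (tr y (Suc u))"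
        using raised_bounds(2)[OF _ b] T accept(4) st by (simp add: V_def est_def)
      then show ?thesis using e g p by linarith
    next
      case False
      \<comment> \<open>If the bar is not raised, it already lies within 2^-m and one grid unit of
        the sample mean.\<close>
      then have "V (tr y (Suc u)) = V (tr y u)" using accept(4) st by (simp add: V_def)
      moreover have "?e < V (tr y u) + 1 / real (grid R) + 1 / 2 ^ ?m"
        using False raise_iff[of ?n "bar (tr y u)" ?m R ?S] by (simp add: V_def est_def)
      ultimately show ?thesis using e g p by linarith
    qed
    then show ?thesis using accept(3) st by simp
  qed
  also have "\<dots> \<le> V (tr y t)" using u(1) by (intro V_mono) simp
  finally show ?thesis .
qed

end

section \<open>Movement of the focus\<close>

lemma half_power_le: "a \<le> b \<Longrightarrow> 1 / (2::real) ^ b \<le> 1 / 2 ^ a"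
  by (simp add: frac_le)

context game
begin

text \<open>A new focus m satisfies 2 m \<ge> focus + stage, and the stage is at least the
  focus.\<close>

lemma focus_mono_step: "focus (tr y u) \<le> focus (tr y (Suc u))"
proof (cases "stage (tr y u) < R")
  case True
  show ?thesis
  proof (cases rule: traj_cases[OF True K_pos])
    case 2
    then show ?thesis using invD(4)[of y u] by simp
  qed simp_all
next
  case False
  then show ?thesis using traj_frozen[of R K y u] by (simp del: traj.simps)
qed

lemma focus_mono: "s \<le> t \<Longrightarrow> focus (tr y s) \<le> focus (tr y t)"
  by (rule lift_Suc_mono_le[of "\<lambda>u. focus (tr y u)"]) (rule focus_mono_step)

text \<open>An arm of gap about \<open>1 / 2 ^ k\<close> pulls the focus down to its own level.\<close>

lemma detected:
  assumes "good y" "Suc u \<le> T" "i < K" "r < R" "k + 2 \<le> r"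
    and gap: "1 / 2 ^ k \<le> \<mu> opt - \<mu> i" "\<mu> opt - \<mu> i < 2 * (1 / 2 ^ k)"
    and pos: "pos K (tr y u) = r * K + i" "pos K (tr y (Suc u)) = r * K + i + 1"
    and acc: "\<mu> opt - 1 / 4 * (1 / 2 ^ k) \<le> V (tr y u)"
    and opp: "focus (tr y u) + r + 2 \<le> 2 * k"
    and lucky: "(i, r) \<notin> unlucky y (Suc u)"
  shows "k \<le> focus (tr y (Suc u))"
proof -
  have st: "stage (tr y u) = r" "arm (tr y u) = i"
    using pos_eqD[OF _ invD(1) assms(3), of y u r] pos(1) by (auto simp: pos_def)
  have lt: "stage (tr y u) < R" using st assms(4) by simp
  have uT: "u < T" using assms(2) by simp
  let ?m = "level (tr y u)" and ?n = "pulls (tr y u) + 1"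
  let ?e = "est y i (u - pulls (tr y u)) ?n"
  have Vo: "V (tr y u) \<le> \<mu> opt" using V_le_opt[OF assms(1)] uT by simp
  have mr: "?m \<le> r" using invD(5)[of y u] st by simp
  have p: "0 < 1 / (2::real) ^ ?m" "0 < 1 / (2::real) ^ k" by simp_all
  show ?thesis
  proof (cases rule: traj_cases[OF lt K_pos])
    case 1
    then show ?thesis using pos by simp
  next
    case 2
    have f: "?e + 2 * (1 / 2 ^ ?m) < V (tr y u)"
      using 2(2) st by (simp add: fails_est)
    show ?thesis
    proof (cases "2 * ?m < focus (tr y u) + r")
      case True
      \<comment> \<open>\<open>opp\<close> keeps all unconfident levels at least two below k, where
        the gap is small against 2^-m; only an unlucky sample is rejected there.\<close>
      then have "?m + 2 \<le> k" using opp by simp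
      then have "1 / (2::real) ^ k \<le> 1 / 2 ^ (?m + 2)" by (rule half_power_le)
      then have km: "1 / (2::real) ^ k \<le> 1 / 4 * (1 / 2 ^ ?m)" by simp
      have "\<nu> i \<ge> \<mu> i - 1 / 32 * (1 / 2 ^ ?m)"
        using \<nu>_close[OF assms(3)] grid_ge[of ?m] mr assms(4) by (auto simp: abs_le_iff)
      then have "?e < \<nu> i - 1 / 2 ^ ?m" using f Vo p gap km by linarith
      then have "(i, r) \<in> unlucky y (Suc u)"
        unfolding unlucky_def using st assms(4) True 2(1) by auto
      with lucky show ?thesis by simp
    next
      case False
      have e: "\<bar>?e - \<mu> i\<bar> \<le> 1 / 4 * (1 / 2 ^ ?m)"
        using confident_est[OF assms(1) uT lt, of ?m] 2(1) st mr assms(4) False by simp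
      have km: "k \<le> ?m"
      proof (rule ccontr)
        assume "\<not> k \<le> ?m"
        then have "1 / (2::real) ^ k \<le> 1 / 2 ^ (?m + 1)" by (intro half_power_le) simp
        then have "1 / (2::real) ^ k \<le> 1 / 2 * (1 / 2 ^ ?m)" by simp
        with e f Vo gap p show False by linarith
      qed
      have mk: "?m \<le> k + 2"
      proof (rule ccontr)
        assume c: "\<not> ?m \<le> k + 2"
        \<comment> \<open>The level passed just before is still at least k + 2. By
          \<open>opp\<close> its test is confident too, so the arm would have failed there
          already.\<close>
        define m' where "m' = ?m - 1"
        have m': "m' < ?m" "k + 2 \<le> m'" "m' \<le> R" using c mr assms(4) by (auto simp: m'_def)
        let ?q = "quota R (focus (tr y u)) (stage (tr y u)) m'"
        have le: "?q \<le> pulls (tr y u)" by (rule invD(8)[OF m'(1)])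
        have "\<bar>est y i (u - pulls (tr y u)) ?q - \<mu> i\<bar> \<le> 1 / 4 * (1 / 2 ^ m')"
          using confident_est[OF assms(1) uT lt m'(3)] le st opp m'(2) by simp
        moreover have "\<not> est y i (u - pulls (tr y u)) ?q + 2 * (1 / 2 ^ m') < V (tr y u)"
          using invD(9)[OF m'(1)] fails_est[OF quota_pos] st by simp
        moreover have "1 / (2::real) ^ m' \<le> 1 / 2 ^ (k + 2)" using m'(2) by (rule half_power_le)
        then have "1 / (2::real) ^ m' \<le> 1 / 4 * (1 / 2 ^ k)" by simp
        ultimately show False using acc gap p by linarith
      qed
      \<comment> \<open>With k \<le> m \<le> k + 2 the gap is below 8 / 2^m, well inside the window
        of 16 / 2^m in which a rejection moves the focus.\<close>
      have "1 / (2::real) ^ (k + 2) \<le> 1 / 2 ^ ?m" using mk by (rule half_power_le)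
      then have "1 / (2::real) ^ k \<le> 4 * (1 / 2 ^ ?m)" by simp
      then have "V (tr y u) \<le> ?e + 16 * (1 / 2 ^ ?m)" using e Vo gap p by linarith
      then have "bar (tr y u) * ?n * 2 ^ ?m \<le> psum y i (u - pulls (tr y u)) ?n * 2 ^ ?m + 16 * ?n * grid R"
        by (subst le_window_iff) (simp_all add: est_def V_def)
      then show ?thesis using 2(3) st False km by simp
    qed
  next
    case 3
    have e: "\<bar>?e - \<mu> i\<bar> \<le> 1 / 4 * (1 / 2 ^ ?m)"
      using confident_est[OF assms(1) uT lt, of ?m] 3(1,3) lt invD(4)[of y u] st by simp
    have "\<not> ?e + 2 * (1 / 2 ^ ?m) < V (tr y u)"
      using 3(2) st by (simp add: fails_est)
    moreover have "1 / (2::real) ^ ?m \<le> 1 / 2 ^ (k + 2)" using assms(5) 3(3) st by (intro half_power_le) simp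
    then have "1 / (2::real) ^ ?m \<le> 1 / 4 * (1 / 2 ^ k)" by simp
    ultimately show ?thesis using acc gap p e by linarith
  qed
qed

lemma pos_stage_le: "r * K \<le> pos K (tr y u) \<longleftrightarrow> r \<le> stage (tr y u)"
proof
  assume "r * K \<le> pos K (tr y u)"
  then have "r * K < (stage (tr y u) + 1) * K" using invD(1)[of y u] by (simp add: pos_def)
  then show "r \<le> stage (tr y u)"
    by (metis mult_less_cancel2 Suc_eq_plus1 less_Suc_eq_le)
qed (auto simp: pos_def intro: trans_le_add1)

lemma pos_opt_less: "2 * b < stage (tr y u) \<Longrightarrow> j < K \<Longrightarrow> 2 * b * K + j < pos K (tr y u)"
proof -
  assume a: "2 * b < stage (tr y u)" "j < K"
  have "2 * b * K + j < (2 * b + 1) * K" using a(2) by simp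
  also have "\<dots> \<le> pos K (tr y u)" using a(1) pos_stage_le[of "2 * b + 1" y u] by simp
  finally show ?thesis .
qed

text \<open>A confident rejection proves the arm suboptimal, so its gap is at least 2^-h. If its
  mean is nevertheless within 16 / 2^m of the bar for some m > h + 7, the bar is far below
  \<open>\<mu> opt\<close>, which means that the best arm was unlucky in all the even rounds from h
  + 3 up to m. Only even rounds matter to \<open>spoiled\<close>.\<close>

lemma focus_bound_aux:
  assumes "good y" "t \<le> T" "g < K"
    and gap: "1 / 2 ^ h \<le> \<mu> opt - \<mu> g"
    and min: "\<And>i. i < K \<Longrightarrow> \<mu> i < \<mu> opt \<Longrightarrow> \<mu> i \<le> \<mu> g"
  shows "focus (tr y t) \<le> h + 7 \<or> (\<forall>b. h + 3 \<le> 2 * b \<longrightarrow> 2 * b < focus (tr y t) \<longrightarrow> (opt, 2 * b) \<in> unlucky y t)"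
  using assms(2)
proof (induction t)
  case 0
  then show ?case by (simp add: start_def)
next
  case (Suc u)
  then have IH: "focus (tr y u) \<le> h + 7 \<or> (\<forall>b. h + 3 \<le> 2 * b \<longrightarrow> 2 * b < focus (tr y u) \<longrightarrow> (opt, 2 * b) \<in> unlucky y u)"
    by simp
  have uT: "u < T" using Suc.prems by simp
  have mono: "unlucky y u \<subseteq> unlucky y (Suc u)" by (rule unlucky_mono) simp
  show ?case
  proof (cases "focus (tr y (Suc u)) = focus (tr y u)")
    case True
    show ?thesis unfolding True using IH mono by blast
  next
    case ne: False
    then have lt: "stage (tr y u) < R" using traj_frozen[of R K y u] by (metis not_le)
    let ?m = "level (tr y u)" and ?n = "pulls (tr y u) + 1" and ?a = "arm (tr y u)"
    let ?e = "est y ?a (u - pulls (tr y u)) ?n"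
    have Vo: "V (tr y u) \<le> \<mu> opt" using V_le_opt[OF assms(1)] uT by simp
    show ?thesis
    proof (cases rule: traj_cases[OF lt K_pos])
      case 2
      have c: "focus (tr y u) + stage (tr y u) \<le> 2 * ?m"
        and w: "bar (tr y u) * ?n * 2 ^ ?m \<le> psum y ?a (u - pulls (tr y u)) ?n * 2 ^ ?m + 16 * ?n * grid R"
        and fm: "focus (tr y (Suc u)) = ?m"
        using 2(3) ne by (auto split: if_splits)
      have mr: "?m \<le> R" using invD(5)[of y u] lt by simp
      have f: "?e + 2 * (1 / 2 ^ ?m) < V (tr y u)"
        using 2(2) by (simp add: fails_est)
      have w': "V (tr y u) \<le> ?e + 16 * (1 / 2 ^ ?m)"
        using w by (subst (asm) le_window_iff) (simp_all add: est_def V_def)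
      have e: "\<bar>?e - \<mu> ?a\<bar> \<le> 1 / 4 * (1 / 2 ^ ?m)"
        using confident_est[OF assms(1) uT lt mr c] 2(1) by simp
      have p: "0 < 1 / (2::real) ^ ?m" "0 < 1 / (2::real) ^ h" by simp_all
      show ?thesis
      proof (cases "?m \<le> h + 7")
        case False
        have "(opt, 2 * b) \<in> unlucky y u" if b: "h + 3 \<le> 2 * b" "2 * b < ?m" for b
        proof (rule ccontr)
          assume n: "(opt, 2 * b) \<notin> unlucky y u"
          have "2 * b < stage (tr y u)" using b(2) invD(5)[of y u] by simp
          with pos_opt_less[OF this opt_less] lt uT n
          have "\<mu> opt - 3 / 2 * (1 / 2 ^ (2 * b)) \<le> V (tr y u)"
            by (intro V_ge_after_opt[OF assms(1)]) auto
          moreover have "1 / (2::real) ^ (2 * b) \<le> 1 / 2 ^ (h + 3)" using b(1) by (rule half_power_le)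
          then have "1 / (2::real) ^ (2 * b) \<le> 1 / 8 * (1 / 2 ^ h)" by (simp add: power_add)
          moreover have "1 / (2::real) ^ ?m \<le> 1 / 2 ^ (h + 8)" using False by (intro half_power_le) simp
          then have "1 / (2::real) ^ ?m \<le> 1 / 256 * (1 / 2 ^ h)" by (simp add: power_add)
          ultimately have "\<mu> ?a > \<mu> opt - 1 / 2 ^ h" using e w' p by linarith
          moreover have "\<mu> ?a < \<mu> opt" using e f Vo p by linarith
          then have "\<mu> ?a \<le> \<mu> g" by (intro min) (auto intro: invD)
          ultimately show False using gap by linarith
        qed
        then show ?thesis unfolding fm using mono by blast
      qed (simp add: fm del: traj.simps)
    qed (use ne in \<open>simp_all del: traj.simps split: if_splits\<close>)
  qed
qed

section \<open>Blocks of two rounds and the delay\<close>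

definition block0 :: "nat \<Rightarrow> nat" where
  "block0 k = (k + 4) div 2"

text \<open>Block b gives round 2 b to the best arm, to lift the bar, and round 2 b + 1 to arm i, to
  attract the focus. Two rounds are taken because in a single one arm i may come before the best
  arm. Round \<open>2 * block0 k\<close> is the first even one from k + 3 on, where an accepted best
  arm makes the bar accurate to 2^-k / 4.\<close>

definition spoiled :: "nat \<Rightarrow> nat \<Rightarrow> nat \<Rightarrow> (nat \<times> nat) set \<Rightarrow> bool" where
  "spoiled i k n S \<longleftrightarrow>
     (\<forall>b. block0 k \<le> b \<longrightarrow> b < block0 k + n \<longrightarrow> (opt, 2 * b) \<in> S \<or> (i, 2 * b + 1) \<in> S)"

text \<open>The cap \<open>R\<close> makes the set finite; rounds from \<open>R\<close> on are never
  unlucky, so no block beyond them is spoiled in a play.\<close>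

definition delay :: "nat \<Rightarrow> nat \<Rightarrow> (nat \<times> nat) set \<Rightarrow> nat" where
  "delay i k S = Max {n. n \<le> R \<and> spoiled i k n S}"

lemma block0_bounds: "k + 3 \<le> 2 * block0 k" "2 * block0 k \<le> k + 4"
  by (auto simp: block0_def)

lemma spoiled_0: "spoiled i k 0 S"
  by (simp add: spoiled_def)

lemma delay_props:
  "delay i k S \<le> R" "spoiled i k (delay i k S) S"
  "n \<le> R \<Longrightarrow> spoiled i k n S \<Longrightarrow> n \<le> delay i k S"
proof -
  let ?A = "{n. n \<le> R \<and> spoiled i k n S}"
  have fin: "finite ?A" by (rule finite_subset[of _ "{..R}"]) auto
  have "0 \<in> ?A" by (simp add: spoiled_0)
  then have "Max ?A \<in> ?A" using fin by (intro Max_in) auto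
  then show "delay i k S \<le> R" "spoiled i k (delay i k S) S" by (auto simp: delay_def)
  show "n \<le> delay i k S" if "n \<le> R" "spoiled i k n S"
    unfolding delay_def using that fin by (intro Max_ge) auto
qed

lemma delay_mono: "S \<subseteq> S' \<Longrightarrow> delay i k S \<le> delay i k S'"
  by (rule delay_props(3)[OF delay_props(1)]) (use delay_props(2)[of i k S] in \<open>auto simp: spoiled_def\<close>)

lemma delay_block:
  assumes "delay i k S < R"
  shows "(opt, 2 * (block0 k + delay i k S)) \<notin> S" "(i, 2 * (block0 k + delay i k S) + 1) \<notin> S"
proof -
  let ?x = "delay i k S"
  have "\<not> spoiled i k (Suc ?x) S" using delay_props(3)[of "Suc ?x" i k S] assms by auto
  then obtain b where b: "block0 k \<le> b" "b < block0 k + Suc ?x" "(opt, 2 * b) \<notin> S" "(i, 2 * b + 1) \<notin> S"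
    by (auto simp: spoiled_def)
  moreover have "\<not> b < block0 k + ?x" using delay_props(2)[of i k S] b by (auto simp: spoiled_def)
  ultimately have "b = block0 k + ?x" by simp
  with b show "(opt, 2 * (block0 k + ?x)) \<notin> S" "(i, 2 * (block0 k + ?x) + 1) \<notin> S" by auto
qed

lemma V_ge_block:
  assumes "good y" "s \<le> t" "s \<le> T" "2 * b < R" "h + 3 \<le> 2 * b" "2 * b < stage (tr y s)" "(opt, 2 * b) \<notin> unlucky y s"
  shows "\<mu> opt - 1 / 4 * (1 / 2 ^ h) \<le> V (tr y t)"
proof -
  have "\<mu> opt - 3 / 2 * (1 / 2 ^ (2 * b)) \<le> V (tr y s)"
    using pos_opt_less[OF assms(6) opt_less] by (intro V_ge_after_opt assms)
  moreover have "1 / (2::real) ^ (2 * b) \<le> 1 / 2 ^ (h + 3)" using assms(5) by (rule half_power_le)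
  then have "1 / (2::real) ^ (2 * b) \<le> 1 / 8 * (1 / 2 ^ h)" by (simp add: power_add)
  moreover have "V (tr y s) \<le> V (tr y t)" using assms(2) by (rule V_mono)
  moreover have "0 < 1 / (2::real) ^ h" by simp
  ultimately show ?thesis by linarith
qed

text \<open>In the first block that is not spoiled the best arm lifts the bar, after which
  \<open>detected\<close> applies to arm i, unless the focus is already too close to k for its
  premise, which gives the second bound directly.\<close>

lemma settled:
  assumes "good y" "s \<le> T" "i < K" "stage (tr y s) = r" "r < R"
    and gap: "1 / 2 ^ k \<le> \<mu> opt - \<mu> i" "\<mu> opt - \<mu> i < 2 * (1 / 2 ^ k)"
  defines "x \<equiv> delay i k (unlucky y s)"
  assumes late: "2 * (block0 k + x) + 2 \<le> r"
  shows "\<mu> opt - 1 / 4 * (1 / 2 ^ k) \<le> V (tr y s)" "k \<le> focus (tr y s) + 2 * x + 6"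
proof -
  let ?b = "block0 k + x"
  have xR: "x < R" using late assms(5) by simp
  have nb: "(opt, 2 * ?b) \<notin> unlucky y s" "(i, 2 * ?b + 1) \<notin> unlucky y s"
    using delay_block[of i k "unlucky y s"] xR by (simp_all add: x_def)
  have kb: "k + 3 \<le> 2 * ?b" "2 * ?b \<le> k + 4 + 2 * x" using block0_bounds[of k] by auto
  show "\<mu> opt - 1 / 4 * (1 / 2 ^ k) \<le> V (tr y s)"
    using late assms(2,4,5) nb kb by (intro V_ge_block[OF assms(1), of s _ ?b]) auto
  have "(2 * ?b + 1) * K + i < (2 * ?b + 1 + 1) * K" using assms(3) by simp
  also have "\<dots> \<le> pos K (tr y s)" using pos_stage_le[of "2 * ?b + 1 + 1" y s] late assms(4) by simp
  finally obtain u where u: "u < s" "pos K (tr y u) = (2 * ?b + 1) * K + i"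
    "pos K (tr y (Suc u)) = (2 * ?b + 1) * K + i + 1"
    using pos_passed[OF K_pos] by blast
  have us: "unlucky y u \<subseteq> unlucky y s" "unlucky y (Suc u) \<subseteq> unlucky y s"
    using u(1) by (auto intro!: unlucky_mono)
  have su: "stage (tr y u) = 2 * ?b + 1"
    using pos_eqD(1)[OF _ invD(1) assms(3), of y u "2 * ?b + 1"] u(2) by (simp add: pos_def)
  have acc: "\<mu> opt - 1 / 4 * (1 / 2 ^ k) \<le> V (tr y u)"
    using late assms(2,5) nb kb us su u(1) by (intro V_ge_block[OF assms(1), of u _ ?b]) auto
  show "k \<le> focus (tr y s) + 2 * x + 6"
  proof (cases "focus (tr y u) + (2 * ?b + 1) + 2 \<le> 2 * k")
    case True
    have "k \<le> focus (tr y (Suc u))"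
      using u assms(2,3,5) late kb us nb
      by (intro detected[OF assms(1) _ assms(3) _ _ gap u(2,3) acc True]) auto
    also have "\<dots> \<le> focus (tr y s)" using u(1) by (intro focus_mono) simp
    finally show ?thesis by simp
  next
    case False
    have "focus (tr y u) \<le> focus (tr y s)" using u(1) by (intro focus_mono) simp
    \<comment> \<open>Here 2 k < focus + 2 b + 3 while 2 b \<le> k + 4 + 2 x, hence k \<le> focus +
      2 x + 6.\<close>
    with False kb show ?thesis by simp
  qed
qed

text \<open>A larger focus would make the best arm unlucky in one more block than the delay counts,
  against the maximality of the delay.\<close>

lemma focus_bound:
  assumes "good y" "t \<le> T" "g < K"
    and gap: "1 / 2 ^ h \<le> \<mu> opt - \<mu> g"
    and min: "\<And>i. i < K \<Longrightarrow> \<mu> i < \<mu> opt \<Longrightarrow> \<mu> i \<le> \<mu> g"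
  shows "focus (tr y t) \<le> h + 7 + 2 * delay g h (unlucky y t)"
proof (rule ccontr)
  let ?x = "delay g h (unlucky y t)"
  assume c: "\<not> ?thesis"
  then have all: "(opt, 2 * b) \<in> unlucky y t" if "h + 3 \<le> 2 * b" "2 * b < focus (tr y t)" for b
    using focus_bound_aux[OF assms(1-4) min] that by auto
  have xR: "Suc ?x \<le> R" using c invD(3,4)[of y t] by simp
  have "spoiled g h (Suc ?x) (unlucky y t)"
    unfolding spoiled_def using all block0_bounds[of h] c by auto
  from delay_props(3)[OF xR this] show False by simp
qed

text \<open>With more rounds than that, an unspoiled block would have lifted the bar above
  \<open>\<mu> i\<close>, while the mean of the champion is never below the bar.\<close>

lemma committed:
  assumes "good y" "t \<le> T" "stage (tr y t) = R" "champ (tr y t) = i" "1 / 2 ^ k \<le> \<mu> opt - \<mu> i"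
  shows "R \<le> k + 4 + 2 * delay i k (unlucky y t)"
proof (rule ccontr)
  let ?x = "delay i k (unlucky y t)"
  assume c: "\<not> ?thesis"
  have "(opt, 2 * (block0 k + ?x)) \<notin> unlucky y t" by (rule delay_block) (use c in simp)
  moreover have "k + 3 \<le> 2 * (block0 k + ?x)" "2 * (block0 k + ?x) \<le> k + 4 + 2 * ?x"
    using block0_bounds[of k] by auto
  ultimately have "\<mu> opt - 1 / 4 * (1 / 2 ^ k) \<le> V (tr y t)"
    using assms(2,3) c by (intro V_ge_block[OF assms(1), of t t "block0 k + ?x"]) auto
  moreover have "V (tr y t) \<le> \<mu> i" using V_le_champ[OF assms(1,2)] assms(4) by simp
  moreover have "0 < 1 / (2::real) ^ k" by simp
  ultimately show False using assms(5) by linarith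
qed

end

section \<open>Probabilities of failures\<close>

lemma expectation_pmf_cong:
  fixes f g :: "'a \<Rightarrow> real"
  assumes "\<And>x. x \<in> set_pmf p \<Longrightarrow> f x = g x"
  shows "measure_pmf.expectation p f = measure_pmf.expectation p g"
  by (intro Bochner_Integration.integral_cong_AE AE_pmfI) (simp_all add: assms)

lemma expectation_pair_pmf_finite:
  fixes h :: "'a \<times> 'b \<Rightarrow> real"
  assumes "finite (set_pmf p)" "finite (set_pmf q)"
  shows "measure_pmf.expectation (pair_pmf p q) h
       = measure_pmf.expectation p (\<lambda>a. measure_pmf.expectation q (\<lambda>b. h (a, b)))"
proof -
  have 1: "measure_pmf.expectation (bind_pmf q (\<lambda>b. return_pmf (a, b))) h
      = measure_pmf.expectation q (\<lambda>b. h (a, b))" for a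
    by (subst pmf_expectation_bind[OF assms(2)])
       (auto simp: integral_measure_pmf_real[OF assms(2)] mult.commute)
  show ?thesis unfolding pair_pmf_def
    by (subst pmf_expectation_bind[OF assms(1)])
       (use assms in \<open>auto simp: 1 integral_measure_pmf_real[OF assms(1)] mult.commute\<close>)
qed

text \<open>The future coordinates are independent of the past ones, even when the event looked at in
  the future is chosen on the basis of the past.\<close>

lemma Pi_pmf_past_future:
  fixes p :: "'a \<Rightarrow> 'b pmf" and f :: "('a \<Rightarrow> 'b) \<Rightarrow> real" and d :: 'b
  assumes fin: "finite I" "\<And>x. x \<in> I \<Longrightarrow> finite (set_pmf (p x))" and A: "A \<subseteq> I"
  defines "pm \<equiv> Pi_pmf I d p"
  assumes f: "\<And>y. y \<in> set_pmf pm \<Longrightarrow> f y = f (\<lambda>x. if x \<in> A then y x else d)"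
    and c: "\<And>y. y \<in> set_pmf pm \<Longrightarrow> c y = c (\<lambda>x. if x \<in> A then y x else d)"
    and G: "\<And>v y. y \<in> set_pmf pm \<Longrightarrow> G v y = G v (\<lambda>x. if x \<in> I - A then y x else d)"
    and nonneg: "\<And>y. 0 \<le> f y"
    and q: "\<And>y. y \<in> set_pmf pm \<Longrightarrow> measure_pmf.expectation pm (\<lambda>z. of_bool (G (c y) z)) \<le> q"
  shows "measure_pmf.expectation pm (\<lambda>y. f y * of_bool (G (c y) y))
     \<le> measure_pmf.expectation pm f * q"
proof -
  define B where "B = I - A"
  define PA where "PA = Pi_pmf A d p"
  define PB where "PB = Pi_pmf B d p"
  define mg where "mg = (\<lambda>(a, b) x. if x \<in> A then a x else (b x :: 'b))"
  define rA where "rA = (\<lambda>y x. if x \<in> A then y x else d)"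
  define rB where "rB = (\<lambda>y x. if x \<in> B then y x else d)"
  have finA: "finite A" "finite B" using A fin(1) finite_subset by (auto simp: B_def)
  have I: "I = A \<union> B" using A by (auto simp: B_def)
  have pm: "pm = map_pmf mg (pair_pmf PA PB)"
    unfolding pm_def I PA_def PB_def mg_def
    using Pi_pmf_union[OF finA, of d p] by (auto simp: B_def)
  have fs: "finite (set_pmf PA)" "finite (set_pmf PB)"
    unfolding PA_def PB_def set_Pi_pmf[OF finA(1)] set_Pi_pmf[OF finA(2)]
    using finA fin(2) A by (auto intro!: finite_PiE_dflt simp: B_def)
  have rmA: "rA (mg (a, b)) = a" if "a \<in> set_pmf PA" for a b
    using that finA set_Pi_pmf_subset[OF finA(1), of d p] by (auto simp: rA_def mg_def PA_def fun_eq_iff)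
  have rmB: "rB (mg (a, b)) = b" if "b \<in> set_pmf PB" for a b
    using that finA set_Pi_pmf_subset[OF finA(2), of d p] by (auto simp: rB_def mg_def PB_def fun_eq_iff B_def)
  have sup: "mg (a, b) \<in> set_pmf pm" if "a \<in> set_pmf PA" "b \<in> set_pmf PB" for a b
    unfolding pm using that by auto
  have EX: "measure_pmf.expectation pm h =
      measure_pmf.expectation PA (\<lambda>a. measure_pmf.expectation PB (\<lambda>b. h (mg (a, b))))" for h :: "_ \<Rightarrow> real"
    unfolding pm integral_map_pmf by (rule expectation_pair_pmf_finite[OF fs])
  have Eq: "measure_pmf.expectation PB (\<lambda>b. of_bool (G (c y) b)) \<le> q" if y: "y \<in> set_pmf pm" for y
  proof -
    have "measure_pmf.expectation PB (\<lambda>b. of_bool (G (c y) b) :: real)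
       = measure_pmf.expectation PA (\<lambda>a. measure_pmf.expectation PB (\<lambda>b. of_bool (G (c y) b)))" by simp
    also have "\<dots> = measure_pmf.expectation PA (\<lambda>a. measure_pmf.expectation PB (\<lambda>b. of_bool (G (c y) (mg (a, b)))))"
    proof (rule expectation_pmf_cong)
      fix a assume a: "a \<in> set_pmf PA"
      show "measure_pmf.expectation PB (\<lambda>b. of_bool (G (c y) b))
        = measure_pmf.expectation PB (\<lambda>b. of_bool (G (c y) (mg (a, b))) :: real)"
      proof (rule expectation_pmf_cong)
        fix b assume b: "b \<in> set_pmf PB"
        show "of_bool (G (c y) b) = (of_bool (G (c y) (mg (a, b))) :: real)"
          using G[OF sup[OF a b], of "c y"] rmB[OF b, of a] by (simp add: rB_def B_def)
      qed
    qed
    also have "\<dots> = measure_pmf.expectation pm (\<lambda>z. of_bool (G (c y) z))" by (simp add: EX)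
    also have "\<dots> \<le> q" by (rule q[OF y])
    finally show ?thesis .
  qed
  have "measure_pmf.expectation pm (\<lambda>y. f y * of_bool (G (c y) y))
    = measure_pmf.expectation PA (\<lambda>a. f a * measure_pmf.expectation PB (\<lambda>b. of_bool (G (c a) b)))"
    unfolding EX
  proof (rule expectation_pmf_cong)
    fix a assume a: "a \<in> set_pmf PA"
    have "measure_pmf.expectation PB (\<lambda>b. f (mg (a, b)) * of_bool (G (c (mg (a, b))) (mg (a, b))))
      = measure_pmf.expectation PB (\<lambda>b. f a * of_bool (G (c a) b))"
    proof (rule expectation_pmf_cong)
      fix b assume b: "b \<in> set_pmf PB"
      have "f (mg (a, b)) = f a" "c (mg (a, b)) = c a"
        using f[OF sup[OF a b]] c[OF sup[OF a b]] rmA[OF a, of b] by (simp_all add: rA_def)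
      moreover have "G (c a) (mg (a, b)) = G (c a) b"
        using G[OF sup[OF a b], of "c a"] rmB[OF b, of a] by (simp add: rB_def B_def)
      ultimately show "f (mg (a, b)) * of_bool (G (c (mg (a, b))) (mg (a, b))) = f a * of_bool (G (c a) b)" by simp
    qed
    then show "measure_pmf.expectation PB (\<lambda>b. f (mg (a, b)) * of_bool (G (c (mg (a, b))) (mg (a, b))))
      = f a * measure_pmf.expectation PB (\<lambda>b. of_bool (G (c a) b))" by simp
  qed
  also have "\<dots> \<le> measure_pmf.expectation PA (\<lambda>a. f a * q)"
  proof (intro integral_mono_AE AE_pmfI integrable_measure_pmf_finite fs)
    fix a assume a: "a \<in> set_pmf PA"
    obtain b where b: "b \<in> set_pmf PB" using set_pmf_not_empty by fast
    have "c (mg (a, b)) = c a"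
      using c[OF sup[OF a b]] rmA[OF a, of b] by (simp_all add: rA_def)
    with Eq[OF sup[OF a b]] nonneg[of a]
    show "f a * measure_pmf.expectation PB (\<lambda>b. of_bool (G (c a) b)) \<le> f a * q"
      by (intro mult_left_mono) auto
  qed
  also have "\<dots> = measure_pmf.expectation PA f * q" by simp
  also have "measure_pmf.expectation PA f = measure_pmf.expectation pm f"
    unfolding EX
  proof (rule expectation_pmf_cong)
    fix a assume a: "a \<in> set_pmf PA"
    have "measure_pmf.expectation PB (\<lambda>b. f (mg (a, b))) = measure_pmf.expectation PB (\<lambda>b. f a)"
      using f[OF sup[OF a]] rmA[OF a]
      by (intro expectation_pmf_cong) (simp_all add: rA_def)
    then show "f a = measure_pmf.expectation PB (\<lambda>b. f (mg (a, b)))" by simp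
  qed
  finally show ?thesis .
qed

section \<open>Tables of independent quantized rewards\<close>

locale random_game = game K T R opt \<nu> \<mu> for K T R opt \<nu> \<mu> +
  fixes \<rho> :: "nat \<Rightarrow> nat pmf"
  assumes supp: "\<And>i. i < K \<Longrightarrow> set_pmf (\<rho> i) \<subseteq> {..grid R}"
    and \<nu>_eq: "\<And>i. i < K \<Longrightarrow> \<nu> i = measure_pmf.expectation (\<rho> i) real / real (grid R)"
    and T_le: "T \<le> 4 ^ R"
begin

definition pm :: "(nat \<times> nat \<Rightarrow> nat) pmf" where
  "pm = Pi_pmf ({..<K} \<times> {1..T}) 0 (\<lambda>p. \<rho> (fst p))"

abbreviation Ex :: "((nat \<times> nat \<Rightarrow> nat) \<Rightarrow> real) \<Rightarrow> real" where
  "Ex \<equiv> measure_pmf.expectation pm"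

lemma finite_supp: "i < K \<Longrightarrow> finite (set_pmf (\<rho> i))"
  using finite_subset[OF supp] by simp

lemma finite_pm: "finite (set_pmf pm)"
  unfolding pm_def by (subst set_Pi_pmf) (auto intro!: finite_PiE_dflt simp: finite_supp)

lemma pm_outside:
  assumes "y \<in> set_pmf pm" "q \<notin> {..<K} \<times> {1..T}"
  shows "y q = 0"
proof -
  have "finite ({..<K} \<times> {1..T})" by simp
  from set_Pi_pmf_subset[OF this, of 0 "\<lambda>p. \<rho> (fst p)"] assms show ?thesis
    unfolding pm_def by blast
qed

lemma integrable_Ex [simp, intro]: "integrable (measure_pmf pm) (f :: _ \<Rightarrow> real)"
  by (rule integrable_measure_pmf_finite[OF finite_pm])

lemma Ex_mono: "(\<And>y. y \<in> set_pmf pm \<Longrightarrow> f y \<le> g y) \<Longrightarrow> Ex f \<le> Ex g"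
  by (intro integral_mono_AE AE_pmfI) auto

lemma Ex_of_bool: "Ex (\<lambda>y. of_bool (P y)) = measure_pmf.prob pm {y. P y}"
proof -
  have "(\<lambda>y. of_bool (P y) :: real) = indicator {y. P y}" by (auto simp: indicator_def)
  then show ?thesis by simp
qed

text \<open>Past and future are split at the fixed time s: f is a weight and c a decision (a focus
  or an arm) that depend on rewards up to s, whereas \<open>G v\<close> looks only at later
  ones.\<close>

lemma session:
  assumes f: "\<And>y y'. (\<And>p. snd p \<le> s \<Longrightarrow> y p = y' p) \<Longrightarrow> f y = f y'"
    and c: "\<And>y y'. (\<And>p. snd p \<le> s \<Longrightarrow> y p = y' p) \<Longrightarrow> c y = c y'"
    and G: "\<And>v y y'. (\<And>p. s < snd p \<Longrightarrow> y p = y' p) \<Longrightarrow> G v y = G v y'"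
    and nonneg: "\<And>y. 0 \<le> f y"
    and q: "\<And>y. Ex (\<lambda>z. of_bool (G (c y) z)) \<le> q"
  shows "Ex (\<lambda>y. f y * of_bool (G (c y) y)) \<le> Ex f * q"
proof -
  let ?I = "{..<K} \<times> {1..T}"
  let ?A = "{p \<in> ?I. snd p \<le> s}"
  show ?thesis unfolding pm_def
  proof (rule Pi_pmf_past_future[where A = ?A and f = f and c = c and G = G])
    fix y assume "y \<in> set_pmf (Pi_pmf ?I 0 (\<lambda>p. \<rho> (fst p)))"
    then have y: "y p = 0" if "p \<notin> ?I" for p using pm_outside[of y p] that by (simp add: pm_def)
    show "f y = f (\<lambda>x. if x \<in> ?A then y x else 0)"
      by (rule f) (use y in auto)
    show "c y = c (\<lambda>x. if x \<in> ?A then y x else 0)"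
      by (rule c) (use y in auto)
    show "G v y = G v (\<lambda>x. if x \<in> ?I - ?A then y x else 0)" for v
      by (rule G) (use y in auto)
    show "measure_pmf.expectation (Pi_pmf ?I 0 (\<lambda>p. \<rho> (fst p))) (\<lambda>z. of_bool (G (c y) z)) \<le> q"
      using q[of y] by (simp add: pm_def)
  qed (auto simp: finite_supp nonneg)
qed

lemma hoeffding:
  assumes j: "j < K" and n: "0 < n" "s + n \<le> T" and \<delta>: "0 \<le> \<delta>"
  shows "Ex (\<lambda>y. of_bool (est y j s n \<le> \<nu> j - \<delta>)) \<le> exp (- 2 * real n * \<delta>\<^sup>2)"
    and "Ex (\<lambda>y. of_bool (\<nu> j + \<delta> \<le> est y j s n)) \<le> exp (- 2 * real n * \<delta>\<^sup>2)"
proof -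
  let ?I = "{..<K} \<times> {1..T}"
  let ?J = "(\<lambda>l. (j, s + l)) ` {1..n}"
  have JI: "?J \<subseteq> ?I" using j n by auto
  have Q: "real (grid R) > 0" by (simp add: grid_def)
  interpret Hoeffding_ineq "measure_pmf pm" ?J "\<lambda>p y. real (y p)" "\<lambda>_. 0" "\<lambda>_. real (grid R)"
    "\<Sum>p\<in>?J. measure_pmf.expectation pm (\<lambda>y. real (y p))"
  proof unfold_locales
    have "prob_space.indep_vars (measure_pmf pm) (\<lambda>_. count_space UNIV) (\<lambda>x f. f x) ?I"
      unfolding pm_def by (rule indep_vars_Pi_pmf) auto
    then have "prob_space.indep_vars (measure_pmf pm) (\<lambda>_. count_space UNIV) (\<lambda>x f. f x) ?J"
      using JI by (rule prob_space.indep_vars_subset[OF measure_pmf.prob_space_axioms])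
    then show "prob_space.indep_vars (measure_pmf pm) (\<lambda>_. borel) (\<lambda>p y. real (y p)) ?J"
      by (rule prob_space.indep_vars_compose2[OF measure_pmf.prob_space_axioms, where Y = "\<lambda>_. real"]) auto
    show "AE x in measure_pmf pm. real (x i) \<in> {0..real (grid R)}" if "i \<in> ?J" for i
    proof (rule AE_pmfI)
      fix y assume y: "y \<in> set_pmf pm"
      have "i \<in> ?I" using that JI by auto
      then have "y i \<in> set_pmf (\<rho> (fst i))"
        using y unfolding pm_def by (subst (asm) set_Pi_pmf) (auto simp: PiE_dflt_def)
      then show "real (y i) \<in> {0..real (grid R)}" using supp[of "fst i"] \<open>i \<in> ?I\<close> by auto
    qed
  qed auto
  have m: "measure_pmf.expectation pm (\<lambda>y. real (y p)) = \<nu> j * real (grid R)" if "p \<in> ?J" for p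
  proof -
    have "measure_pmf.expectation pm (\<lambda>y. real (y p)) = measure_pmf.expectation (map_pmf (\<lambda>y. y p) pm) real"
      by simp
    also have "map_pmf (\<lambda>y. y p) pm = \<rho> j"
      unfolding pm_def using that JI by (subst Pi_pmf_component) auto
    finally show ?thesis using \<nu>_eq[OF j] Q by simp
  qed
  have inj: "inj_on (\<lambda>l. (j, s + l)) {1..n}" by (auto simp: inj_on_def)
  have card: "card ?J = n" by (subst card_image[OF inj]) simp
  have sumJ: "(\<Sum>p\<in>?J. real (y p)) = est y j s n * (real n * real (grid R))" for y
    using n Q by (subst sum.reindex[OF inj]) (simp add: est_def psum_def)
  have mean: "(\<Sum>p\<in>?J. measure_pmf.expectation pm (\<lambda>y. real (y p))) = \<nu> j * (real n * real (grid R))"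
    using m card by (simp add: sum.reindex[OF inj])
  let ?D = "real n * real (grid R)"
  have D: "?D > 0" using n Q by simp
  have sq: "(\<Sum>i\<in>?J. (real (grid R) - 0)\<^sup>2) = real n * (real (grid R))\<^sup>2"
    using card by simp
  have ex: "- 2 * (\<delta> * ?D)\<^sup>2 / (\<Sum>i\<in>?J. (real (grid R) - 0)\<^sup>2) = - 2 * real n * \<delta>\<^sup>2"
    unfolding sq using Q n by (simp add: power2_eq_square field_simps)
  have e: "0 \<le> \<delta> * ?D" using D \<delta> by simp
  have pos: "0 < (\<Sum>i\<in>?J. (real (grid R) - 0)\<^sup>2)" unfolding sq using Q n by simp
  have "measure_pmf.prob pm {y. est y j s n \<le> \<nu> j - \<delta>}
     = measure_pmf.prob pm {y \<in> space (measure_pmf pm). (\<Sum>p\<in>?J. real (y p)) \<le>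
       (\<Sum>p\<in>?J. measure_pmf.expectation pm (\<lambda>y. real (y p))) - \<delta> * ?D}"
    unfolding sumJ mean left_diff_distrib[symmetric] using D by (simp add: mult_le_cancel_right)
  also have "\<dots> \<le> exp (- 2 * real n * \<delta>\<^sup>2)"
    using Hoeffding_ineq_le[OF e pos] unfolding ex .
  finally show "Ex (\<lambda>y. of_bool (est y j s n \<le> \<nu> j - \<delta>)) \<le> exp (- 2 * real n * \<delta>\<^sup>2)"
    by (simp add: Ex_of_bool)
  have "measure_pmf.prob pm {y. \<nu> j + \<delta> \<le> est y j s n}
     = measure_pmf.prob pm {y \<in> space (measure_pmf pm). (\<Sum>p\<in>?J. real (y p)) \<ge>
       (\<Sum>p\<in>?J. measure_pmf.expectation pm (\<lambda>y. real (y p))) + \<delta> * ?D}"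
    unfolding sumJ mean distrib_right[symmetric] using D by (simp add: mult_le_cancel_right)
  also have "\<dots> \<le> exp (- 2 * real n * \<delta>\<^sup>2)"
    using Hoeffding_ineq_ge[OF e pos] unfolding ex .
  finally show "Ex (\<lambda>y. of_bool (\<nu> j + \<delta> \<le> est y j s n)) \<le> exp (- 2 * real n * \<delta>\<^sup>2)"
    by (simp add: Ex_of_bool)
qed

end

section \<open>Summing the failure probabilities over the levels\<close>

lemma sum_inverse_squares_le: "(\<Sum>m<N. 1 / (real m + 1)\<^sup>2) \<le> 2"
proof -
  have "(\<Sum>m<Suc N. 1 / (real m + 1)\<^sup>2) \<le> 2 - 1 / (real N + 1)" for N
  proof (induction N)
    case (Suc N)
    have "1 / (real N + 2)\<^sup>2 \<le> 1 / ((real N + 1) * (real N + 2))"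
      unfolding power2_eq_square by (intro divide_left_mono mult_right_mono) auto
    also have "\<dots> = 1 / (real N + 1) - 1 / (real N + 2)"
      by (simp add: divide_simps)
    finally have "1 / (real N + 2)\<^sup>2 \<le> 1 / (real N + 1) - 1 / (real N + 2)" .
    with Suc show ?case by (simp add: add.commute add.left_commute)
  qed simp
  from this[of N] show ?thesis
    by (smt (verit) sum.lessThan_Suc zero_le_divide_1_iff of_nat_0_le_iff zero_le_power2)
qed

text \<open>The fourth power of exp (8 z) \<ge> 8 z turns the exponential into 4096 z^4. Since z = 1
  + slack has z^2 above the distance to the nearer of level 0 and the focus, 1 / z^4 is at most an
  inverse square of that distance plus one.\<close>

lemma exp_slack_le:
  "exp (- 32 * (1 + real (slack f m)))
     \<le> 1 / 4096 * (1 / (real m + 1)\<^sup>2 + 1 / (real (if m \<le> f then f - m else m - f) + 1)\<^sup>2)"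
proof -
  define z where "z = 1 + real (slack f m)"
  have z: "z \<ge> 1" by (simp add: z_def)
  have "8 * z \<le> exp (8 * z)" using exp_ge_add_one_self[of "8 * z"] by linarith
  then have "(8 * z) ^ 4 \<le> (exp (8 * z)) ^ 4"
    using z by (intro power_mono) auto
  also have "(exp (8 * z)) ^ 4 = exp (32 * z)" by (simp flip: exp_of_nat_mult)
  finally have "4096 * z ^ 4 \<le> exp (32 * z)" by (simp add: power_mult_distrib)
  then have "exp (- 32 * z) \<le> 1 / (4096 * z ^ 4)"
    using z by (simp add: exp_minus field_simps)
  define h where "h = (if m \<le> f then min m (f - m) else m - f)"
  have hz: "real h + 1 \<le> z ^ 2"
  proof (cases "m \<le> f")
    case True
    have "min m (f - m) < (Suc (slack f m))\<^sup>2"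
      using True by (simp add: slack_def Suc_floor_sqrt_power2_gt)
    then have "real (h + 1) \<le> real ((Suc (slack f m))\<^sup>2)"
      unfolding of_nat_le_iff using True by (simp add: h_def)
    then show ?thesis by (simp add: z_def add.commute)
  next
    case False
    then have "z = real h + 1" by (simp add: z_def h_def slack_def)
    then show ?thesis using z self_le_power[of z 2] by simp
  qed
  have "(real h + 1)\<^sup>2 \<le> (z ^ 2)\<^sup>2" using hz by (intro power_mono) auto
  then have "(real h + 1)\<^sup>2 \<le> z ^ 4" by (simp flip: power_mult)
  then have "1 / z ^ 4 \<le> 1 / (real h + 1)\<^sup>2" using z by (intro divide_left_mono) auto
  also have "\<dots> \<le> 1 / (real m + 1)\<^sup>2 + 1 / (real (if m \<le> f then f - m else m - f) + 1)\<^sup>2"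
    by (auto simp: h_def min_def)
  finally show ?thesis using \<open>exp (- 32 * z) \<le> 1 / (4096 * z ^ 4)\<close> unfolding z_def by simp
qed

lemma two_power_squared: "((2::real) ^ m)\<^sup>2 = 4 ^ m"
  by (simp add: power2_eq_square flip: power_mult_distrib)

lemma sum_exp_slack_le: "(\<Sum>m\<le>R. exp (- 32 * (1 + real (slack f m)))) \<le> 1 / 64"
proof -
  let ?g = "\<lambda>m. 1 / (real m + 1)\<^sup>2"
  let ?d = "\<lambda>m. if m \<le> f then f - m else m - f"
  have 1: "(\<Sum>m\<le>R. ?g m) \<le> 2" using sum_inverse_squares_le[of "Suc R"] by (simp add: lessThan_Suc_atMost)
  \<comment> \<open>The levels are covered by those up to f and those from f on, each an initial
    segment of the series of inverse squares; f is counted twice. In total (2 + 4) / 4096 \<le> 1 /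
    64.\<close>
  have "(\<Sum>m\<le>R. ?g (?d m)) \<le> (\<Sum>m\<in>{..<Suc f} \<union> {f..<f + Suc R}. ?g (?d m))"
    by (intro sum_mono2) auto
  also have "\<dots> \<le> (\<Sum>m<Suc f. ?g (?d m)) + (\<Sum>m\<in>{f..<f + Suc R}. ?g (?d m))"
    by (subst sum_Un) (auto intro: sum_nonneg)
  also have "(\<Sum>m<Suc f. ?g (?d m)) = (\<Sum>m<Suc f. ?g (Suc f - Suc m))"
    by (intro sum.cong) auto
  also have "\<dots> = (\<Sum>m<Suc f. ?g m)" by (rule sum.nat_diff_reindex)
  also have "(\<Sum>m\<in>{f..<f + Suc R}. ?g (?d m)) = (\<Sum>m\<in>{0..<Suc R}. ?g (?d (m + f)))"
    using sum.shift_bounds_nat_ivl[of "\<lambda>m. ?g (?d m)" 0 f "Suc R"] by (simp add: add.commute)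
  also have "\<dots> = (\<Sum>m<Suc R. ?g m)"
    by (intro sum.cong) auto
  finally have 2: "(\<Sum>m\<le>R. ?g (?d m)) \<le> 4"
    using sum_inverse_squares_le[of "Suc R"] sum_inverse_squares_le[of "Suc f"] by simp
  have "(\<Sum>m\<le>R. exp (- 32 * (1 + real (slack f m)))) \<le> (\<Sum>m\<le>R. 1 / 4096 * (?g m + ?g (?d m)))"
    by (intro sum_mono exp_slack_le)
  also have "\<dots> = 1 / 4096 * ((\<Sum>m\<le>R. ?g m) + (\<Sum>m\<le>R. ?g (?d m)))"
    by (simp only: sum_distrib_left[symmetric] sum.distrib)
  also have "\<dots> \<le> 1 / 64" using 1 2 by simp
  finally show ?thesis .
qed

declare sum_of_bool_eq [simp del] sum_mult_of_bool_eq [simp del] sum_of_bool_mult_eq [simp del]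

lemma of_bool_le_sum:
  "finite A \<Longrightarrow> (P \<Longrightarrow> \<exists>x\<in>A. Q x) \<Longrightarrow> (of_bool P :: real) \<le> (\<Sum>x\<in>A. of_bool (Q x))"
proof (cases P)
  assume fin: "finite A" and ex: "P \<Longrightarrow> \<exists>x\<in>A. Q x"
  case True
  then obtain x where x: "x \<in> A" "Q x" using ex by blast
  have "(of_bool (Q x) :: real) \<le> (\<Sum>x\<in>A. of_bool (Q x))"
    by (rule member_le_sum) (use x fin in auto)
  then show ?thesis using x by simp
qed (simp add: sum_nonneg)

lemma sum_of_bool_le:
  assumes "finite A" "\<And>x. x \<in> A \<Longrightarrow> Q x \<Longrightarrow> P" "\<And>x x'. x \<in> A \<Longrightarrow> x' \<in> A \<Longrightarrow> Q x \<Longrightarrow> Q x' \<Longrightarrow> x = x'"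
  shows "(\<Sum>x\<in>A. of_bool (Q x) :: real) \<le> of_bool P"
proof (cases "\<exists>x\<in>A. Q x")
  case True
  then obtain x where x: "x \<in> A" "Q x" by blast
  have "(\<Sum>x\<in>A. of_bool (Q x) :: real) = (\<Sum>x'\<in>{x}. of_bool (Q x'))"
    using assms x by (intro sum.mono_neutral_right) auto
  then show ?thesis using assms(2) x by simp
qed simp

context random_game
begin

section \<open>Unlucky sessions and the tail of the delay\<close>

lemma tr_cong: "(\<And>p. snd p \<le> s \<Longrightarrow> y p = y' p) \<Longrightarrow> u \<le> s \<Longrightarrow> tr y u = tr y' u"
  by (rule traj_cong) auto

lemma psum_cong: "(\<And>p. P (snd p) \<Longrightarrow> y p = y' p) \<Longrightarrow> (\<And>l. 1 \<le> l \<Longrightarrow> l \<le> n \<Longrightarrow> P (s + l)) \<Longrightarrow> est y a s n = est y' a s n"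
  unfolding est_def psum_def by (auto intro!: sum.cong arg_cong2[where f = "(/)"])

lemma unlucky_cong_subset:
  assumes "\<And>p. snd p \<le> s \<Longrightarrow> y p = y' p"
  shows "unlucky y s \<subseteq> unlucky y' s"
proof (clarify)
  fix j r assume "(j, r) \<in> unlucky y s"
  then obtain u where u: "u < s" "stage (tr y u) = r \<and> r < R \<and> arm (tr y u) = j \<and>
     pulls (tr y u) + 1 = quota R (focus (tr y u)) r (level (tr y u)) \<and>
     2 * level (tr y u) < focus (tr y u) + r \<and>
     est y j (u - pulls (tr y u)) (pulls (tr y u) + 1) < \<nu> j - 1 / 2 ^ level (tr y u)"
    unfolding unlucky_def by blast
  have t: "tr y u = tr y' u" using assms u(1) by (intro tr_cong[of s]) auto
  \<comment> \<open>The test made in step u reads rewards up to time u + 1 \<le> s.\<close>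
  have e: "est y j (u - pulls (tr y u)) (pulls (tr y u) + 1) = est y' j (u - pulls (tr y u)) (pulls (tr y u) + 1)"
    by (rule psum_cong[where P = "\<lambda>l. l \<le> s"]) (use assms u(1) invD(6)[of y u] in auto)
  show "(j, r) \<in> unlucky y' s"
    unfolding unlucky_def mem_Collect_eq case_prod_conv
    by (intro exI[of _ u]) (use u(1) u(2)[unfolded e, unfolded t] in blast)
qed

lemma unlucky_cong:
  assumes "\<And>p. snd p \<le> s \<Longrightarrow> y p = y' p"
  shows "unlucky y s = unlucky y' s"
proof (rule subset_antisym)
  show "unlucky y s \<subseteq> unlucky y' s" by (rule unlucky_cong_subset) (rule assms)
  show "unlucky y' s \<subseteq> unlucky y s" by (rule unlucky_cong_subset) (rule assms[symmetric])
qed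

definition begins :: "(nat \<times> nat \<Rightarrow> nat) \<Rightarrow> nat \<Rightarrow> nat \<Rightarrow> nat \<Rightarrow> bool" where
  "begins y j r s \<longleftrightarrow> pulls (tr y s) = 0 \<and> stage (tr y s) = r \<and> arm (tr y s) = j"

lemma begins_unique: "begins y j r s \<Longrightarrow> begins y j r s' \<Longrightarrow> r < R \<Longrightarrow> s = s'"
  by (rule start_unique[OF K_pos, of R y]) (auto simp: begins_def pos_def)

lemma begins_cong: "(\<And>p. snd p \<le> s \<Longrightarrow> y p = y' p) \<Longrightarrow> begins y j r s = begins y' j r s"
  using tr_cong[of s y y' s] by (simp add: begins_def)

lemma Ex_sum: "Ex (\<lambda>y. \<Sum>a\<in>A. f a y) = (\<Sum>a\<in>A. Ex (f a))"
  by (rule Bochner_Integration.integral_sum) simp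

text \<open>For a fixed focus f this is a union bound over the unconfident levels; Hoeffding with 16
  * 4^m (1 + slack) samples and deviation 2^-m yields the series of
  \<open>sum_exp_slack_le\<close>.\<close>

lemma low_deviation:
  assumes "j < K"
  shows "Ex (\<lambda>y. of_bool (\<exists>m\<le>R. 2 * m < f + r \<and> s + quota R f r m \<le> T \<and>
     est y j s (quota R f r m) < \<nu> j - 1 / 2 ^ m)) \<le> 1 / 64"
proof -
  have "Ex (\<lambda>y. of_bool (\<exists>m\<le>R. 2 * m < f + r \<and> s + quota R f r m \<le> T \<and>
     est y j s (quota R f r m) < \<nu> j - 1 / 2 ^ m))
    \<le> Ex (\<lambda>y. \<Sum>m\<le>R. of_bool (2 * m < f + r \<and> s + quota R f r m \<le> T \<and>
     est y j s (quota R f r m) < \<nu> j - 1 / 2 ^ m))"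
    by (intro Ex_mono of_bool_le_sum) auto
  also have "\<dots> = (\<Sum>m\<le>R. Ex (\<lambda>y. of_bool (2 * m < f + r \<and> s + quota R f r m \<le> T \<and>
     est y j s (quota R f r m) < \<nu> j - 1 / 2 ^ m)))"
    by (rule Ex_sum)
  also have "\<dots> \<le> (\<Sum>m\<le>R. exp (- 32 * (1 + real (slack f m))))"
  proof (intro sum_mono)
    fix m
    show "Ex (\<lambda>y. of_bool (2 * m < f + r \<and> s + quota R f r m \<le> T \<and>
       est y j s (quota R f r m) < \<nu> j - 1 / 2 ^ m)) \<le> exp (- 32 * (1 + real (slack f m)))"
    proof (cases "2 * m < f + r \<and> s + quota R f r m \<le> T")
      case True
      have "Ex (\<lambda>y. of_bool (2 * m < f + r \<and> s + quota R f r m \<le> T \<and>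
         est y j s (quota R f r m) < \<nu> j - 1 / 2 ^ m))
        \<le> Ex (\<lambda>y. of_bool (est y j s (quota R f r m) \<le> \<nu> j - 1 / 2 ^ m))"
        by (intro Ex_mono) auto
      also have "\<dots> \<le> exp (- 2 * real (quota R f r m) * (1 / 2 ^ m)\<^sup>2)"
        using True quota_pos by (intro hoeffding(1) assms) auto
      also have "- 2 * real (quota R f r m) * (1 / 2 ^ m)\<^sup>2 = - 32 * (1 + real (slack f m))"
        using True by (simp add: quota_def power_divide two_power_squared)
      finally show ?thesis .
    next
      case False
      then have "(\<lambda>y. of_bool (2 * m < f + r \<and> s + quota R f r m \<le> T \<and>
         est y j s (quota R f r m) < \<nu> j - 1 / 2 ^ m)) = (\<lambda>y. 0 :: real)" by auto
      then show ?thesis by simp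
    qed
  qed
  also have "\<dots> \<le> 1 / 64" by (rule sum_exp_slack_le)
  finally show ?thesis .
qed

text \<open>The premise on A says that it concerns earlier sessions only. Split by the unique start
  s of session (j, r): the past fixes A and the focus, while the tests of the session read later
  rewards and fail with probability at most 1/64.\<close>

lemma unlucky_prob:
  assumes j: "j < K" and r: "r < R"
    and A: "\<And>S. A S \<longleftrightarrow> A {(j', r'). (j', r') \<in> S \<and> r' * K + j' < r * K + j}"
  shows "Ex (\<lambda>y. of_bool (A (unlucky y T) \<and> (j, r) \<in> unlucky y T)) \<le> 1 / 64 * Ex (\<lambda>y. of_bool (A (unlucky y T)))"
proof -
  let ?G = "\<lambda>s f y. \<exists>m\<le>R. 2 * m < f + r \<and> s + quota R f r m \<le> T \<and>
     est y j s (quota R f r m) < \<nu> j - 1 / 2 ^ m"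
  \<comment> \<open>When session (j, r) begins, all sessions of smaller rank are over, so A is
    decided by the rewards up to s.\<close>
  have prev: "A (unlucky y T) \<longleftrightarrow> A (unlucky y s)" if b: "begins y j r s" "s \<le> T" for y s
  proof -
    have "(j', r') \<in> unlucky y s" if "(j', r') \<in> unlucky y T" "r' * K + j' < r * K + j" for j' r'
    proof -
      obtain u where u: "u < T" "stage (tr y u) = r'" "arm (tr y u) = j'"
        "r' < R \<and> pulls (tr y u) + 1 = quota R (focus (tr y u)) r' (level (tr y u)) \<and>
         2 * level (tr y u) < focus (tr y u) + r' \<and>
         est y j' (u - pulls (tr y u)) (pulls (tr y u) + 1) < \<nu> j' - 1 / 2 ^ level (tr y u)"
        using \<open>(j', r') \<in> unlucky y T\<close> unfolding unlucky_def by blast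
      have "u < s"
      proof (rule ccontr)
        assume "\<not> u < s"
        then have "pos K (tr y s) \<le> pos K (tr y u)" by (intro pos_mono K_pos) simp
        with u that b show False by (simp add: pos_def begins_def)
      qed
      with u show ?thesis unfolding unlucky_def by blast
    qed
    then have "{(j', r'). (j', r') \<in> unlucky y T \<and> r' * K + j' < r * K + j}
       = {(j', r'). (j', r') \<in> unlucky y s \<and> r' * K + j' < r * K + j}"
      using unlucky_mono[OF b(2), of y] by auto
    with A[of "unlucky y T"] A[of "unlucky y s"] show ?thesis by simp
  qed
  have "Ex (\<lambda>y. of_bool (A (unlucky y T) \<and> (j, r) \<in> unlucky y T))
    \<le> Ex (\<lambda>y. \<Sum>s<T. of_bool (begins y j r s \<and> A (unlucky y s)) * of_bool (?G s (focus (tr y s)) y))"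
  proof (rule Ex_mono)
    fix y
    have "(of_bool (A (unlucky y T) \<and> (j, r) \<in> unlucky y T) :: real)
      \<le> (\<Sum>s<T. of_bool ((begins y j r s \<and> A (unlucky y s)) \<and> ?G s (focus (tr y s)) y))"
    proof (rule of_bool_le_sum)
      assume "A (unlucky y T) \<and> (j, r) \<in> unlucky y T"
      then obtain u where u: "A (unlucky y T)" "u < T" "stage (tr y u) = r" "arm (tr y u) = j"
        "pulls (tr y u) + 1 = quota R (focus (tr y u)) r (level (tr y u))"
        "2 * level (tr y u) < focus (tr y u) + r"
        "est y j (u - pulls (tr y u)) (pulls (tr y u) + 1) < \<nu> j - 1 / 2 ^ level (tr y u)"
        unfolding unlucky_def by blast
      define s where "s = u - pulls (tr y u)"
      have s: "tr y s = fresh (tr y u)" unfolding s_def by (rule invD)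
      have b: "begins y j r s" using s u by (simp add: begins_def fresh_def)
      have sT: "s < T" using u(2) by (simp add: s_def)
      have f: "focus (tr y s) = focus (tr y u)" by (simp add: s fresh_def)
      have "?G s (focus (tr y s)) y"
      proof (intro exI conjI)
        show "level (tr y u) \<le> R" using invD(3,5)[of y u] by simp
        show "2 * level (tr y u) < focus (tr y s) + r" using u f by simp
        have q: "quota R (focus (tr y s)) r (level (tr y u)) = pulls (tr y u) + 1"
          using f u(5) by simp
        show "s + quota R (focus (tr y s)) r (level (tr y u)) \<le> T"
          unfolding q using invD(6)[of y u] u(2) by (simp add: s_def)
        show "est y j s (quota R (focus (tr y s)) r (level (tr y u))) < \<nu> j - 1 / 2 ^ level (tr y u)"
          unfolding q using u(7) by (simp add: s_def)
      qed
      moreover have "A (unlucky y s)" using prev[OF b] sT u(1) by simp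
      ultimately show "\<exists>s\<in>{..<T}. (begins y j r s \<and> A (unlucky y s)) \<and> ?G s (focus (tr y s)) y"
        using b sT by blast
    qed simp
    then show "(of_bool (A (unlucky y T) \<and> (j, r) \<in> unlucky y T) :: real)
      \<le> (\<Sum>s<T. of_bool (begins y j r s \<and> A (unlucky y s)) * of_bool (?G s (focus (tr y s)) y))"
      by (simp only: of_bool_conj)
  qed
  also have "\<dots> = (\<Sum>s<T. Ex (\<lambda>y. of_bool (begins y j r s \<and> A (unlucky y s)) * of_bool (?G s (focus (tr y s)) y)))"
    by (rule Ex_sum)
  also have "\<dots> \<le> (\<Sum>s<T. Ex (\<lambda>y. of_bool (begins y j r s \<and> A (unlucky y s))) * (1 / 64))"
  proof (intro sum_mono session[where f = "\<lambda>y. of_bool (begins y j r s \<and> A (unlucky y s))"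
        and c = "\<lambda>y. focus (tr y s)" and G = "?G s" for s])
    fix s and y y' :: "nat \<times> nat \<Rightarrow> nat"
    assume "\<And>p. snd p \<le> s \<Longrightarrow> y p = y' p"
    then show "(of_bool (begins y j r s \<and> A (unlucky y s)) :: real) = of_bool (begins y' j r s \<and> A (unlucky y' s))"
      "focus (tr y s) = focus (tr y' s)"
      using begins_cong[of s y y'] unlucky_cong[of s y y'] tr_cong[of s y y' s] by simp_all
  next
    fix s v and y y' :: "nat \<times> nat \<Rightarrow> nat"
    assume "\<And>p. s < snd p \<Longrightarrow> y p = y' p"
    then have "est y j s n = est y' j s n" for n
      by (intro psum_cong[where P = "\<lambda>l. s < l"]) auto
    then show "?G s v y = ?G s v y'" by simp
  next
    show "Ex (\<lambda>z. of_bool (?G s (focus (tr y s)) z)) \<le> 1 / 64" for s y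
      by (rule low_deviation[OF j])
  qed simp
  also have "\<dots> = 1 / 64 * Ex (\<lambda>y. \<Sum>s<T. of_bool (begins y j r s \<and> A (unlucky y s)))"
    by (simp add: Ex_sum sum_distrib_left mult.commute)
  also have "\<dots> \<le> 1 / 64 * Ex (\<lambda>y. of_bool (A (unlucky y T)))"
    using prev begins_unique[OF _ _ r] by (intro mult_left_mono Ex_mono sum_of_bool_le) auto
  finally show ?thesis .
qed

lemma unlucky_round_less: "(j, r) \<in> unlucky y t \<Longrightarrow> r < R"
  by (auto simp: unlucky_def)

lemma unlucky_prob':
  assumes j: "j < K"
    and A: "\<And>S. A S \<longleftrightarrow> A {(j', r'). (j', r') \<in> S \<and> r' * K + j' < r * K + j}"
  shows "Ex (\<lambda>y. of_bool (A (unlucky y T) \<and> (j, r) \<in> unlucky y T)) \<le> 1 / 64 * Ex (\<lambda>y. of_bool (A (unlucky y T)))"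
proof (cases "r < R")
  case True
  show ?thesis using unlucky_prob[OF j True, of A] A by blast
next
  case False
  then have "(j, r) \<notin> unlucky y T" for y using unlucky_round_less by blast
  then show ?thesis by (simp add: Ex_of_bool)
qed

text \<open>Each block adds two possible failures of probability 1/64, conditionally on the blocks
  before it.\<close>

lemma spoiled_prob:
  assumes i: "i < K"
  shows "Ex (\<lambda>y. of_bool (spoiled i k n (unlucky y T))) \<le> (1 / 32) ^ n"
proof (induction n)
  case 0
  then show ?case by (simp add: spoiled_0)
next
  case (Suc n)
  let ?b = "block0 k + n"
  have A: "spoiled i k n S \<longleftrightarrow> spoiled i k n {(j', r'). (j', r') \<in> S \<and> r' * K + j' < 2 * ?b * K + j}" for S j
  proof -
    have "2 * b * K + opt < 2 * ?b * K + j" "(2 * b + 1) * K + i < 2 * ?b * K + j" if "b < ?b" for b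
    proof -
      have "(2 * b + 1) * K + i < (2 * b + 2) * K" using i by simp
      also have "\<dots> \<le> 2 * ?b * K" using that by (intro mult_right_mono) auto
      finally show "(2 * b + 1) * K + i < 2 * ?b * K + j" by simp
      have "2 * b * K + opt < (2 * b + 1) * K" using opt_less by simp
      also have "\<dots> \<le> 2 * ?b * K" using that by (intro mult_right_mono) auto
      finally show "2 * b * K + opt < 2 * ?b * K + j" by simp
    qed
    then show ?thesis unfolding spoiled_def by auto
  qed
  \<comment> \<open>Inserting j = K + i moves the bound on the rank into the next round, 2 b +
    1.\<close>
  have A': "spoiled i k n S \<longleftrightarrow> spoiled i k n {(j', r'). (j', r') \<in> S \<and> r' * K + j' < (2 * ?b + 1) * K + i}" for S
    using A[of S "K + i"] by (simp add: algebra_simps)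
  have sp: "spoiled i k (Suc n) S \<longleftrightarrow> spoiled i k n S \<and> ((opt, 2 * ?b) \<in> S \<or> (i, 2 * ?b + 1) \<in> S)" for S
  proof -
    have "(\<forall>b. k0 \<le> b \<longrightarrow> b < k0 + Suc n \<longrightarrow> Q b) \<longleftrightarrow> (\<forall>b. k0 \<le> b \<longrightarrow> b < k0 + n \<longrightarrow> Q b) \<and> Q (k0 + n)"
      for k0 and Q :: "nat \<Rightarrow> bool"
      by (metis add_Suc_right le_add1 less_Suc_eq)
    then show ?thesis unfolding spoiled_def by simp
  qed
  have "Ex (\<lambda>y. of_bool (spoiled i k (Suc n) (unlucky y T)))
    \<le> Ex (\<lambda>y. of_bool (spoiled i k n (unlucky y T) \<and> (opt, 2 * ?b) \<in> unlucky y T)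
        + of_bool (spoiled i k n (unlucky y T) \<and> (i, 2 * ?b + 1) \<in> unlucky y T))"
    unfolding sp by (intro Ex_mono) auto
  also have "\<dots> = Ex (\<lambda>y. of_bool (spoiled i k n (unlucky y T) \<and> (opt, 2 * ?b) \<in> unlucky y T))
        + Ex (\<lambda>y. of_bool (spoiled i k n (unlucky y T) \<and> (i, 2 * ?b + 1) \<in> unlucky y T))"
    by (rule Bochner_Integration.integral_add) auto
  also have "\<dots> \<le> 1 / 64 * Ex (\<lambda>y. of_bool (spoiled i k n (unlucky y T)))
      + 1 / 64 * Ex (\<lambda>y. of_bool (spoiled i k n (unlucky y T)))"
    using unlucky_prob'[of opt "spoiled i k n" "2 * ?b", OF opt_less A] unlucky_prob'[of i "spoiled i k n" "2 * ?b + 1", OF i A'] by (rule add_mono)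
  also have "\<dots> \<le> (1 / 32) ^ Suc n" using Suc by simp
  finally show ?case .
qed

text \<open>The power 16^delay is one of the terms 16^n of spoiled initial stretches, whose
  expectations are at most (16 / 32)^n. The base 16 = 4^2 is the growth of the costs over one
  block.\<close>

lemma delay_moment:
  assumes i: "i < K"
  shows "Ex (\<lambda>y. 16 ^ delay i k (unlucky y T)) \<le> 2"
proof -
  have "Ex (\<lambda>y. 16 ^ delay i k (unlucky y T)) \<le> Ex (\<lambda>y. \<Sum>n\<le>R. 16 ^ n * of_bool (spoiled i k n (unlucky y T)))"
  proof (rule Ex_mono)
    fix y
    let ?x = "delay i k (unlucky y T)"
    have "16 ^ ?x * of_bool (spoiled i k ?x (unlucky y T)) \<le> (\<Sum>n\<le>R. 16 ^ n * of_bool (spoiled i k n (unlucky y T)) :: real)"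
      by (rule member_le_sum) (use delay_props(1) in auto)
    then show "16 ^ ?x \<le> (\<Sum>n\<le>R. 16 ^ n * of_bool (spoiled i k n (unlucky y T)) :: real)"
      using delay_props(2)[of i k "unlucky y T"] by simp
  qed
  also have "\<dots> = (\<Sum>n\<le>R. 16 ^ n * Ex (\<lambda>y. of_bool (spoiled i k n (unlucky y T))))"
    by (subst Ex_sum) simp
  also have "\<dots> \<le> (\<Sum>n\<le>R. 16 ^ n * (1 / 32) ^ n)"
    by (intro sum_mono mult_left_mono spoiled_prob i) auto
  also have "\<dots> = (\<Sum>n<Suc R. (1 / 2) ^ n)"
    by (simp add: lessThan_Suc_atMost flip: power_mult_distrib)
  also have "\<dots> \<le> 2" by (subst geometric_sum) (auto simp: field_simps)
  finally show ?thesis .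
qed

text \<open>The factor T is the largest regret of a play that is not good.\<close>

lemma not_good_prob: "real T * Ex (\<lambda>y. of_bool (\<not> good y)) \<le> 1"
proof -
  let ?G = "\<lambda>s m a y. m \<le> R \<and> a < K \<and> s + confident m \<le> T \<and> 1 / (8 * 2 ^ m) < \<bar>est y a s (confident m) - \<nu> a\<bar>"
  have b: "Ex (\<lambda>y. of_bool (?G s m a y)) \<le> 2 * (1 / 256) ^ (R + 1)" for s m a
  proof (cases "m \<le> R \<and> a < K \<and> s + confident m \<le> T")
    case True
    have cp: "confident m > 0" by (simp add: confident_def)
    have ex: "exp (- 2 * real (confident m) * (1 / (8 * 2 ^ m))\<^sup>2) \<le> (1 / 256) ^ (R + 1)"
    proof -
      \<comment> \<open>Thus the Hoeffding exponent is 8 (R + 1), and e \<ge> 2 turns exp (- 8) into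
        1 / 256.\<close>
      have "real (confident m) * (1 / (8 * 2 ^ m))\<^sup>2 = 4 * (real R + 1)"
        by (simp add: confident_def power_divide power_mult_distrib two_power_squared)
      then have "exp (- 2 * real (confident m) * (1 / (8 * 2 ^ m))\<^sup>2) = exp (real (R + 1) * (- 8))" by simp
      also have "\<dots> = exp (- 8) ^ (R + 1)" by (rule exp_of_nat_mult)
      also have "\<dots> = (1 / exp 8) ^ (R + 1)" by (simp add: exp_minus inverse_eq_divide)
      also have "\<dots> \<le> (1 / 256) ^ (R + 1)"
      proof (intro power_mono divide_left_mono)
        have "2 \<le> exp (1::real)" using exp_ge_add_one_self[of 1] by simp
        then have "2 ^ 8 \<le> exp (1::real) ^ 8" by (intro power_mono) auto
        then show "256 \<le> exp (8::real)" by (simp flip: exp_of_nat_mult)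
      qed auto
      finally show ?thesis .
    qed
    have "Ex (\<lambda>y. of_bool (?G s m a y)) \<le> Ex (\<lambda>y. of_bool (est y a s (confident m) \<le> \<nu> a - 1 / (8 * 2 ^ m))
       + of_bool (\<nu> a + 1 / (8 * 2 ^ m) \<le> est y a s (confident m)))"
      by (intro Ex_mono) (auto simp: abs_if)
    also have "\<dots> = Ex (\<lambda>y. of_bool (est y a s (confident m) \<le> \<nu> a - 1 / (8 * 2 ^ m)))
       + Ex (\<lambda>y. of_bool (\<nu> a + 1 / (8 * 2 ^ m) \<le> est y a s (confident m)))"
      by (rule Bochner_Integration.integral_add) auto
    also have "\<dots> \<le> exp (- 2 * real (confident m) * (1 / (8 * 2 ^ m))\<^sup>2) + exp (- 2 * real (confident m) * (1 / (8 * 2 ^ m))\<^sup>2)"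
      using True cp by (intro add_mono hoeffding) auto
    also have "\<dots> \<le> 2 * (1 / 256) ^ (R + 1)" using ex by simp
    finally show ?thesis .
  next
    case False
    then have "(\<lambda>y. of_bool (?G s m a y)) = (\<lambda>y. 0 :: real)" by auto
    then show ?thesis by simp
  qed
  have "Ex (\<lambda>y. of_bool (\<not> good y)) \<le> Ex (\<lambda>y. \<Sum>(s, m)\<in>{..<T} \<times> {..R}. of_bool (?G s m (arm (tr y s)) y))"
  proof (intro Ex_mono)
    fix y
    have "(of_bool (\<not> good y) :: real) \<le> (\<Sum>x\<in>{..<T} \<times> {..R}. of_bool (?G (fst x) (snd x) (arm (tr y (fst x))) y))"
    proof (rule of_bool_le_sum)
      assume "\<not> good y"
      then obtain s m where sm: "m \<le> R" "s + confident m \<le> T" "\<not> \<bar>est y (arm (tr y s)) s (confident m) - \<nu> (arm (tr y s))\<bar> \<le> 1 / (8 * 2 ^ m)"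
        unfolding good_def by blast
      have "0 < confident m" by (simp add: confident_def)
      with sm have "s < T" by linarith
      with sm show "\<exists>x\<in>{..<T} \<times> {..R}. ?G (fst x) (snd x) (arm (tr y (fst x))) y"
        by (intro bexI[of _ "(s, m)"]) (auto simp: invD(1))
    qed simp
    then show "of_bool (\<not> good y) \<le> (\<Sum>(s, m)\<in>{..<T} \<times> {..R}. of_bool (?G s m (arm (tr y s)) y) :: real)"
      by (simp add: case_prod_unfold)
  qed
  also have "\<dots> = (\<Sum>(s, m)\<in>{..<T} \<times> {..R}. Ex (\<lambda>y. 1 * of_bool (?G s m (arm (tr y s)) y)))"
    by (simp add: Ex_sum case_prod_unfold)
  also have "\<dots> \<le> (\<Sum>(s, m)\<in>{..<T} \<times> {..R}. Ex (\<lambda>y. 1) * (2 * (1 / 256) ^ (R + 1)))"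
  proof (intro sum_mono, clarify)
    fix s m
    show "Ex (\<lambda>y. 1 * of_bool (?G s m (arm (tr y s)) y)) \<le> Ex (\<lambda>y. 1) * (2 * (1 / 256) ^ (R + 1))"
    proof (rule session[where c = "\<lambda>y. arm (tr y s)" and G = "?G s m"])
      fix v and y y' :: "nat \<times> nat \<Rightarrow> nat"
      assume "\<And>p. s < snd p \<Longrightarrow> y p = y' p"
      then have "est y v s n = est y' v s n" for n
        by (intro psum_cong[where P = "\<lambda>l. s < l"]) auto
      then show "?G s m v y = ?G s m v y'" by simp
    next
      fix y y' :: "nat \<times> nat \<Rightarrow> nat"
      assume "\<And>p. snd p \<le> s \<Longrightarrow> y p = y' p"
      then show "arm (tr y s) = arm (tr y' s)" using tr_cong[of s y y' s] by simp
    qed (use b in auto)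
  qed
  also have "\<dots> = real T * (real R + 1) * (2 * (1 / 256) ^ (R + 1))"
    by (simp add: case_prod_unfold algebra_simps)
  finally have 1: "Ex (\<lambda>y. of_bool (\<not> good y)) \<le> real T * (real R + 1) * (2 * (1 / 256) ^ (R + 1))" .
  have "real T \<le> 4 ^ R" using T_le by (metis of_nat_le_iff of_nat_power of_nat_numeral)
  moreover have "real R + 1 \<le> 4 ^ R"
  proof -
    have "R < 4 ^ R" by (rule less_exp[THEN less_le_trans]) (simp add: power_mono)
    then have "real (R + 1) \<le> real (4 ^ R)" by (simp only: of_nat_le_iff)
    then show ?thesis by simp
  qed
  \<comment> \<open>One T is the regret of a bad play, the other counts the starting times, and R +
    1 counts the levels; together at most 64^R, against 256^R in the tail.\<close>
  ultimately have "real T * (real T * (real R + 1)) \<le> 4 ^ R * (4 ^ R * 4 ^ R)"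
    by (intro mult_mono) auto
  then have "real T * Ex (\<lambda>y. of_bool (\<not> good y)) \<le> 4 ^ R * (4 ^ R * 4 ^ R) * (2 * (1 / 256) ^ (R + 1))"
    using mult_left_mono[OF 1, of "real T"] by (simp add: mult_right_mono order_trans mult.assoc)
  also have "\<dots> = (64 * (1 / 256)) ^ R * (2 / 256)"
    by (simp add: power_mult_distrib flip: power_mult_distrib)
  also have "\<dots> \<le> 1" using power_le_one[of "64 * (1 / 256) :: real" R] by simp
  finally show ?thesis .
qed

end

section \<open>Expected number of pulls\<close>

definition dist_nat :: "nat \<Rightarrow> nat \<Rightarrow> nat" where
  "dist_nat m k = (if m \<le> k then k - m else m - k)"

lemma sum_half_dist_le: "(\<Sum>m\<le>r. (1 / 2 :: real) ^ dist_nat m k) \<le> 4"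
proof -
  have g: "(\<Sum>m<N. (1 / 2 :: real) ^ m) \<le> 2" for N
    by (subst geometric_sum) (auto simp: field_simps)
  have "(\<Sum>m\<le>r. (1 / 2 :: real) ^ dist_nat m k) \<le> (\<Sum>m\<in>{..<Suc k} \<union> {k..<k + Suc r}. (1 / 2) ^ dist_nat m k)"
    by (intro sum_mono2) auto
  also have "\<dots> \<le> (\<Sum>m<Suc k. (1 / 2) ^ dist_nat m k) + (\<Sum>m\<in>{k..<k + Suc r}. (1 / 2) ^ dist_nat m k)"
    by (subst sum_Un) (auto intro: sum_nonneg)
  also have "(\<Sum>m<Suc k. (1 / 2 :: real) ^ dist_nat m k) = (\<Sum>m<Suc k. (1 / 2) ^ (Suc k - Suc m))"
    by (intro sum.cong) (auto simp: dist_nat_def)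
  also have "\<dots> = (\<Sum>m<Suc k. (1 / 2) ^ m)" by (rule sum.nat_diff_reindex)
  also have "(\<Sum>m\<in>{k..<k + Suc r}. (1 / 2 :: real) ^ dist_nat m k) = (\<Sum>m\<in>{0..<Suc r}. (1 / 2) ^ dist_nat (m + k) k)"
    using sum.shift_bounds_nat_ivl[of "\<lambda>m. (1 / 2 :: real) ^ dist_nat m k" 0 k "Suc r"] by (simp add: add.commute)
  also have "\<dots> = (\<Sum>m<Suc r. (1 / 2) ^ m)"
    by (intro sum.cong) (auto simp: dist_nat_def)
  finally show ?thesis using g[of "Suc k"] g[of "Suc r"] by simp
qed

lemma slack_back: "slack f m \<le> slack f (m + j) + j"
proof (induction j)
  case (Suc j)
  then show ?case using slack_le_Suc[of f "m + j"] by simp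
qed simp

text \<open>Up to level \<open>k + 2\<close> the gap of an arm of level \<open>k\<close> may be too small to be noticed.\<close>

definition survive :: "nat \<Rightarrow> nat \<Rightarrow> real" where
  "survive k m = (if m \<le> k + 2 then 1 else exp (- 8 * 4 ^ (m - k - 3)))"

lemma survive_bounds: "0 \<le> survive k m" "survive k m \<le> 1"
  by (auto simp: survive_def)

text \<open>The doubly exponential decay is weakened to 64^-j, enough to beat both 16^j and 4^j 2^j.
  The constant is 64^3, since the decay sets in three levels late.\<close>

lemma survive_le: "survive k (k + j) \<le> 262144 * (1 / 64) ^ j"
proof (cases "j \<le> 2")
  case True
  then have "j = 0 \<or> j = 1 \<or> j = 2" by auto
  then show ?thesis by (auto simp: survive_def power2_eq_square)
next
  case False
  then obtain i where i: "j = i + 3" by (metis add.commute le_Suc_ex not_less_eq_eq numeral_2_eq_2 numeral_3_eq_3)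
  let ?e = "exp (8 / 3 * 4 ^ i) :: real"
  have "0 \<le> (4::real) ^ i" by simp
  then have "2 * 4 ^ i \<le> 1 + 8 / 3 * (4::real) ^ i" by linarith
  also have "\<dots> \<le> ?e" by (rule exp_ge_add_one_self)
  finally have "(2 * 4 ^ i) ^ 3 \<le> ?e ^ 3" by (intro power_mono) auto
  also have "?e ^ 3 = exp (8 * 4 ^ i)" by (simp flip: exp_of_nat_mult)
  also have "(2 * (4::real) ^ i) ^ 3 = 8 * 64 ^ i"
    by (simp add: power_mult_distrib power3_eq_cube flip: power_mult_distrib)
  finally have "1 / exp (8 * 4 ^ i) \<le> 1 / (8 * (64::real) ^ i)" by (intro divide_left_mono) auto
  also have "\<dots> \<le> 262144 * (1 / 64) ^ j" by (simp add: i power_add power_divide field_simps)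
  finally show ?thesis by (simp add: i survive_def exp_minus inverse_eq_divide)
qed

lemma add_one_le_two_power: "1 + real j \<le> 2 ^ j"
proof -
  have "j < 2 ^ j" by (rule less_exp)
  then have "Suc j \<le> 2 ^ j" by (rule Suc_leI)
  then have "real (Suc j) \<le> real (2 ^ j)" by (simp only: of_nat_le_iff)
  then show ?thesis by simp
qed

text \<open>A level further down saves a factor 4, while the change of the slack over j levels costs
  at most 1 + j \<le> 2^j; this leaves the ratio 1/2. Upwards the ratio is 4 * 2 / 64.\<close>

lemma expected_low_le:
  "4 ^ m * (1 + real (slack f m)) * survive k m
     \<le> 262144 * (4 ^ k * (1 + real (slack f k))) * (1 / 2) ^ dist_nat m k"
proof (cases "m \<le> k")
  case True
  then obtain j where j: "k = m + j" using le_Suc_ex by blast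
  have s: "1 + real (slack f m) \<le> (1 + real (slack f k)) * (1 + real j)"
  proof -
    have "slack f m \<le> slack f k + j" using slack_back[of f m j] by (simp add: j)
    then have "real (slack f m) \<le> real (slack f k) + real j" by (metis of_nat_add of_nat_le_iff)
    moreover have "0 \<le> real (slack f k) * real j" by simp
    ultimately show ?thesis unfolding distrib_left distrib_right mult_1_left mult_1_right by linarith
  qed
  also have "\<dots> \<le> (1 + real (slack f k)) * 2 ^ j"
    by (intro mult_left_mono add_one_le_two_power) auto
  finally have "4 ^ m * (1 + real (slack f m)) * survive k m \<le> 4 ^ m * ((1 + real (slack f k)) * 2 ^ j) * 1"
    using survive_bounds[of k m] by (intro mult_mono) auto
  also have "\<dots> = 4 ^ k * (1 + real (slack f k)) * (1 / 2) ^ dist_nat m k"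
  proof -
    have "(4::real) ^ m * 2 ^ j = 4 ^ k * (1 / 2) ^ j"
      by (simp add: j power_add power_divide field_simps flip: power_mult_distrib)
    then show ?thesis by (simp add: dist_nat_def j mult_ac)
  qed
  also have "\<dots> \<le> 262144 * (4 ^ k * (1 + real (slack f k)) * (1 / 2) ^ dist_nat m k)"
    by simp
  finally show ?thesis by (simp only: mult.assoc)
next
  case False
  then obtain j where j: "m = k + j" using nat_le_iff_add[of k m] by auto
  have s: "1 + real (slack f m) \<le> (1 + real (slack f k)) * (1 + real j)"
  proof -
    have "slack f m \<le> slack f k + j" using slack_add_le[of f k j] by (simp add: j)
    then have "real (slack f m) \<le> real (slack f k) + real j" by (metis of_nat_add of_nat_le_iff)
    moreover have "0 \<le> real (slack f k) * real j" by simp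
    ultimately show ?thesis unfolding distrib_left distrib_right mult_1_left mult_1_right by linarith
  qed
  also have "\<dots> \<le> (1 + real (slack f k)) * 2 ^ j"
    by (intro mult_left_mono add_one_le_two_power) auto
  finally have "4 ^ m * (1 + real (slack f m)) * survive k m
     \<le> 4 ^ m * ((1 + real (slack f k)) * 2 ^ j) * (262144 * (1 / 64) ^ j)"
    using survive_le[of k j] survive_bounds[of k m] by (intro mult_mono) (auto simp: j)
  also have "\<dots> = 262144 * (4 ^ k * (1 + real (slack f k))) * (1 / 8) ^ j"
  proof -
    have "(4::real) ^ m * 2 ^ j * (1 / 64) ^ j = 4 ^ k * (1 / 8) ^ j"
      by (simp add: j power_add power_divide field_simps flip: power_mult_distrib)
    then show ?thesis by (simp add: mult_ac)
  qed
  also have "\<dots> \<le> 262144 * (4 ^ k * (1 + real (slack f k))) * (1 / 2) ^ j"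
    by (intro mult_left_mono power_mono) auto
  finally show ?thesis using False by (simp add: dist_nat_def j)
qed

text \<open>The same scheme with 16 per level: ratio 1/16 below k and 16/64 above.\<close>

lemma expected_confident_le:
  "16 ^ m * survive k m \<le> 262144 * 16 ^ k * (1 / 2) ^ dist_nat m k"
proof (cases "m \<le> k")
  case True
  then obtain j where j: "k = m + j" using le_Suc_ex by blast
  have "16 ^ m * survive k m \<le> 16 ^ m * 1"
    using survive_bounds[of k m] by (intro mult_left_mono) auto
  also have "\<dots> = 16 ^ k * (1 / 16) ^ j" by (simp add: j power_add power_divide)
  also have "\<dots> \<le> 16 ^ k * (1 / 2) ^ j" by (intro mult_left_mono power_mono) auto
  also have "\<dots> \<le> 262144 * (16 ^ k * (1 / 2) ^ j)" by simp
  finally show ?thesis using j by (simp add: dist_nat_def)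
next
  case False
  then obtain j where j: "m = k + j" using nat_le_iff_add[of k m] by auto
  have "16 ^ m * survive k m \<le> 16 ^ m * (262144 * (1 / 64) ^ j)"
    using survive_le[of k j] by (intro mult_left_mono) (auto simp: j)
  also have "\<dots> = 262144 * 16 ^ k * (1 / 4) ^ j"
    by (simp add: j power_add power_divide field_simps flip: power_mult_distrib)
  also have "\<dots> \<le> 262144 * 16 ^ k * (1 / 2) ^ j" by (intro mult_left_mono power_mono) auto
  finally show ?thesis using False by (simp add: dist_nat_def j)
qed

text \<open>The first summand stands for the unconfident tests, the second for the confident ones;
  both are dominated by levels near k. The constant is 4 * 262144, with 4 from the two-sided
  geometric series.\<close>

definition session_bound :: "nat \<Rightarrow> nat \<Rightarrow> nat \<Rightarrow> nat \<Rightarrow> real" where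
  "session_bound R k r f = 1048576 * (16 * (4 ^ k * (1 + real (slack f k)))
     + 256 * (real R + 1) * (16 ^ k / 2 ^ (f + r)))"

text \<open>At a confident level 4^m \<ge> 2^(f + r), so 4^m may be replaced by 16^m / 2^(f + r), an
  expression in which the threshold no longer appears.\<close>

lemma expected_quota_le:
  "(\<Sum>m\<le>r. real (quota R f r m) * survive k m) \<le> session_bound R k r f"
proof -
  have "(\<Sum>m\<le>r. real (quota R f r m) * survive k m)
    \<le> (\<Sum>m\<le>r. 262144 * (16 * (4 ^ k * (1 + real (slack f k)))
     + 256 * (real R + 1) * (16 ^ k / 2 ^ (f + r))) * (1 / 2) ^ dist_nat m k)"
  proof (rule sum_mono)
    fix m
    have "real (quota R f r m) \<le> 16 * (4 ^ m * (1 + real (slack f m))) + 256 * (real R + 1) * (16 ^ m / 2 ^ (f + r))"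
    proof (cases "2 * m < f + r")
      case True
      then show ?thesis by (simp add: quota_def algebra_simps)
    next
      case False
      then have "(2::real) ^ (f + r) \<le> 2 ^ (2 * m)" by (intro power_increasing) auto
      also have "\<dots> = 4 ^ m" by (simp add: power_mult)
      finally have "1 \<le> (4::real) ^ m / 2 ^ (f + r)" by simp
      then have "4 ^ m * 1 \<le> 4 ^ m * ((4::real) ^ m / 2 ^ (f + r))" by (intro mult_left_mono) auto
      also have "\<dots> = 16 ^ m / 2 ^ (f + r)" by (simp flip: power_mult_distrib)
      finally have "256 * (real R + 1) * 4 ^ m \<le> 256 * (real R + 1) * (16 ^ m / 2 ^ (f + r))"
        by (intro mult_left_mono) auto
      moreover have "real (quota R f r m) = 256 * (real R + 1) * 4 ^ m"
        using False by (simp add: quota_def algebra_simps)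
      moreover have "0 \<le> 16 * (4 ^ m * (1 + real (slack f m)))" by simp
      ultimately show ?thesis by linarith
    qed
    then have "real (quota R f r m) * survive k m \<le>
      (16 * (4 ^ m * (1 + real (slack f m))) + 256 * (real R + 1) * (16 ^ m / 2 ^ (f + r))) * survive k m"
      using survive_bounds by (intro mult_right_mono)
    also have "\<dots> = 16 * (4 ^ m * (1 + real (slack f m)) * survive k m)
       + 256 * (real R + 1) / 2 ^ (f + r) * (16 ^ m * survive k m)"
      by (simp add: algebra_simps add_divide_distrib)
    also have "\<dots> \<le> 16 * (262144 * (4 ^ k * (1 + real (slack f k))) * (1 / 2) ^ dist_nat m k)
      + 256 * (real R + 1) / 2 ^ (f + r) * (262144 * 16 ^ k * (1 / 2) ^ dist_nat m k)"
      by (intro add_mono mult_left_mono expected_low_le expected_confident_le) auto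
    also have "\<dots> = 262144 * (16 * (4 ^ k * (1 + real (slack f k)))
     + 256 * (real R + 1) * (16 ^ k / 2 ^ (f + r))) * (1 / 2) ^ dist_nat m k"
      by (simp add: algebra_simps add_divide_distrib)
    finally show "real (quota R f r m) * survive k m \<le> 262144 * (16 * (4 ^ k * (1 + real (slack f k)))
     + 256 * (real R + 1) * (16 ^ k / 2 ^ (f + r))) * (1 / 2) ^ dist_nat m k" .
  qed
  also have "\<dots> = 262144 * (16 * (4 ^ k * (1 + real (slack f k)))
     + 256 * (real R + 1) * (16 ^ k / 2 ^ (f + r))) * (\<Sum>m\<le>r. (1 / 2) ^ dist_nat m k)"
    by (simp only: sum_distrib_left)
  also have "\<dots> \<le> 262144 * (16 * (4 ^ k * (1 + real (slack f k)))
     + 256 * (real R + 1) * (16 ^ k / 2 ^ (f + r))) * 4"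
    by (intro mult_left_mono sum_half_dist_le) auto
  also have "\<dots> = session_bound R k r f" by (simp add: session_bound_def)
  finally show ?thesis .
qed

section \<open>Length of a single session\<close>

context random_game
begin

text \<open>The samples are required to fit into the horizon, because only rewards up to T are
  random.\<close>

definition passes :: "(nat \<times> nat \<Rightarrow> nat) \<Rightarrow> nat \<Rightarrow> nat \<Rightarrow> nat \<Rightarrow> nat \<Rightarrow> bool" where
  "passes y i r s m \<longleftrightarrow> (\<forall>l<m. s + quota R (focus (tr y s)) r l \<le> T \<and>
     \<not> fails R (bar (tr y s)) (quota R (focus (tr y s)) r l) (psum y i s (quota R (focus (tr y s)) r l)) l)"

text \<open>A pull is charged to the start s of its session and to the level m it serves: it is
  among the first \<open>quota\<close> pulls after s, and all lower levels have been passed.\<close>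

lemma session_count:
  assumes r: "r < R"
  shows "(\<Sum>t<T. of_bool (arm (tr y t) = i \<and> stage (tr y t) = r) :: real)
    \<le> (\<Sum>s<T. \<Sum>m\<le>r. of_bool (begins y i r s \<and> passes y i r s m) * real (quota R (focus (tr y s)) r m))"
proof -
  let ?q = "\<lambda>s m. quota R (focus (tr y s)) r m"
  have "(\<Sum>t<T. of_bool (arm (tr y t) = i \<and> stage (tr y t) = r) :: real)
    \<le> (\<Sum>t<T. \<Sum>s<T. \<Sum>m\<le>r. of_bool (begins y i r s \<and> passes y i r s m) * of_bool (t \<in> {s..<s + ?q s m}))"
  proof (rule sum_mono)
    fix t assume t: "t \<in> {..<T}"
    have "(of_bool (arm (tr y t) = i \<and> stage (tr y t) = r) :: real) \<le>
      (\<Sum>x\<in>{..<T} \<times> {..r}. of_bool ((begins y i r (fst x) \<and> passes y i r (fst x) (snd x)) \<and>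
         t \<in> {fst x..<fst x + ?q (fst x) (snd x)}))"
    proof (rule of_bool_le_sum)
      assume a: "arm (tr y t) = i \<and> stage (tr y t) = r"
      define s where "s = t - pulls (tr y t)"
      have s: "tr y s = fresh (tr y t)" unfolding s_def by (rule invD)
      have b: "begins y i r s" using s a by (simp add: begins_def fresh_def)
      have sf: "focus (tr y s) = focus (tr y t)" "bar (tr y s) = bar (tr y t)" by (simp_all add: s fresh_def)
      have "passes y i r s (level (tr y t))"
        unfolding passes_def sf
      proof (intro allI impI conjI)
        fix l assume l: "l < level (tr y t)"
        show "s + quota R (focus (tr y t)) r l \<le> T"
          using invD(8)[OF l] invD(6)[of y t] t a by (simp add: s_def)
        show "\<not> fails R (bar (tr y t)) (quota R (focus (tr y t)) r l)
          (psum y i s (quota R (focus (tr y t)) r l)) l"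
          using invD(9)[OF l] a by (simp add: s_def)
      qed
      moreover have "pulls (tr y t) < quota R (focus (tr y t)) (stage (tr y t)) (level (tr y t))"
        using inv[of y t] unfolding inv_def by blast
      then have "t \<in> {s..<s + ?q s (level (tr y t))}" unfolding sf using a invD(6)[of y t] by (simp add: s_def)
      moreover have "(s, level (tr y t)) \<in> {..<T} \<times> {..r}" using t a invD(5)[of y t] by (simp add: s_def less_imp_diff_less)
      ultimately show "\<exists>x\<in>{..<T} \<times> {..r}. (begins y i r (fst x) \<and> passes y i r (fst x) (snd x)) \<and>
         t \<in> {fst x..<fst x + ?q (fst x) (snd x)}"
        using b by (intro bexI[of _ "(s, level (tr y t))"]) auto
    qed simp
    then show "(of_bool (arm (tr y t) = i \<and> stage (tr y t) = r) :: real) \<le>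
      (\<Sum>s<T. \<Sum>m\<le>r. of_bool (begins y i r s \<and> passes y i r s m) * of_bool (t \<in> {s..<s + ?q s m}))"
      unfolding sum.cartesian_product by (simp only: of_bool_conj case_prod_unfold)
  qed
  also have "\<dots> = (\<Sum>s<T. \<Sum>t<T. \<Sum>m\<le>r. of_bool (begins y i r s \<and> passes y i r s m) * of_bool (t \<in> {s..<s + ?q s m}))"
    by (rule sum.swap)
  also have "\<dots> = (\<Sum>s<T. \<Sum>m\<le>r. of_bool (begins y i r s \<and> passes y i r s m) * (\<Sum>t<T. of_bool (t \<in> {s..<s + ?q s m})))"
    unfolding sum_distrib_left by (intro sum.cong refl sum.swap)
  also have "\<dots> \<le> (\<Sum>s<T. \<Sum>m\<le>r. of_bool (begins y i r s \<and> passes y i r s m) * real (?q s m))"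
  proof (intro sum_mono mult_left_mono)
    fix s m
    have "(\<Sum>t<T. of_bool (t \<in> {s..<s + ?q s m}) :: real) = real (card ({..<T} \<inter> {s..<s + ?q s m}))"
      by (simp add: sum_of_bool_eq Int_def)
    also have "\<dots> \<le> real (card {s..<s + ?q s m})" by (intro of_nat_mono card_mono) auto
    finally show "(\<Sum>t<T. of_bool (t \<in> {s..<s + ?q s m}) :: real) \<le> real (?q s m)" by simp
  qed simp
  finally show ?thesis .
qed

text \<open>C is an event of the past of s that makes the bar accurate. Reaching a level m > k + 2
  then forces an overestimate at level m - 1, an event about rewards after s, so its probability
  multiplies the quota.\<close>

lemma session_length:
  assumes i: "i < K" and r: "r < R" and gap: "1 / 2 ^ k \<le> \<mu> opt - \<mu> i"
    and C: "\<And>s y y'. (\<And>p. snd p \<le> s \<Longrightarrow> y p = y' p) \<Longrightarrow> C s y = C s y'"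
    and acc: "\<And>s y. C s y \<Longrightarrow> \<mu> opt - 1 / 4 * (1 / 2 ^ k) \<le> V (tr y s)"
  shows "Ex (\<lambda>y. \<Sum>s<T. \<Sum>m\<le>r. of_bool (begins y i r s \<and> C s y \<and> passes y i r s m) * real (quota R (focus (tr y s)) r m))
    \<le> Ex (\<lambda>y. \<Sum>s<T. of_bool (begins y i r s \<and> C s y) * session_bound R k r (focus (tr y s)))"
proof -
  let ?q = "\<lambda>y s m. quota R (focus (tr y s)) r m"
  let ?f = "\<lambda>s m y. of_bool (begins y i r s \<and> C s y) * real (?q y s m)"
  have "Ex (\<lambda>y. of_bool (begins y i r s \<and> C s y \<and> passes y i r s m) * real (?q y s m)) \<le> Ex (?f s m) * survive k m"
    if m: "m \<le> r" for s m
  proof (cases "m \<le> k + 2")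
    case True
    have "Ex (\<lambda>y. of_bool (begins y i r s \<and> C s y \<and> passes y i r s m) * real (?q y s m)) \<le> Ex (?f s m)"
      by (intro Ex_mono mult_right_mono) auto
    then show ?thesis using True by (simp add: survive_def)
  next
    case False
    define l where "l = m - 1"
    have l: "l < m" "k + 2 \<le> l" "l \<le> R" using False m r by (auto simp: l_def)
    let ?G = "\<lambda>f y. s + quota R f r l \<le> T \<and> \<nu> i + 1 / 2 ^ (k + 3) \<le> est y i s (quota R f r l)"
    have "Ex (\<lambda>y. of_bool (begins y i r s \<and> C s y \<and> passes y i r s m) * real (?q y s m))
      \<le> Ex (\<lambda>y. ?f s m y * of_bool (?G (focus (tr y s)) y))"
    proof (rule Ex_mono)
      fix y
      have "?G (focus (tr y s)) y" if "C s y" "passes y i r s m"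
      proof
        have p: "s + ?q y s l \<le> T" "\<not> fails R (bar (tr y s)) (?q y s l) (psum y i s (?q y s l)) l"
          using that(2) l(1) unfolding passes_def by blast+
        show "s + ?q y s l \<le> T" by (rule p)
        have "V (tr y s) \<le> est y i s (?q y s l) + 2 * (1 / 2 ^ l)"
          using p(2) by (simp add: fails_est quota_pos)
        moreover have "1 / (2::real) ^ l \<le> 1 / 2 ^ (k + 2)" using l(2) by (rule half_power_le)
        then have "1 / (2::real) ^ l \<le> 1 / 4 * (1 / 2 ^ k)" by simp
        moreover have "\<nu> i \<le> \<mu> i + 1 / 32 * (1 / 2 ^ k)"
          using \<nu>_close[OF i] grid_ge[of k] l by (auto simp: abs_le_iff)
        moreover have "0 < 1 / (2::real) ^ k" by simp
        \<comment> \<open>In units of 2^-k: the gap 1, less 1/4 for the bar, 2/4 for the tolerance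
          of the test and 1/32 for rounding, exceeds 1/8.\<close>
        ultimately have "\<nu> i + 1 / 8 * (1 / 2 ^ k) \<le> est y i s (?q y s l)"
          using acc[OF that(1)] gap by linarith
        then show "\<nu> i + 1 / 2 ^ (k + 3) \<le> est y i s (?q y s l)" by (simp add: power_add)
      qed
      then show "of_bool (begins y i r s \<and> C s y \<and> passes y i r s m) * real (?q y s m)
        \<le> ?f s m y * of_bool (?G (focus (tr y s)) y)" by auto
    qed
    also have "\<dots> \<le> Ex (?f s m) * survive k m"
    proof (rule session[where c = "\<lambda>y. focus (tr y s)" and G = ?G])
      fix y y' :: "nat \<times> nat \<Rightarrow> nat"
      assume a: "\<And>p. snd p \<le> s \<Longrightarrow> y p = y' p"
      show "?f s m y = ?f s m y'" "focus (tr y s) = focus (tr y' s)"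
        using begins_cong[OF a] C[OF a] tr_cong[OF a, of s] by simp_all
    next
      fix v and y y' :: "nat \<times> nat \<Rightarrow> nat"
      assume "\<And>p. s < snd p \<Longrightarrow> y p = y' p"
      then have "est y i s n = est y' i s n" for n
        by (intro psum_cong[where P = "\<lambda>l. s < l"]) auto
      then show "?G v y = ?G v y'" by simp
    next
      fix y
      let ?F = "focus (tr y s)"
      show "Ex (\<lambda>z. of_bool (?G ?F z)) \<le> survive k m"
      proof (cases "s + quota R ?F r l \<le> T")
        case True
        have fR: "?F \<le> R" using invD(3,4)[of y s] by simp
        have "16 * 4 ^ l * 1 \<le> 16 * 4 ^ l * (1 + slack ?F l)" by (intro mult_left_mono) auto
        also have "\<dots> \<le> quota R ?F r l" using l(3) fR by (rule quota_ge)
        finally have "real (16 * 4 ^ l) \<le> real (quota R ?F r l)" by (simp only: of_nat_le_iff)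
        then have "2 * real (16 * 4 ^ l) * (1 / 2 ^ (k + 3))\<^sup>2 \<le> 2 * real (quota R ?F r l) * (1 / 2 ^ (k + 3))\<^sup>2"
          by (intro mult_right_mono) auto
        \<comment> \<open>This is the origin of the exponent in \<open>survive\<close>: 2 * 16 *
          4^(m - 1) / 4^(k + 3).\<close>
        moreover have "2 * real (16 * 4 ^ l) * (1 / 2 ^ (k + 3))\<^sup>2 = 8 * 4 ^ (m - k - 3)"
        proof -
          obtain d where d: "l = k + 2 + d" using l(2) le_Suc_ex by blast
          then have "m - k - 3 = d" using l_def False by simp
          then show ?thesis unfolding d by (simp add: power_divide power_add power_mult_distrib two_power_squared)
        qed
        ultimately have "8 * 4 ^ (m - k - 3) \<le> 2 * real (quota R ?F r l) * (1 / 2 ^ (k + 3))\<^sup>2"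
          by linarith
        then have "- 2 * real (quota R ?F r l) * (1 / 2 ^ (k + 3))\<^sup>2 \<le> - 8 * 4 ^ (m - k - 3)"
          by linarith
        then have "exp (- 2 * real (quota R ?F r l) * (1 / 2 ^ (k + 3))\<^sup>2) \<le> survive k m"
          using False unfolding survive_def by (simp only: exp_le_cancel_iff if_False)
        moreover have "Ex (\<lambda>z. of_bool (?G ?F z)) \<le> Ex (\<lambda>z. of_bool (\<nu> i + 1 / 2 ^ (k + 3) \<le> est z i s (quota R ?F r l)))"
          by (intro Ex_mono) auto
        moreover have "\<dots> \<le> exp (- 2 * real (quota R ?F r l) * (1 / 2 ^ (k + 3))\<^sup>2)"
          using True by (intro hoeffding i quota_pos) auto
        ultimately show ?thesis by linarith
      next
        case False
        then show ?thesis using survive_bounds by simp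
      qed
    qed simp
    finally show ?thesis .
  qed
  then have "Ex (\<lambda>y. \<Sum>s<T. \<Sum>m\<le>r. of_bool (begins y i r s \<and> C s y \<and> passes y i r s m) * real (?q y s m))
    \<le> (\<Sum>s<T. \<Sum>m\<le>r. Ex (?f s m) * survive k m)"
    unfolding Ex_sum by (intro sum_mono) auto
  also have "\<dots> = (\<Sum>s<T. \<Sum>m\<le>r. Ex (\<lambda>y. ?f s m y * survive k m))"
    by simp
  also have "\<dots> = Ex (\<lambda>y. \<Sum>s<T. \<Sum>m\<le>r. ?f s m y * survive k m)"
    by (simp only: Ex_sum)
  also have "\<dots> \<le> Ex (\<lambda>y. \<Sum>s<T. of_bool (begins y i r s \<and> C s y) * session_bound R k r (focus (tr y s)))"
  proof (intro Ex_mono sum_mono)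
    fix y s
    have "(\<Sum>m\<le>r. ?f s m y * survive k m) = of_bool (begins y i r s \<and> C s y) * (\<Sum>m\<le>r. real (?q y s m) * survive k m)"
      by (simp add: sum_distrib_left mult_ac)
    also have "\<dots> \<le> of_bool (begins y i r s \<and> C s y) * session_bound R k r (focus (tr y s))"
      by (intro mult_left_mono expected_quota_le) auto
    finally show "(\<Sum>m\<le>r. ?f s m y * survive k m) \<le> \<dots>" .
  qed
  finally show ?thesis .
qed

end

section \<open>Total number of pulls of a suboptimal arm\<close>

lemma sum_four_power_le: "(\<Sum>m\<le>r. (4::real) ^ m) \<le> 2 * 4 ^ r"
proof (induction r)
  case (Suc r)
  have "0 \<le> (4::real) ^ r" by simp
  with Suc show ?case unfolding sum.atMost_Suc power_Suc by linarith
qed simp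

lemma sum_four_power_less: "(\<Sum>r<n. (4::real) ^ r) \<le> 4 ^ n"
proof (induction n)
  case (Suc n)
  have "0 \<le> (4::real) ^ n" by simp
  with Suc show ?case unfolding sum.lessThan_Suc power_Suc by linarith
qed simp

locale gapped_game = random_game +
  fixes g :: nat and lev :: "nat \<Rightarrow> nat"
  assumes g_less: "g < K" and g_gap: "\<mu> g < \<mu> opt"
    and g_min: "\<And>i. i < K \<Longrightarrow> \<mu> i < \<mu> opt \<Longrightarrow> \<mu> i \<le> \<mu> g"
    and lev: "\<And>i. i < K \<Longrightarrow> \<mu> i < \<mu> opt \<Longrightarrow> 1 / 2 ^ lev i \<le> \<mu> opt - \<mu> i \<and> \<mu> opt - \<mu> i < 2 * (1 / 2 ^ lev i)"
    and \<mu>_le_1: "\<And>i. i < K \<Longrightarrow> \<mu> i \<le> 1"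
begin

abbreviation wait :: "(nat \<times> nat \<Rightarrow> nat) \<Rightarrow> nat \<Rightarrow> nat \<Rightarrow> nat" where
  "wait y t i \<equiv> delay i (lev i) (unlucky y t)"

text \<open>The bar is accurate enough for arm i, and the focus lies between the levels of i and g
  up to the delays. Delays are taken at time s, not T, so that the property belongs to the past of
  the session, as \<open>session_length\<close> demands.\<close>

definition calm :: "nat \<Rightarrow> nat \<Rightarrow> nat \<Rightarrow> (nat \<times> nat \<Rightarrow> nat) \<Rightarrow> bool" where
  "calm i r s y \<longleftrightarrow> lev i \<le> r \<and> \<mu> opt - 1 / 4 * (1 / 2 ^ lev i) \<le> V (tr y s) \<and>
     lev i \<le> focus (tr y s) + 2 * wait y s i + 6 \<and>
     focus (tr y s) \<le> lev g + 7 + 2 * wait y s g"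

lemma calm_cong: "(\<And>p. snd p \<le> s \<Longrightarrow> y p = y' p) \<Longrightarrow> calm i r s y = calm i r s y'"
  using tr_cong[of s y y' s] unlucky_cong[of s y y'] by (simp add: calm_def)

lemma begins_calm:
  assumes "good y" "s \<le> T" "i < K" "\<mu> i < \<mu> opt" "begins y i r s" "r < R"
    and "2 * (block0 (lev i) + wait y T i) + 2 \<le> r"
  shows "calm i r s y"
proof -
  have st: "stage (tr y s) = r" using assms(5) by (simp add: begins_def)
  have "wait y s i \<le> wait y T i" using assms(2) by (intro delay_mono unlucky_mono)
  then have late: "2 * (block0 (lev i) + wait y s i) + 2 \<le> r" using assms(7) by simp
  note lv = lev[OF assms(3,4)]
  have "lev i \<le> r" using assms(7) block0_bounds(1)[of "lev i"] by simp
  moreover have "focus (tr y s) \<le> lev g + 7 + 2 * wait y s g"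
    using lev[OF g_less g_gap] g_min by (intro focus_bound[OF assms(1,2) g_less]) auto
  ultimately show ?thesis unfolding calm_def
    using settled[OF assms(1,2,3) st assms(6) conjunct1[OF lv] conjunct2[OF lv] late] by simp
qed

lemma sum_begins_le:
  assumes "r < R" "0 \<le> B" "\<And>s. s < T \<Longrightarrow> begins y i r s \<Longrightarrow> P s \<Longrightarrow> X s \<le> B"
  shows "(\<Sum>s<T. of_bool (begins y i r s \<and> P s) * X s) \<le> (B :: real)"
proof -
  have "(\<Sum>s<T. of_bool (begins y i r s \<and> P s) * X s) \<le> (\<Sum>s<T. of_bool (begins y i r s \<and> P s) * B)"
    using assms(3) by (intro sum_mono) auto
  also have "\<dots> = (\<Sum>s<T. of_bool (begins y i r s \<and> P s)) * B" by (simp add: sum_distrib_right)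
  also have "\<dots> \<le> of_bool True * B"
    using begins_unique[OF _ _ assms(1)] assms(2) by (intro mult_right_mono sum_of_bool_le) auto
  finally show ?thesis by simp
qed

text \<open>Pulls outside calm sessions. The rounds up to the first unspoiled block cost 512 (R + 1)
  4^r each, and the exponent of their sum is at most lev + 6 + 2 wait; one more share pays for
  committing to a wrong champion.\<close>

definition hurried :: "(nat \<times> nat \<Rightarrow> nat) \<Rightarrow> nat \<Rightarrow> real" where
  "hurried y i = 513 * (real R + 1) * (4 ^ (lev i + 6) * 16 ^ wait y T i)"

definition settled_pulls :: "(nat \<times> nat \<Rightarrow> nat) \<Rightarrow> nat \<Rightarrow> nat \<Rightarrow> real" where
  "settled_pulls y i r = (\<Sum>s<T. \<Sum>m\<le>r. of_bool (begins y i r s \<and> calm i r s y \<and> passes y i r s m)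
     * real (quota R (focus (tr y s)) r m))"

text \<open>Sessions that are not calm occur only before the first unspoiled block is over; they are
  charged a complete climb with the largest quotas.\<close>

lemma pulls_in_round_le:
  assumes good: "good y" and i: "i < K" "\<mu> i < \<mu> opt" and r: "r < R"
  shows "(\<Sum>t<T. of_bool (arm (tr y t) = i \<and> stage (tr y t) = r) :: real)
    \<le> of_bool (r < 2 * (block0 (lev i) + wait y T i) + 2) * (512 * (real R + 1) * 4 ^ r) + settled_pulls y i r"
proof -
  let ?q = "\<lambda>s m. real (quota R (focus (tr y s)) r m)"
  let ?late = "2 * (block0 (lev i) + wait y T i) + 2 \<le> r"
  have "(\<Sum>t<T. of_bool (arm (tr y t) = i \<and> stage (tr y t) = r) :: real)
    \<le> (\<Sum>s<T. \<Sum>m\<le>r. of_bool (begins y i r s \<and> passes y i r s m) * ?q s m)"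
    by (rule session_count[OF r])
  also have "\<dots> \<le> (\<Sum>s<T. \<Sum>m\<le>r. of_bool (begins y i r s \<and> \<not> calm i r s y) * ?q s m
      + of_bool (begins y i r s \<and> calm i r s y \<and> passes y i r s m) * ?q s m)"
    by (intro sum_mono) auto
  also have "\<dots> = (\<Sum>s<T. of_bool (begins y i r s \<and> \<not> calm i r s y) * (\<Sum>m\<le>r. ?q s m)) + settled_pulls y i r"
    by (simp add: sum.distrib sum_distrib_left settled_pulls_def)
  also have "(\<Sum>s<T. of_bool (begins y i r s \<and> \<not> calm i r s y) * (\<Sum>m\<le>r. ?q s m))
    \<le> of_bool (r < 2 * (block0 (lev i) + wait y T i) + 2) * (512 * (real R + 1) * 4 ^ r)"
  proof (rule sum_begins_le[OF r])
    fix s assume s: "s < T" "begins y i r s" "\<not> calm i r s y"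
    have hurry: "r < 2 * (block0 (lev i) + wait y T i) + 2"
      using begins_calm[OF good _ i s(2) r] s by (meson less_imp_le not_less)
    have "(\<Sum>m\<le>r. ?q s m) \<le> (\<Sum>m\<le>r. 256 * (real R + 1) * 4 ^ m)"
    proof (rule sum_mono)
      fix m assume "m \<in> {..r}"
      then have "quota R (focus (tr y s)) r m \<le> 4 ^ m * (256 * (R + 1))"
        using r invD(3,4)[of y s] by (intro quota_le) auto
      then have "?q s m \<le> real (4 ^ m * (256 * (R + 1)))" by (simp only: of_nat_le_iff)
      then show "?q s m \<le> 256 * (real R + 1) * 4 ^ m" by (simp add: algebra_simps)
    qed
    also have "\<dots> = 256 * (real R + 1) * (\<Sum>m\<le>r. 4 ^ m)" by (simp only: sum_distrib_left)
    also have "\<dots> \<le> 256 * (real R + 1) * (2 * 4 ^ r)" by (intro mult_left_mono sum_four_power_le) auto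
    also have "\<dots> = of_bool (r < 2 * (block0 (lev i) + wait y T i) + 2) * (512 * (real R + 1) * 4 ^ r)"
      using hurry by simp
    finally show "(\<Sum>m\<le>r. ?q s m) \<le> \<dots>" .
  qed simp
  finally show ?thesis by simp
qed

lemma pulls_le:
  assumes good: "good y" and i: "i < K" "\<mu> i < \<mu> opt"
  shows "(\<Sum>t<T. of_bool (pull R (tr y t) = i) :: real) \<le> hurried y i + (\<Sum>r<R. settled_pulls y i r)"
proof -
  let ?x = "wait y T i"
  let ?late = "2 * (block0 (lev i) + ?x) + 2"
  have "(\<Sum>t<T. of_bool (pull R (tr y t) = i) :: real)
    \<le> (\<Sum>t<T. (\<Sum>r<R. of_bool (arm (tr y t) = i \<and> stage (tr y t) = r))
        + of_bool (stage (tr y t) = R \<and> champ (tr y t) = i))"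
  proof (rule sum_mono)
    fix t
    show "(of_bool (pull R (tr y t) = i) :: real)
      \<le> (\<Sum>r<R. of_bool (arm (tr y t) = i \<and> stage (tr y t) = r)) + of_bool (stage (tr y t) = R \<and> champ (tr y t) = i)"
    proof (cases "stage (tr y t) < R")
      case True
      have "(of_bool (pull R (tr y t) = i) :: real) \<le> (\<Sum>r<R. of_bool (arm (tr y t) = i \<and> stage (tr y t) = r))"
        using True by (intro of_bool_le_sum) (auto simp: pull_def)
      then show ?thesis by (simp add: add_increasing2)
    next
      case False
      then have "stage (tr y t) = R" using invD(3)[of y t] by simp
      then show ?thesis by (auto simp: pull_def sum_nonneg add_increasing)
    qed
  qed
  also have "\<dots> = (\<Sum>r<R. \<Sum>t<T. of_bool (arm (tr y t) = i \<and> stage (tr y t) = r))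
      + (\<Sum>t<T. of_bool (stage (tr y t) = R \<and> champ (tr y t) = i))"
    unfolding sum.distrib by (subst sum.swap) simp
  also have "\<dots> \<le> (\<Sum>r<R. of_bool (r < ?late) * (512 * (real R + 1) * 4 ^ r) + settled_pulls y i r)
      + 4 ^ (lev i + 4) * 16 ^ ?x"
  proof (intro add_mono sum_mono pulls_in_round_le good i)
    show "(\<Sum>t<T. of_bool (stage (tr y t) = R \<and> champ (tr y t) = i) :: real) \<le> 4 ^ (lev i + 4) * 16 ^ ?x"
    proof (cases "\<exists>t<T. stage (tr y t) = R \<and> champ (tr y t) = i")
      case True
      then obtain t where t: "t < T" "stage (tr y t) = R" "champ (tr y t) = i" by blast
      \<comment> \<open>Committing to a suboptimal arm requires a delay so long that even all T
        \<le> 4^R pulls fit into the cost of that delay.\<close>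
      have "R \<le> lev i + 4 + 2 * wait y t i"
        using t lev[OF i] by (intro committed[OF good]) auto
      moreover have "wait y t i \<le> ?x" using t by (intro delay_mono unlucky_mono) auto
      ultimately have R: "R \<le> lev i + 4 + 2 * ?x" by simp
      have "(\<Sum>t<T. of_bool (stage (tr y t) = R \<and> champ (tr y t) = i) :: real) \<le> (\<Sum>t<T. 1)"
        by (intro sum_mono) auto
      also have "\<dots> = real T" by simp
      also have "\<dots> \<le> 4 ^ R" using T_le by (metis of_nat_le_iff of_nat_power of_nat_numeral)
      also have "\<dots> \<le> 4 ^ (lev i + 4 + 2 * ?x)" using R by (intro power_increasing) auto
      also have "\<dots> = 4 ^ (lev i + 4) * 16 ^ ?x" by (simp add: power_add power_mult)
      finally show ?thesis .
    next
      case False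
      then have "(\<Sum>t<T. of_bool (stage (tr y t) = R \<and> champ (tr y t) = i) :: real) = 0" by (intro sum.neutral) auto
      then show ?thesis by simp
    qed
  qed auto
  also have "\<dots> = 512 * (real R + 1) * (\<Sum>r<R. of_bool (r < ?late) * 4 ^ r) + (\<Sum>r<R. settled_pulls y i r)
      + 4 ^ (lev i + 4) * 16 ^ ?x"
    by (simp add: sum.distrib sum_distrib_left mult_ac)
  also have "(\<Sum>r<R. of_bool (r < ?late) * (4::real) ^ r) \<le> 4 ^ (lev i + 6) * 16 ^ ?x"
  proof -
    have "(\<Sum>r<R. of_bool (r < ?late) * (4::real) ^ r) = (\<Sum>r\<in>{..<R} \<inter> {..<?late}. 4 ^ r)"
      by (subst sum.inter_restrict) (auto intro!: sum.cong)
    also have "\<dots> \<le> (\<Sum>r<?late. 4 ^ r)" by (intro sum_mono2) auto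
    also have "\<dots> \<le> 4 ^ ?late" by (rule sum_four_power_less)
    also have "\<dots> \<le> 4 ^ (lev i + 6 + 2 * ?x)" using block0_bounds(2)[of "lev i"] by (intro power_increasing) auto
    also have "\<dots> = 4 ^ (lev i + 6) * 16 ^ ?x" by (simp add: power_add power_mult)
    finally show ?thesis .
  qed
  also have "512 * (real R + 1) * (4 ^ (lev i + 6) * 16 ^ ?x) + (\<Sum>r<R. settled_pulls y i r) + 4 ^ (lev i + 4) * 16 ^ ?x
    \<le> hurried y i + (\<Sum>r<R. settled_pulls y i r)"
  proof -
    have "(4::real) ^ (lev i + 4) * 16 ^ ?x \<le> 4 ^ (lev i + 6) * 16 ^ ?x"
      by (intro mult_right_mono power_increasing) auto
    also have "\<dots> \<le> (real R + 1) * (4 ^ (lev i + 6) * 16 ^ ?x)"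
      using mult_right_mono[of 1 "real R + 1" "4 ^ (lev i + 6) * 16 ^ ?x"] by simp
    finally show ?thesis by (simp add: hurried_def algebra_simps)
  qed
  finally show ?thesis by simp
qed

definition width :: "nat \<Rightarrow> nat" where
  "width i = floor_sqrt (min (lev i) (lev g - lev i))"

text \<open>Up to the focus, replacing the focus by \<open>lev g\<close> changes the argument of the
  root by at most 7 + 2 wait, and the root is 1-Lipschitz. Beyond the focus the slack is k - focus,
  which calmness bounds by the delay.\<close>

lemma slack_calm:
  assumes "calm i r s y" "s \<le> T"
  shows "slack (focus (tr y s)) (lev i) \<le> width i + 13 + 2 * wait y T i + 2 * wait y T g"
proof -
  have w: "wait y s i \<le> wait y T i" "wait y s g \<le> wait y T g"
    using assms(2) by (intro delay_mono unlucky_mono; simp)+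
  let ?f = "focus (tr y s)" and ?k = "lev i"
  show ?thesis
  proof (cases "?k \<le> ?f")
    case True
    have "min ?k (?f - ?k) \<le> min ?k (lev g - ?k) + (7 + 2 * wait y T g)"
      using assms(1) w by (auto simp: calm_def)
    then have "floor_sqrt (min ?k (?f - ?k)) \<le> width i + (7 + 2 * wait y T g)"
      unfolding width_def by (rule floor_sqrt_lipschitz)
    then show ?thesis using True by (simp add: slack_def)
  next
    case False
    have "?k \<le> ?f + 2 * wait y s i + 6" using assms(1) unfolding calm_def by blast
    then show ?thesis using False w(1) by (simp add: slack_def)
  qed
qed

text \<open>16^k / 2^(f + r) is split into 4^k, 2^(k - f), at most 64 * 4^wait by calmness, and 2^(k
  - r), geometric in the round.\<close>

lemma session_bound_calm:
  assumes "calm i r s y" "s \<le> T"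
  shows "session_bound R (lev i) r (focus (tr y s))
    \<le> 16777216 * 4 ^ lev i * (14 + real (width i) + 2 * 16 ^ wait y T i + 2 * 16 ^ wait y T g)
     + 17179869184 * (real R + 1) * 4 ^ lev i * 16 ^ wait y T i * (1 / 2) ^ (r - lev i)"
proof -
  let ?f = "focus (tr y s)" and ?k = "lev i" and ?x = "wait y T i" and ?z = "wait y T g"
  have x16: "real n \<le> 16 ^ n" for n
  proof -
    have "n < 2 ^ n" by (rule less_exp)
    also have "(2::nat) ^ n \<le> 16 ^ n" by (rule power_mono) auto
    finally have "real n \<le> real (16 ^ n)" by (simp only: of_nat_le_iff)
    then show ?thesis by simp
  qed
  have "real (slack ?f ?k) \<le> real (width i + 13 + 2 * ?x + 2 * ?z)"
    using slack_calm[OF assms] by (simp only: of_nat_le_iff)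
  then have s: "1 + real (slack ?f ?k) \<le> 14 + real (width i) + 2 * 16 ^ ?x + 2 * 16 ^ ?z"
    using x16[of ?x] x16[of ?z] unfolding of_nat_add of_nat_mult of_nat_numeral by linarith
  have kr: "?k \<le> r" using assms(1) by (simp add: calm_def)
  have "wait y s i \<le> ?x" using assms(2) by (intro delay_mono unlucky_mono)
  then have "?k \<le> ?f + (2 * ?x + 6)" using assms(1) by (simp add: calm_def)
  then have "(2::real) ^ ?k \<le> 2 ^ (?f + (2 * ?x + 6))" by (intro power_increasing) auto
  also have "\<dots> = 2 ^ ?f * (64 * 4 ^ ?x)" by (simp add: power_add power_mult)
  also have "\<dots> \<le> 2 ^ ?f * (64 * 16 ^ ?x)" by (intro mult_left_mono power_mono) auto
  finally have k: "2 ^ ?k / 2 ^ ?f \<le> 64 * (16::real) ^ ?x" by (simp add: field_simps)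
  have "(16::real) ^ ?k / 2 ^ (?f + r) = 4 ^ ?k * ((2 ^ ?k / 2 ^ ?f) * (2 ^ ?k / 2 ^ r))"
    by (simp add: power_add flip: power_mult_distrib)
  also have "(2::real) ^ ?k / 2 ^ r = (1 / 2) ^ (r - ?k)"
    using kr by (simp add: power_diff power_divide)
  also have "4 ^ ?k * ((2 ^ ?k / 2 ^ ?f) * (1 / 2 :: real) ^ (r - ?k)) \<le> 4 ^ ?k * ((64 * 16 ^ ?x) * (1 / 2) ^ (r - ?k))"
    using k by (intro mult_left_mono mult_right_mono) auto
  finally have c: "(16::real) ^ ?k / 2 ^ (?f + r) \<le> 4 ^ ?k * ((64 * 16 ^ ?x) * (1 / 2) ^ (r - ?k))" .
  have "session_bound R ?k r ?f \<le> 1048576 * (16 * (4 ^ ?k * (14 + real (width i) + 2 * 16 ^ ?x + 2 * 16 ^ ?z))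
     + 256 * (real R + 1) * (4 ^ ?k * ((64 * 16 ^ ?x) * (1 / 2) ^ (r - ?k))))"
  proof -
    have 1: "16 * (4 ^ ?k * (1 + real (slack ?f ?k)))
      \<le> 16 * (4 ^ ?k * (14 + real (width i) + 2 * 16 ^ ?x + 2 * 16 ^ ?z))"
      using s by simp
    have 2: "256 * (real R + 1) * ((16::real) ^ ?k / 2 ^ (?f + r))
      \<le> 256 * (real R + 1) * (4 ^ ?k * ((64 * 16 ^ ?x) * (1 / 2) ^ (r - ?k)))"
      using c by (rule mult_left_mono) simp
    show ?thesis unfolding session_bound_def by (rule mult_left_mono[OF add_mono[OF 1 2]]) simp
  qed
  then show ?thesis by (simp add: algebra_simps)
qed

lemma calm_pulls_le:
  assumes "r < R"
  shows "(\<Sum>s<T. of_bool (begins y i r s \<and> calm i r s y) * session_bound R (lev i) r (focus (tr y s)))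
    \<le> 16777216 * 4 ^ lev i * (14 + real (width i) + 2 * 16 ^ wait y T i + 2 * 16 ^ wait y T g)
     + 17179869184 * (real R + 1) * 4 ^ lev i * 16 ^ wait y T i * (1 / 2) ^ dist_nat r (lev i)"
proof (rule sum_begins_le[OF assms])
  fix s assume "s < T" "calm i r s y"
  then show "session_bound R (lev i) r (focus (tr y s))
    \<le> 16777216 * 4 ^ lev i * (14 + real (width i) + 2 * 16 ^ wait y T i + 2 * 16 ^ wait y T g)
     + 17179869184 * (real R + 1) * 4 ^ lev i * 16 ^ wait y T i * (1 / 2) ^ dist_nat r (lev i)"
    using session_bound_calm[of i r s y] by (auto simp: dist_nat_def calm_def)
qed simp

lemma Ex_add: "Ex (\<lambda>y. f y + h y) = Ex f + Ex h"
  by (rule Bochner_Integration.integral_add) auto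

lemma Ex_const_mult: "Ex (\<lambda>y. c * f y) = c * Ex f"
  by simp

text \<open>The two delays enter additively, so the first moments of 16^wait suffice. The term with
  the width is paid in each of the \<open>R\<close> rounds; the confident term decays with the
  distance of r from k and is in effect paid once.\<close>

lemma expected_pulls_le:
  assumes i: "i < K" "\<mu> i < \<mu> opt"
  shows "Ex (\<lambda>y. of_bool (good y) * (\<Sum>t<T. of_bool (pull R (tr y t) = i)))
    \<le> 2 ^ 38 * (real R + 1) * 4 ^ lev i * (1 + real (width i))"
proof -
  let ?k = "lev i"
  let ?X = "\<lambda>y. (16::real) ^ wait y T i" and ?Z = "\<lambda>y. (16::real) ^ wait y T g"
  have mom: "Ex ?X \<le> 2" "Ex ?Z \<le> 2" using delay_moment[OF i(1)] delay_moment[OF g_less] by auto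
  have nn: "0 \<le> settled_pulls y i r" for y r
    unfolding settled_pulls_def by (intro sum_nonneg) auto
  have "Ex (\<lambda>y. of_bool (good y) * (\<Sum>t<T. of_bool (pull R (tr y t) = i)))
    \<le> Ex (\<lambda>y. hurried y i + (\<Sum>r<R. settled_pulls y i r))"
  proof (rule Ex_mono)
    fix y
    show "of_bool (good y) * (\<Sum>t<T. of_bool (pull R (tr y t) = i)) \<le> hurried y i + (\<Sum>r<R. settled_pulls y i r)"
      using pulls_le[OF _ i, of y] nn by (cases "good y") (auto simp: hurried_def sum_nonneg)
  qed
  also have "\<dots> = Ex (\<lambda>y. hurried y i) + (\<Sum>r<R. Ex (\<lambda>y. settled_pulls y i r))"
    by (simp only: Ex_add Ex_sum)
  also have "(\<Sum>r<R. Ex (\<lambda>y. settled_pulls y i r)) \<le>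
     (\<Sum>r<R. Ex (\<lambda>y. 16777216 * 4 ^ ?k * (14 + real (width i) + 2 * ?X y + 2 * ?Z y)
     + 17179869184 * (real R + 1) * 4 ^ ?k * ?X y * (1 / 2) ^ dist_nat r ?k))"
  proof (rule sum_mono)
    fix r assume r: "r \<in> {..<R}"
    have "Ex (\<lambda>y. settled_pulls y i r)
      \<le> Ex (\<lambda>y. \<Sum>s<T. of_bool (begins y i r s \<and> calm i r s y) * session_bound R ?k r (focus (tr y s)))"
      unfolding settled_pulls_def
      using r i lev[OF i] by (intro session_length calm_cong) (auto simp: calm_def)
    also have "\<dots> \<le> Ex (\<lambda>y. 16777216 * 4 ^ ?k * (14 + real (width i) + 2 * ?X y + 2 * ?Z y)
     + 17179869184 * (real R + 1) * 4 ^ ?k * ?X y * (1 / 2) ^ dist_nat r ?k)"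
      using r by (intro Ex_mono calm_pulls_le) auto
    finally show "Ex (\<lambda>y. settled_pulls y i r) \<le> \<dots>" .
  qed
  also have "\<dots> = (\<Sum>r<R. 16777216 * 4 ^ ?k * (14 + real (width i) + 2 * Ex ?X + 2 * Ex ?Z)
     + 17179869184 * (real R + 1) * 4 ^ ?k * Ex ?X * (1 / 2) ^ dist_nat r ?k)"
    by (simp add: Ex_add)
  also have "\<dots> \<le> (\<Sum>r<R. 16777216 * 4 ^ ?k * (14 + real (width i) + 2 * 2 + 2 * 2)
     + 17179869184 * (real R + 1) * 4 ^ ?k * 2 * (1 / 2) ^ dist_nat r ?k)"
    using mom by (intro sum_mono add_mono mult_left_mono mult_right_mono) auto
  also have "\<dots> = real R * (16777216 * 4 ^ ?k * (22 + real (width i)))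
     + 34359738368 * (real R + 1) * 4 ^ ?k * (\<Sum>r<R. (1 / 2) ^ dist_nat r ?k)"
    by (simp only: sum.distrib sum_distrib_left[symmetric] sum_constant card_lessThan) (simp add: algebra_simps)
  also have "\<dots> \<le> (real R + 1) * (16777216 * 4 ^ ?k * (22 * (1 + real (width i))))
     + 34359738368 * (real R + 1) * 4 ^ ?k * 4"
  proof (intro add_mono mult_mono mult_left_mono)
    have "(\<Sum>r<R. (1 / 2 :: real) ^ dist_nat r ?k) \<le> (\<Sum>r\<le>R. (1 / 2) ^ dist_nat r ?k)"
      by (intro sum_mono2) auto
    also have "\<dots> \<le> 4" by (rule sum_half_dist_le)
    finally show "(\<Sum>r<R. (1 / 2 :: real) ^ dist_nat r ?k) \<le> 4" .
  qed (auto intro: sum_nonneg)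
  also have "Ex (\<lambda>y. hurried y i) \<le> 513 * (real R + 1) * (4 ^ (?k + 6) * 2)"
    unfolding hurried_def Ex_const_mult using mom by (intro mult_left_mono) auto
  also have "513 * (real R + 1) * (4 ^ (?k + 6) * 2) + ((real R + 1) * (16777216 * 4 ^ ?k * (22 * (1 + real (width i))))
     + 34359738368 * (real R + 1) * 4 ^ ?k * 4)
     = (real R + 1) * 4 ^ ?k * (4202496 + 369098752 * (1 + real (width i)) + 137438953472)"
    by (simp add: power_add algebra_simps)
  also have "\<dots> \<le> (real R + 1) * 4 ^ ?k * (2 ^ 38 * (1 + real (width i)))"
    by (intro mult_left_mono) auto
  also have "\<dots> = 2 ^ 38 * (real R + 1) * 4 ^ lev i * (1 + real (width i))"
    by (simp only: mult_ac)
  finally show ?thesis by simp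
qed

text \<open>The regret is distributed over the suboptimal arms in good plays; in other plays it is
  at most T, which costs 1 in expectation.\<close>

theorem expected_regret_le:
  "Ex (\<lambda>y. \<Sum>t<T. \<mu> opt - \<mu> (pull R (tr y t)))
    \<le> 1 + (\<Sum>i | i < K \<and> \<mu> i < \<mu> opt. (\<mu> opt - \<mu> i) * (2 ^ 38 * (real R + 1) * 4 ^ lev i * (1 + real (width i))))"
proof -
  let ?S = "{i. i < K \<and> \<mu> i < \<mu> opt}"
  have fin: "finite ?S" by simp
  have pK: "pull R (tr y t) < K" for y t using invD(1,2)[of y t] by (simp add: pull_def)
  have pt: "\<mu> opt - \<mu> (pull R (tr y t)) = (\<Sum>i\<in>?S. (\<mu> opt - \<mu> i) * of_bool (pull R (tr y t) = i))" for y t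
  proof (cases "pull R (tr y t) \<in> ?S")
    case True
    have "(\<Sum>i\<in>?S. (\<mu> opt - \<mu> i) * of_bool (pull R (tr y t) = i))
      = (\<Sum>i\<in>{pull R (tr y t)}. (\<mu> opt - \<mu> i) * of_bool (pull R (tr y t) = i))"
      using True by (intro sum.mono_neutral_right) auto
    then show ?thesis by simp
  next
    case False
    then have "\<mu> (pull R (tr y t)) = \<mu> opt" using pK[of y t] opt_max[of "pull R (tr y t)"] by auto
    moreover have "(\<Sum>i\<in>?S. (\<mu> opt - \<mu> i) * of_bool (pull R (tr y t) = i)) = 0"
      using False by (intro sum.neutral) auto
    ultimately show ?thesis by simp
  qed
  have "Ex (\<lambda>y. \<Sum>t<T. \<mu> opt - \<mu> (pull R (tr y t)))
    \<le> Ex (\<lambda>y. real T * of_bool (\<not> good y) + (\<Sum>i\<in>?S. (\<mu> opt - \<mu> i) * (of_bool (good y) * (\<Sum>t<T. of_bool (pull R (tr y t) = i)))))"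
  proof (rule Ex_mono)
    fix y
    show "(\<Sum>t<T. \<mu> opt - \<mu> (pull R (tr y t))) \<le> real T * of_bool (\<not> good y)
      + (\<Sum>i\<in>?S. (\<mu> opt - \<mu> i) * (of_bool (good y) * (\<Sum>t<T. of_bool (pull R (tr y t) = i))))"
    proof (cases "good y")
      case True
      have "(\<Sum>t<T. \<mu> opt - \<mu> (pull R (tr y t))) = (\<Sum>i\<in>?S. \<Sum>t<T. (\<mu> opt - \<mu> i) * of_bool (pull R (tr y t) = i))"
        unfolding pt by (rule sum.swap)
      then show ?thesis using True by (simp add: sum_distrib_left)
    next
      case False
      have "(\<Sum>t<T. \<mu> opt - \<mu> (pull R (tr y t))) \<le> (\<Sum>t<T. 1)"
      proof (rule sum_mono)
        fix t
        show "\<mu> opt - \<mu> (pull R (tr y t)) \<le> 1"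
          using \<mu>_le_1[OF opt_less] \<mu>_nonneg[OF pK[of y t]] by linarith
      qed
      then show ?thesis using False by simp
    qed
  qed
  also have "\<dots> = real T * Ex (\<lambda>y. of_bool (\<not> good y))
    + (\<Sum>i\<in>?S. (\<mu> opt - \<mu> i) * Ex (\<lambda>y. of_bool (good y) * (\<Sum>t<T. of_bool (pull R (tr y t) = i))))"
    by (simp only: Ex_add Ex_sum Ex_const_mult)
  also have "\<dots> \<le> 1 + (\<Sum>i\<in>?S. (\<mu> opt - \<mu> i) * (2 ^ 38 * (real R + 1) * 4 ^ lev i * (1 + real (width i))))"
    by (intro add_mono not_good_prob sum_mono mult_left_mono expected_pulls_le) auto
  finally show ?thesis .
qed

end

section \<open>The player as a word-RAM program\<close>

text \<open>
  Cell 9 holds \<open>2 ^ level\<close> and cell 10 the slack.  Since cell 9 is never \<open>0\<close> afterwards, it also tells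
  the first run, in which there is no reward to process yet.
\<close>

abbreviation cell :: "nat \<Rightarrow> exp" where "cell i \<equiv> Load (Imm i)"

definition next_prog :: prog where
  "next_prog = Seq (Store (Imm 6) (Imm 0)) (Seq (Store (Imm 7) (Imm 0)) (Seq (Store (Imm 8) (Imm 0))
     (Seq (Store (Imm 9) (Imm 1)) (Seq (Store (Imm 10) (Imm 0))
     (Cond (Less (Add (cell 5) (Imm 1)) (cell 3))
        (Store (Imm 5) (Add (cell 5) (Imm 1)))
        (Seq (Store (Imm 5) (Imm 0)) (Store (Imm 11) (Add (cell 11) (Imm 1)))))))))"

definition low_exp :: exp where
  "low_exp = Less (Mul (Imm 2) (cell 8)) (Add (cell 13) (cell 11))"

text \<open>Expressions have no conditional; the case distinction becomes a mixture weighted by the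
  0/1 value of \<open>low_exp\<close>.\<close>

definition quota_exp :: "nat \<Rightarrow> exp" where
  "quota_exp B = Mul (Mul (cell 9) (cell 9))
     (Add (Mul low_exp (Mul (Imm 16) (Add (Imm 1) (cell 10)))) (Mul (Sub (Imm 1) low_exp) (Imm B)))"

definition gain_exp :: exp where "gain_exp = Mul (cell 7) (cell 9)"
definition bar_exp :: exp where "bar_exp = Mul (Mul (cell 12) (cell 6)) (cell 9)"
definition grid_exp :: "nat \<Rightarrow> exp" where "grid_exp Q = Mul (cell 6) (Imm Q)"

definition reject_prog :: "nat \<Rightarrow> prog" where
  "reject_prog Q = Seq
     (Cond low_exp Skip
        (Cond (Less (Add gain_exp (Mul (Imm 16) (grid_exp Q))) bar_exp) Skip (Store (Imm 13) (cell 8))))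
     next_prog"

text \<open>The slack changes by at most one when the level does, so a square root is corrected, not computed.\<close>

definition root_prog :: "exp \<Rightarrow> prog" where
  "root_prog h = Cond (Less h (Mul (cell 10) (cell 10)))
     (Store (Imm 10) (Sub (cell 10) (Imm 1)))
     (Cond (Less h (Mul (Add (cell 10) (Imm 1)) (Add (cell 10) (Imm 1)))) Skip
        (Store (Imm 10) (Add (cell 10) (Imm 1))))"

definition up_prog :: prog where
  "up_prog = Seq (Store (Imm 8) (Add (cell 8) (Imm 1))) (Seq (Store (Imm 9) (Mul (Imm 2) (cell 9)))
     (Cond (Less (cell 13) (cell 8))
        (Store (Imm 10) (Add (cell 10) (Imm 1)))
        (Cond (Less (cell 8) (Sub (cell 13) (cell 8)))
           (root_prog (cell 8)) (root_prog (Sub (cell 13) (cell 8))))))"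

definition accept_prog :: "nat \<Rightarrow> prog" where
  "accept_prog Q = Seq
     (Cond (Less gain_exp (Add (Mul (Mul (Add (cell 12) (Imm 1)) (cell 6)) (cell 9)) (grid_exp Q))) Skip
        (Seq (Store (Imm 12) (Quot (Sub gain_exp (grid_exp Q)) (Mul (cell 6) (cell 9))))
             (Store (Imm 14) (cell 5))))
     next_prog"

definition check_prog :: "nat \<Rightarrow> prog" where
  "check_prog Q = Cond (Less (Add gain_exp (Mul (Imm 2) (grid_exp Q))) bar_exp) (reject_prog Q)
     (Cond (Less (cell 8) (cell 11)) up_prog (accept_prog Q))"

text \<open>0 - 1 wraps around to the largest word 2^w - 1; its Q-th part is the width of one bucket
  of rewards.\<close>

definition reward_exp :: "nat \<Rightarrow> exp" where
  "reward_exp Q = Quot (cell 1) (Quot (Sub (Imm 0) (Imm 1)) (Imm Q))"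

definition step_prog :: "nat \<Rightarrow> nat \<Rightarrow> prog" where
  "step_prog Q B = Seq (Store (Imm 7) (Add (cell 7) (reward_exp Q))) (Seq (Store (Imm 6) (Add (cell 6) (Imm 1)))
     (Cond (Sub (cell 6) (quota_exp B)) Skip (check_prog Q)))"

text \<open>A run first processes the reward of the preceding pull and then announces the next arm,
  so the state lags one step behind the clock.\<close>

definition player_prog :: "nat \<Rightarrow> prog" where
  "player_prog R = Seq
     (Cond (cell 9) (Cond (Less (cell 11) (Imm R)) (step_prog (grid R) (256 * (R + 1))) Skip) (Store (Imm 9) (Imm 1)))
     (Cond (Less (cell 11) (Imm R)) (Store (Imm 0) (cell 5)) (Store (Imm 0) (cell 14)))"

definition stored :: "mem \<Rightarrow> nat \<Rightarrow> nat \<Rightarrow> nat \<Rightarrow> nat \<Rightarrow> nat \<Rightarrow> nat \<Rightarrow> nat \<Rightarrow> nat \<Rightarrow> nat \<Rightarrow> nat \<Rightarrow> nat \<Rightarrow> bool" where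
  "stored m K a n s l P q r v f b \<longleftrightarrow> 15 \<le> length m \<and> m ! 3 = K \<and> m ! 5 = a \<and> m ! 6 = n \<and> m ! 7 = s \<and>
     m ! 8 = l \<and> m ! 9 = P \<and> m ! 10 = q \<and> m ! 11 = r \<and> m ! 12 = v \<and> m ! 13 = f \<and> m ! 14 = b"

section \<open>Correctness of the pieces of the program\<close>

lemma mod_word: "16 \<le> w \<Longrightarrow> i \<le> 16 \<Longrightarrow> i mod 2 ^ w = (i::nat)"
proof -
  assume a: "16 \<le> w" "i \<le> 16"
  have "(2::nat) ^ 16 \<le> 2 ^ w" using a(1) by (intro power_increasing) auto
  with a show ?thesis by simp
qed

lemma mod_word_simps:
  assumes "16 \<le> w"
  shows "0 mod 2 ^ w = (0::nat)" "1 mod 2 ^ w = (1::nat)" "Suc 0 mod 2 ^ w = Suc 0" "2 mod 2 ^ w = (2::nat)" "3 mod 2 ^ w = (3::nat)" "5 mod 2 ^ w = (5::nat)"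
    "6 mod 2 ^ w = (6::nat)" "7 mod 2 ^ w = (7::nat)" "8 mod 2 ^ w = (8::nat)" "9 mod 2 ^ w = (9::nat)"
    "10 mod 2 ^ w = (10::nat)" "11 mod 2 ^ w = (11::nat)" "12 mod 2 ^ w = (12::nat)" "13 mod 2 ^ w = (13::nat)"
    "14 mod 2 ^ w = (14::nat)" "16 mod 2 ^ w = (16::nat)"
  using mod_word[OF assms] assms by simp_all

lemma exec_next:
  assumes "stored m K a n s l P q r v f b" "16 \<le> w" "a + 1 < 2 ^ w" "r + 1 < 2 ^ w"
  shows "\<exists>m'. exec w next_prog m = Some m' \<and> length m' = length m \<and>
    stored m' K (if a + 1 < K then a + 1 else 0) 0 0 0 1 0 (if a + 1 < K then r else r + 1) v f b"
  using assms mod_word_simps[OF assms(2)]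
  by (auto simp: next_prog_def stored_def)

lemma eval_exps:
  assumes "stored m K a n s l P q r v f b" "16 \<le> w"
  shows "2 * l < 2 ^ w \<Longrightarrow> f + r < 2 ^ w \<Longrightarrow> eval_exp w m low_exp = (if 2 * l < f + r then 1 else 0)"
    "s * P < 2 ^ w \<Longrightarrow> eval_exp w m gain_exp = s * P"
    "v * n < 2 ^ w \<Longrightarrow> v * n * P < 2 ^ w \<Longrightarrow> eval_exp w m bar_exp = v * n * P"
    "n * Q < 2 ^ w \<Longrightarrow> Q < 2 ^ w \<Longrightarrow> eval_exp w m (grid_exp Q) = n * Q"
proof -
  have c: "m ! 6 = n" "m ! 7 = s" "m ! 8 = l" "m ! 9 = P" "m ! 11 = r" "m ! 12 = v" "m ! 13 = f" "\<And>i. i < 15 \<Longrightarrow> i < length m"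
    using assms(1) by (simp_all add: stored_def)
  note c [simp] = this mod_word_simps[OF assms(2)]
  show "eval_exp w m low_exp = (if 2 * l < f + r then 1 else 0)" if "2 * l < 2 ^ w" "f + r < 2 ^ w"
    using that by (simp add: low_exp_def)
  show "eval_exp w m gain_exp = s * P" if "s * P < 2 ^ w"
    using that by (simp add: gain_exp_def)
  show "eval_exp w m bar_exp = v * n * P" if "v * n < 2 ^ w" "v * n * P < 2 ^ w"
    using that by (simp add: bar_exp_def)
  show "eval_exp w m (grid_exp Q) = n * Q" if "n * Q < 2 ^ w" "Q < 2 ^ w"
    using that by (simp add: grid_exp_def)
qed

lemma exec_reject:
  assumes "stored m K a n s l P q r v f b" "16 \<le> w" "a + 1 < 2 ^ w" "r + 1 < 2 ^ w"
    and b: "2 * l < 2 ^ w" "f + r < 2 ^ w" "s * P < 2 ^ w" "v * n < 2 ^ w" "v * n * P < 2 ^ w" "n * Q < 2 ^ w" "Q < 2 ^ w"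
      "16 * (n * Q) < 2 ^ w" "s * P + 16 * (n * Q) < 2 ^ w"
  shows "\<exists>m'. exec w (reject_prog Q) m = Some m' \<and> length m' = length m \<and>
    stored m' K (if a + 1 < K then a + 1 else 0) 0 0 0 1 0 (if a + 1 < K then r else r + 1) v
      (if f + r \<le> 2 * l \<and> v * n * P \<le> s * P + 16 * (n * Q) then l else f) b"
proof -
  let ?f = "if f + r \<le> 2 * l \<and> v * n * P \<le> s * P + 16 * (n * Q) then l else f"
  note e = eval_exps[OF assms(1,2)]
  have "exec w (Cond low_exp Skip
        (Cond (Less (Add gain_exp (Mul (Imm 16) (grid_exp Q))) bar_exp) Skip (Store (Imm 13) (cell 8)))) m
     = Some (if f + r \<le> 2 * l \<and> v * n * P \<le> s * P + 16 * (n * Q) then m[13 := l] else m)"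
  proof -
    have 1: "eval_exp w m low_exp = (if 2 * l < f + r then 1 else 0)"
      "eval_exp w m gain_exp = s * P" "eval_exp w m bar_exp = v * n * P" "eval_exp w m (grid_exp Q) = n * Q"
      using e b by simp_all
    have 2: "eval_exp w m (Less (Add gain_exp (Mul (Imm 16) (grid_exp Q))) bar_exp)
        = (if s * P + 16 * (n * Q) < v * n * P then 1 else 0)"
      by (simp only: eval_exp.simps 1 mod_word_simps(16)[OF assms(2)] mod_less[OF b(8)] mod_less[OF b(9)])
    have 3: "exec w (Store (Imm 13) (cell 8)) m = Some (m[13 := l])"
      using assms(1) by (simp add: stored_def mod_word_simps[OF assms(2)])
    show ?thesis unfolding exec.simps(1,4) 1 2 3 by auto
  qed
  moreover define m1 where "m1 = (if f + r \<le> 2 * l \<and> v * n * P \<le> s * P + 16 * (n * Q) then m[13 := l] else m)"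
  ultimately have 0: "exec w (reject_prog Q) m = exec w next_prog m1" by (simp add: reject_prog_def)
  have "stored m1 K a n s l P q r v ?f b" "length m1 = length m"
    using assms(1) by (simp_all add: stored_def m1_def)
  with exec_next[of m1, OF _ assms(2-4)] show ?thesis unfolding 0 by force
qed

lemma eval_cell:
  assumes "15 \<le> length m" "16 \<le> w" "i < 15"
  shows "eval_exp w m (cell i) = m ! i"
  using assms mod_word[of w i] by simp

lemma eval_cells:
  assumes "stored m K a n s l P q r v f b" "16 \<le> w"
  shows "eval_exp w m (cell 3) = K" "eval_exp w m (cell 5) = a" "eval_exp w m (cell 6) = n" "eval_exp w m (cell 7) = s"
    "eval_exp w m (cell 8) = l" "eval_exp w m (cell 9) = P" "eval_exp w m (cell 10) = q" "eval_exp w m (cell 11) = r"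
    "eval_exp w m (cell 12) = v" "eval_exp w m (cell 13) = f" "eval_exp w m (cell 14) = b"
  using assms(1) eval_cell[OF _ assms(2), of m] unfolding stored_def by simp_all

lemma exec_store:
  assumes "16 \<le> w" "i < 15" "eval_exp w m e = x"
  shows "exec w (Store (Imm i) e) m = Some (m[i := x])"
  using assms mod_word[of w i] by simp

lemma exec_accept:
  assumes "stored m K a n s l P q r v f b" "16 \<le> w" "a + 1 < 2 ^ w" "r + 1 < 2 ^ w"
    and b: "s * P < 2 ^ w" "v + 1 < 2 ^ w" "(v + 1) * n < 2 ^ w" "(v + 1) * n * P < 2 ^ w" "n * Q < 2 ^ w" "Q < 2 ^ w"
      "(v + 1) * n * P + n * Q < 2 ^ w" "n * P < 2 ^ w"
  shows "\<exists>m'. exec w (accept_prog Q) m = Some m' \<and> length m' = length m \<and>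
    stored m' K (if a + 1 < K then a + 1 else 0) 0 0 0 1 0 (if a + 1 < K then r else r + 1)
      (if (v + 1) * n * P + n * Q \<le> s * P then (s * P - n * Q) div (n * P) else v) f
      (if (v + 1) * n * P + n * Q \<le> s * P then a else b)"
proof -
  let ?c = "(v + 1) * n * P + n * Q \<le> s * P"
  let ?m = "if ?c then m[12 := (s * P - n * Q) div (n * P), 14 := a] else m"
  note e = eval_exps[OF assms(1,2)]
  have sub: "(s * P + 2 ^ w - n * Q) mod 2 ^ w = s * P - n * Q" if ?c
  proof -
    have "n * Q \<le> s * P" using that by (rule add_leD2)
    then have "s * P + 2 ^ w - n * Q = (s * P - n * Q) + 2 ^ w" by (rule diff_add_assoc2[THEN trans[OF _ refl]])
    moreover have "s * P - n * Q < 2 ^ w" using b(1) by (rule less_imp_diff_less)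
    ultimately show ?thesis by (simp only: mod_add_self2 mod_less)
  qed
  note ev = eval_exp.simps(1,3-8) eval_cells[OF assms(1,2)] mod_word_simps(1-4)[OF assms(2)]
  have c0: "eval_exp w m (Add (Mul (Mul (Add (cell 12) (Imm 1)) (cell 6)) (cell 9)) (grid_exp Q)) = (v + 1) * n * P + n * Q"
    by (simp only: ev e(4)[OF b(5,6)] mod_less[OF b(2)] mod_less[OF b(3)] mod_less[OF b(4)] mod_less[OF b(7)])
  have c: "eval_exp w m (Less gain_exp (Add (Mul (Mul (Add (cell 12) (Imm 1)) (cell 6)) (cell 9)) (grid_exp Q)))
     = (if ?c then 0 else 1)"
    by (simp only: eval_exp.simps(8) c0 e(2)[OF b(1)] not_le[symmetric] if_not_P split: if_split) (auto simp: not_le)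
  have d: "eval_exp w m (Quot (Sub gain_exp (grid_exp Q)) (Mul (cell 6) (cell 9))) = (s * P - n * Q) div (n * P)" if ?c
    by (simp only: ev e(2)[OF b(1)] e(4)[OF b(5,6)] sub[OF that] mod_less[OF b(8)])
  have x: "exec w (Cond (Less gain_exp (Add (Mul (Mul (Add (cell 12) (Imm 1)) (cell 6)) (cell 9)) (grid_exp Q))) Skip
        (Seq (Store (Imm 12) (Quot (Sub gain_exp (grid_exp Q)) (Mul (cell 6) (cell 9))))
             (Store (Imm 14) (cell 5)))) m = Some ?m"
  proof (cases ?c)
    case True
    have s5: "eval_exp w (m[12 := (s * P - n * Q) div (n * P)]) (cell 5) = a"
      using assms(1) eval_cell[of "m[12 := (s * P - n * Q) div (n * P)]" w 5] assms(2) by (simp add: stored_def)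
    have e1: "exec w (Store (Imm 12) (Quot (Sub gain_exp (grid_exp Q)) (Mul (cell 6) (cell 9)))) m
        = Some (m[12 := (s * P - n * Q) div (n * P)])"
      by (rule exec_store[OF assms(2) _ d[OF True]]) simp
    have e2: "exec w (Store (Imm 14) (cell 5)) (m[12 := (s * P - n * Q) div (n * P)]) = Some ?m"
      using True by (subst exec_store[OF assms(2) _ s5]) auto
    show ?thesis
      by (simp only: exec.simps(3,4) c e1 e2 if_P[OF True] bind.bind_lunit simp_thms if_False)
  next
    case False
    then show ?thesis
      by (simp only: exec.simps(1,4) c if_False if_True one_neq_zero not_False_eq_True)
  qed
  define m1 where "m1 = ?m"
  have 0: "exec w (accept_prog Q) m = exec w next_prog m1"
    unfolding accept_prog_def exec.simps(3) x m1_def bind.bind_lunit by (rule refl)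
  define v1 where "v1 = (if ?c then (s * P - n * Q) div (n * P) else v)"
  define b1 where "b1 = (if ?c then a else b)"
  have "stored m1 K a n s l P q r v1 f b1" "length m1 = length m"
    using assms(1) by (simp_all add: stored_def m1_def v1_def b1_def)
  with exec_next[of m1, OF _ assms(2-4)] show ?thesis
    unfolding 0 v1_def[symmetric] b1_def[symmetric] by force
qed

lemma exec_root:
  assumes "stored m K a n s l P q r v f b" "16 \<le> w" "eval_exp w m h = x"
    and "(q + 1) * (q + 1) < 2 ^ w" "q = 0 \<Longrightarrow> \<not> x < q * q"
  shows "\<exists>m'. exec w (root_prog h) m = Some m' \<and> length m' = length m \<and>
    stored m' K a n s l P (if x < q * q then q - 1 else if x < (q + 1) * (q + 1) then q else q + 1) r v f b"
proof -
  have "q * q \<le> (q + 1) * (q + 1)" by (intro mult_mono) auto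
  then have q: "q * q < 2 ^ w" using assms(4) by (rule le_less_trans)
  have "q + 1 \<le> (q + 1) * (q + 1)" by simp
  then have q': "q + 1 < 2 ^ w" using assms(4) by (rule le_less_trans)
  note ev = eval_exp.simps(1,3-8) eval_cells[OF assms(1,2)] mod_word_simps(1-4)[OF assms(2)]
  have "(q + 2 ^ w - 1) mod 2 ^ w = q - 1" if "q \<noteq> 0"
  proof -
    have "q + 2 ^ w - 1 = (q - 1) + 2 ^ w" using that by simp
    moreover have "q - 1 < 2 ^ w" using q' by simp
    ultimately show ?thesis by (simp only: mod_add_self2 mod_less)
  qed
  then have 1: "eval_exp w m (Sub (cell 10) (Imm 1)) = q - 1" if "x < q * q"
    using that by (cases "q = 0") (simp_all only: ev, simp)
  have 2: "eval_exp w m (Add (cell 10) (Imm 1)) = q + 1"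
    by (simp only: ev mod_less[OF q'])
  have 3: "eval_exp w m (Less h (Mul (cell 10) (cell 10))) = (if x < q * q then 1 else 0)"
    by (simp only: ev assms(3) mod_less[OF q])
  have 4: "eval_exp w m (Less h (Mul (Add (cell 10) (Imm 1)) (Add (cell 10) (Imm 1)))) = (if x < (q + 1) * (q + 1) then 1 else 0)"
    by (simp only: ev assms(3) mod_less[OF q'] mod_less[OF assms(4)])
  let ?q = "if x < q * q then q - 1 else if x < (q + 1) * (q + 1) then q else q + 1"
  have "exec w (root_prog h) m = Some (if \<not> x < q * q \<and> x < (q + 1) * (q + 1) then m else m[10 := ?q])"
  proof -
    have e1: "exec w (Store (Imm 10) (Sub (cell 10) (Imm 1))) m = Some (m[10 := q - 1])" if "x < q * q"
      by (rule exec_store[OF assms(2) _ 1[OF that]]) simp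
    have e2: "exec w (Store (Imm 10) (Add (cell 10) (Imm 1))) m = Some (m[10 := q + 1])"
      by (rule exec_store[OF assms(2) _ 2]) simp
    show ?thesis unfolding root_prog_def exec.simps(1,4) 3 4 e2 using e1 by simp
  qed
  moreover have "stored (if \<not> x < q * q \<and> x < (q + 1) * (q + 1) then m else m[10 := ?q]) K a n s l P ?q r v f b"
    using assms(1) by (simp add: stored_def)
  ultimately show ?thesis by simp
qed

text \<open>The root differs from q by at most one, so comparing x with the squares of q and q + 1
  identifies it.\<close>

lemma floor_sqrt_step:
  assumes "x \<le> y + 1" "y \<le> x + 1"
  defines "q \<equiv> floor_sqrt y"
  shows "(if x < q * q then q - 1 else if x < (q + 1) * (q + 1) then q else q + 1) = floor_sqrt x"
proof -
  have b: "floor_sqrt x \<le> q + 1" "q \<le> floor_sqrt x + 1"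
    using floor_sqrt_lipschitz[of x y 1] floor_sqrt_lipschitz[of y x 1] assms by auto
  have 1: "q \<le> floor_sqrt x \<longleftrightarrow> q * q \<le> x" "q + 1 \<le> floor_sqrt x \<longleftrightarrow> (q + 1) * (q + 1) \<le> x"
    by (simp_all only: le_floor_sqrt_iff power2_eq_square)
  show ?thesis using b 1 by (auto simp: not_less)
qed

lemma exec_up:
  assumes "stored m K a n s l P (slack f l) r v f b" "16 \<le> w" "l + 1 < 2 ^ w" "2 * P < 2 ^ w"
    "(f + l + 2) * (f + l + 2) < 2 ^ w"
  shows "\<exists>m'. exec w up_prog m = Some m' \<and> length m' = length m \<and>
    stored m' K a n s (l + 1) (2 * P) (slack f (l + 1)) r v f b"
proof -
  let ?q = "slack f l"
  define m1 where "m1 = m[8 := l + 1, 9 := 2 * P]"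
  have s1: "stored m1 K a n s (l + 1) (2 * P) ?q r v f b"
    using assms(1) by (auto simp: stored_def m1_def)
  have q: "?q \<le> f + l" using slack_le_max[of f l] by auto
  then have "(?q + 1) * (?q + 1) \<le> (f + l + 2) * (f + l + 2)" by (intro mult_mono) auto
  then have qw: "(?q + 1) * (?q + 1) < 2 ^ w" using assms(5) by simp
  have "?q + 1 \<le> (?q + 1) * (?q + 1)" by simp
  then have q1: "?q + 1 < 2 ^ w" using qw by (rule le_less_trans)
  have "f \<le> (f + l + 2) * (f + l + 2)" by simp
  then have fw: "f < 2 ^ w" using assms(5) by (rule le_less_trans)
  let ?rest = "Cond (Less (cell 13) (cell 8))
        (Store (Imm 10) (Add (cell 10) (Imm 1)))
        (Cond (Less (cell 8) (Sub (cell 13) (cell 8)))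
           (root_prog (cell 8)) (root_prog (Sub (cell 13) (cell 8))))"
  have up: "exec w up_prog m = exec w ?rest m1"
  proof -
    have s0: "stored (m[8 := l + 1]) K a n s (l + 1) P ?q r v f b" using assms(1) by (simp add: stored_def)
    have 1: "eval_exp w m (Add (cell 8) (Imm 1)) = l + 1"
      by (simp only: eval_exp.simps(1,3) eval_cells[OF assms(1,2)] mod_word_simps[OF assms(2)] mod_less[OF assms(3)])
    have 2: "eval_exp w (m[8 := l + 1]) (Mul (Imm 2) (cell 9)) = 2 * P"
      by (simp only: eval_exp.simps(1,5) eval_cells[OF s0 assms(2)] mod_word_simps[OF assms(2)] mod_less[OF assms(4)])
    have e1: "exec w (Store (Imm 8) (Add (cell 8) (Imm 1))) m = Some (m[8 := l + 1])"
      by (rule exec_store[OF assms(2) _ 1]) simp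
    have e2: "exec w (Store (Imm 9) (Mul (Imm 2) (cell 9))) (m[8 := l + 1]) = Some m1"
      unfolding m1_def by (rule exec_store[OF assms(2) _ 2]) simp
    show ?thesis by (simp only: up_prog_def exec.simps(3) e1 e2 bind.bind_lunit)
  qed
  have "\<exists>m'. exec w ?rest m1 = Some m' \<and> length m' = length m1 \<and> stored m' K a n s (l + 1) (2 * P) (slack f (l + 1)) r v f b"
  proof (cases "f < l + 1")
    case True
    \<comment> \<open>Past the focus the slack is linear; for l = f it steps from
      \<open>floor_sqrt 0\<close>, which is 0, to 1.\<close>
    then have "slack f (l + 1) = ?q + 1" by (auto simp: slack_def)
    have 1: "eval_exp w m1 (Add (cell 10) (Imm 1)) = ?q + 1"
      by (simp only: eval_exp.simps(1,3) eval_cells[OF s1 assms(2)] mod_word_simps[OF assms(2)] mod_less[OF q1])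
    have 2: "eval_exp w m1 (Less (cell 13) (cell 8)) = 1"
      using True by (simp only: eval_exp.simps(8) eval_cells[OF s1 assms(2)] if_True)
    have st: "stored (m1[10 := ?q + 1]) K a n s (l + 1) (2 * P) (slack f (l + 1)) r v f b"
      using s1 \<open>slack f (l + 1) = ?q + 1\<close> by (simp add: stored_def)
    have e: "exec w (Store (Imm 10) (Add (cell 10) (Imm 1))) m1 = Some (m1[10 := ?q + 1])"
      by (rule exec_store[OF assms(2) _ 1]) simp
    have br: "exec w ?rest m1 = Some (m1[10 := ?q + 1])"
      by (simp only: exec.simps(4) 2 one_neq_zero not_False_eq_True if_True e)
    show ?thesis unfolding br using st by simp
  next
    case False
    have sub: "eval_exp w m1 (Sub (cell 13) (cell 8)) = f - (l + 1)"
    proof -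
      have "f + 2 ^ w - (l + 1) = (f - (l + 1)) + 2 ^ w" using False by simp
      moreover have "f - (l + 1) < 2 ^ w" using fw by (rule less_imp_diff_less)
      ultimately have "(f + 2 ^ w - (l + 1)) mod 2 ^ w = f - (l + 1)" by (simp only: mod_add_self2 mod_less)
      then show ?thesis by (simp only: eval_exp.simps(4) eval_cells[OF s1 assms(2)])
    qed
    note c8 = eval_cells(5,10)[OF s1 assms(2)]
    have c: "eval_exp w m1 (Less (cell 13) (cell 8)) = 0"
      "eval_exp w m1 (Less (cell 8) (Sub (cell 13) (cell 8))) = (if l + 1 < f - (l + 1) then 1 else 0)"
      using False by (simp_all only: eval_exp.simps(8) sub c8 if_False)
    let ?x = "min (l + 1) (f - (l + 1))"
    have root: "(if ?x < ?q * ?q then ?q - 1 else if ?x < (?q + 1) * (?q + 1) then ?q else ?q + 1) = slack f (l + 1)"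
    proof -
      have sl: "?q = floor_sqrt (min l (f - l))" "slack f (l + 1) = floor_sqrt ?x"
        using False by (simp_all add: slack_def)
      have "?x \<le> min l (f - l) + 1" "min l (f - l) \<le> ?x + 1" by (auto simp: min_def)
      then show ?thesis unfolding sl by (rule floor_sqrt_step)
    qed
    have q0: "?q = 0 \<Longrightarrow> \<not> ?x < ?q * ?q" by simp
    let ?h = "if l + 1 < f - (l + 1) then cell 8 else Sub (cell 13) (cell 8)"
    have h: "eval_exp w m1 ?h = ?x"
    proof (cases "l + 1 < f - (l + 1)")
      case True
      then have "?x = l + 1" by simp
      then show ?thesis by (simp only: True if_True c8)
    next
      case F: False
      then have "?x = f - (l + 1)" by simp
      then show ?thesis by (simp only: F if_False sub)
    qed
    have br: "exec w ?rest m1 = exec w (root_prog ?h) m1"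
      unfolding exec.simps(4) c
      by (cases "l + 1 < f - (l + 1)") (simp_all only: if_True if_False simp_thms one_neq_zero)
    show ?thesis unfolding br using exec_root[OF s1 assms(2) h qw q0] unfolding root .
  qed
  moreover have "length m1 = length m" by (simp add: m1_def)
  ultimately show ?thesis unfolding up by (simp only:)
qed

section \<open>One run of the program simulates one step of the player\<close>

lemma sub_word: "b \<le> a \<Longrightarrow> a < W \<Longrightarrow> (a + W - b) mod W = a - (b::nat)"
proof -
  assume a: "b \<le> a" "a < W"
  then have "a + W - b = (a - b) + W" by simp
  moreover have "a - b < W" using a by simp
  ultimately show ?thesis by (simp only: mod_add_self2 mod_less)
qed

text \<open>Branches test for a nonzero word, so \<open>Sub\<close> serves as the test whether the
  quota has been missed.\<close>

lemma sub_word_eq_0: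
  assumes "a < W" "b < W"
  shows "(a + W - b) mod W = (0::nat) \<longleftrightarrow> a = b"
proof (cases "b \<le> a")
  case True
  then show ?thesis using sub_word[OF True assms(1)] by auto
next
  case False
  then have "a + W - b < W" "0 < a + W - b" using assms by auto
  then show ?thesis using False by (simp only: mod_less) auto
qed

definition loaded :: "mem \<Rightarrow> nat \<Rightarrow> player \<Rightarrow> bool" where
  "loaded m K \<sigma> \<longleftrightarrow> stored m K (arm \<sigma>) (pulls \<sigma>) (gain \<sigma>) (level \<sigma>) (2 ^ level \<sigma>) (slack (focus \<sigma>) (level \<sigma>))
     (stage \<sigma>) (bar \<sigma>) (focus \<sigma>) (champ \<sigma>)"

lemma next_arm_loaded:
  assumes "stored m K (if arm \<sigma> + 1 < K then arm \<sigma> + 1 else 0) 0 0 0 1 0 (if arm \<sigma> + 1 < K then stage \<sigma> else stage \<sigma> + 1)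
    (bar \<sigma>) (focus \<sigma>) (champ \<sigma>)"
  shows "loaded m K (next_arm K \<sigma>)"
  using assms by (auto simp: loaded_def next_arm_def slack_def)

text \<open>With x = 4^R, each of n, 2^l and R + 1 is at most x and the grid is 64 x. Every value
  listed is therefore at most a moderate multiple of x^3, below 65536 x^3, and does not wrap
  around.\<close>

lemma word_bounds:
  fixes n s l r f v R w :: nat
  assumes W: "65536 * (4 ^ R) ^ 3 \<le> (2::nat) ^ w"
    and n: "n \<le> 4 ^ R" and s: "s \<le> n * grid R" and l: "l < R" and f: "f \<le> R" "r \<le> R" and v: "v \<le> grid R"
  shows "16 \<le> w"
    "2 * l < 2 ^ w" "f + r < 2 ^ w" "r + 1 < 2 ^ w" "l + 1 < 2 ^ w" "2 * 2 ^ l < (2::nat) ^ w"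
    "s * 2 ^ l < 2 ^ w" "v * n < 2 ^ w" "v * n * 2 ^ l < 2 ^ w" "n * grid R < 2 ^ w" "grid R < 2 ^ w"
    "2 * (n * grid R) < 2 ^ w" "s * 2 ^ l + 2 * (n * grid R) < 2 ^ w"
    "16 * (n * grid R) < 2 ^ w" "s * 2 ^ l + 16 * (n * grid R) < 2 ^ w"
    "v + 1 < 2 ^ w" "(v + 1) * n < 2 ^ w" "(v + 1) * n * 2 ^ l < 2 ^ w"
    "(v + 1) * n * 2 ^ l + n * grid R < 2 ^ w" "n * 2 ^ l < 2 ^ w"
    "(f + l + 2) * (f + l + 2) < 2 ^ w" "s < 2 ^ w" "n < 2 ^ w"
    "2 ^ l * 2 ^ l * (256 * (R + 1)) < (2::nat) ^ w" "2 ^ l * 2 ^ l * (16 * (1 + (f + l))) < (2::nat) ^ w"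
    "2 ^ l * 2 ^ l < (2::nat) ^ w" "256 * (R + 1) < 2 ^ w" "16 * (1 + (f + l)) < 2 ^ w"
    "f < 2 ^ w" "r < 2 ^ w" "R < 2 ^ w"
proof -
  define x :: nat where "x = 4 ^ R"
  define p :: nat where "p = 2 ^ l"
  define W :: nat where "W = 2 ^ w"
  have x1: "1 \<le> x" by (simp add: x_def)
  have x2: "x \<le> x * x" "x * x \<le> x * x * x" using x1 by simp_all
  have WW: "65536 * (x * x * x) \<le> W" using assms(1) by (simp add: x_def W_def power3_eq_cube)
  have Rx: "R + 1 \<le> x"
  proof -
    have "R < 2 ^ R" by (rule less_exp)
    also have "(2::nat) ^ R \<le> x" unfolding x_def by (rule power_mono) auto
    finally show ?thesis by simp
  qed
  have px: "p \<le> x"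
  proof -
    have "p \<le> 2 ^ R" unfolding p_def using l by (intro power_increasing) auto
    also have "(2::nat) ^ R \<le> x" unfolding x_def by (rule power_mono) auto
    finally show ?thesis .
  qed
  have g: "grid R = 64 * x" by (simp add: grid_def x_def)
  have nx: "n \<le> x" using n by (simp add: x_def)
  have nQ: "n * grid R \<le> 64 * (x * x)" using mult_le_mono1[OF nx, of "64 * x"] by (simp add: g)
  have s': "s \<le> 64 * (x * x)" using s nQ by (rule order_trans)
  have sp: "s * p \<le> 64 * (x * x * x)" using mult_le_mono[OF s' px] by simp
  have v1: "v + 1 \<le> 65 * x" using v x1 by (simp add: g)
  have vn: "(v + 1) * n \<le> 65 * (x * x)" using mult_le_mono[OF v1 nx] by simp
  have vnp: "(v + 1) * n * p \<le> 65 * (x * x * x)" using mult_le_mono[OF vn px] by simp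
  have vn': "v * n \<le> (v + 1) * n" "v * n * p \<le> (v + 1) * n * p" by simp_all
  have np: "n * p \<le> x * x" using mult_le_mono[OF nx px] .
  have pp: "p * p \<le> x * x" using mult_le_mono[OF px px] .
  have fl: "f + l + 2 \<le> 2 * x" using Rx f l by simp
  have fl2: "(f + l + 2) * (f + l + 2) \<le> 4 * (x * x)" using mult_le_mono[OF fl fl] by simp
  have B: "256 * (R + 1) \<le> 256 * x" using Rx by simp
  have ppB: "p * p * (256 * (R + 1)) \<le> 256 * (x * x * x)" using mult_le_mono[OF pp B] by simp
  have C: "16 * (1 + (f + l)) \<le> 32 * x" using fl by simp
  have ppC: "p * p * (16 * (1 + (f + l))) \<le> 32 * (x * x * x)" using mult_le_mono[OF pp C] by simp
  note all = x1 x2 WW Rx px nx nQ s' sp v1 vn vnp vn' np pp fl fl2 B ppB C ppC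
  have "65536 \<le> W" using x1 x2 WW by linarith
  moreover have "(2::nat) ^ 16 = 65536" by simp
  ultimately have "(2::nat) ^ 16 \<le> 2 ^ w" by (simp only: W_def)
  then show "16 \<le> w" by (simp only: power_increasing_iff[of "2::nat"])
  show "2 * l < 2 ^ w" "f + r < 2 ^ w" "r + 1 < 2 ^ w" "l + 1 < 2 ^ w" "2 * 2 ^ l < (2::nat) ^ w"
    unfolding W_def[symmetric] p_def[symmetric] using all l f by linarith+
  show "s * 2 ^ l < 2 ^ w" "v * n < 2 ^ w" "v * n * 2 ^ l < 2 ^ w" "n * grid R < 2 ^ w" "grid R < 2 ^ w"
    unfolding W_def[symmetric] p_def[symmetric] using all g by linarith+
  show "2 * (n * grid R) < 2 ^ w" "s * 2 ^ l + 2 * (n * grid R) < 2 ^ w"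
    "16 * (n * grid R) < 2 ^ w" "s * 2 ^ l + 16 * (n * grid R) < 2 ^ w"
    unfolding W_def[symmetric] p_def[symmetric] using all by linarith+
  show "v + 1 < 2 ^ w" "(v + 1) * n < 2 ^ w" "(v + 1) * n * 2 ^ l < 2 ^ w"
    "(v + 1) * n * 2 ^ l + n * grid R < 2 ^ w" "n * 2 ^ l < 2 ^ w"
    unfolding W_def[symmetric] p_def[symmetric] using all by linarith+
  show "(f + l + 2) * (f + l + 2) < 2 ^ w" "s < 2 ^ w" "n < 2 ^ w"
    "2 ^ l * 2 ^ l * (256 * (R + 1)) < (2::nat) ^ w" "2 ^ l * 2 ^ l * (16 * (1 + (f + l))) < (2::nat) ^ w"
    "2 ^ l * 2 ^ l < (2::nat) ^ w" "256 * (R + 1) < 2 ^ w" "16 * (1 + (f + l)) < 2 ^ w"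
    "f < 2 ^ w" "r < 2 ^ w" "R < 2 ^ w"
    unfolding W_def[symmetric] p_def[symmetric] using all f by linarith+
qed

lemma eval_quota:
  assumes "stored m K a n s l (2 ^ l) (slack f l) r v f b"
    and b: "16 \<le> w" "2 * l < 2 ^ w" "f + r < 2 ^ w"
      "2 ^ l * 2 ^ l * (256 * (R + 1)) < (2::nat) ^ w" "2 ^ l * 2 ^ l * (16 * (1 + (f + l))) < (2::nat) ^ w"
      "2 ^ l * 2 ^ l < (2::nat) ^ w" "256 * (R + 1) < 2 ^ w" "16 * (1 + (f + l)) < 2 ^ w"
  shows "eval_exp w m (quota_exp (256 * (R + 1))) = quota R f r l"
proof -
  let ?q = "slack f l"
  note e = eval_exps(1)[OF assms(1,2,3,4)]
  have q: "?q \<le> f + l" using slack_le_max[of f l] by auto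
  have c1: "16 * (1 + ?q) < 2 ^ w" using q b(8) by simp
  have "2 ^ l * 2 ^ l * (16 * (1 + ?q)) \<le> (2::nat) ^ l * 2 ^ l * (16 * (1 + (f + l)))" using q by (intro mult_left_mono) auto
  then have c2: "2 ^ l * 2 ^ l * (16 * (1 + ?q)) < (2::nat) ^ w" using b(5) by (rule le_less_trans)
  have c3: "1 + ?q < 2 ^ w" using c1 by simp
  have w1: "(1::nat) < 2 ^ w" using b(1) by (intro one_less_power) auto
  have p4: "(2::nat) ^ l * 2 ^ l = 4 ^ l" by (simp flip: power_mult_distrib)
  have m1: "eval_exp w m (Sub (Imm 1) low_exp) = (if 2 * l < f + r then 0 else 1)"
    using sub_word[of 1 1 "2 ^ w"] sub_word[of 0 1 "2 ^ w"] w1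
    by (simp only: eval_exp.simps(1,4) e mod_word_simps[OF b(1)]) simp
  have ev16: "eval_exp w m (Mul (Imm 16) (Add (Imm 1) (cell 10))) = 16 * (1 + ?q)"
    by (simp only: eval_exp.simps(1,3,5) eval_cells[OF assms(1) b(1)] mod_word_simps[OF b(1)] mod_less[OF c3] mod_less[OF c1])
  have P: "eval_exp w m (Mul (cell 9) (cell 9)) = 2 ^ l * 2 ^ l"
    by (simp only: eval_exp.simps(5) eval_cells[OF assms(1) b(1)] mod_less[OF b(6)])
  have B: "eval_exp w m (Imm (256 * (R + 1))) = 256 * (R + 1)" by (simp only: eval_exp.simps(1) mod_less[OF b(7)])
  show ?thesis
  proof (cases "2 * l < f + r")
    case True
    have "eval_exp w m (quota_exp (256 * (R + 1))) = 2 ^ l * 2 ^ l * (16 * (1 + ?q))"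
      unfolding quota_exp_def eval_exp.simps(5)[of w m "Mul (cell 9) (cell 9)"] P eval_exp.simps(3)[of w m "Mul low_exp _"]
        eval_exp.simps(5)[of w m low_exp] eval_exp.simps(5)[of w m "Sub (Imm 1) low_exp"] m1 e ev16 B if_P[OF True]
        mult_1_left mult_zero_left add_0_right mod_0 mod_less[OF c1] mod_less[OF c2] by (rule refl)
    then show ?thesis using True by (simp add: quota_def p4)
  next
    case False
    have "eval_exp w m (quota_exp (256 * (R + 1))) = 2 ^ l * 2 ^ l * (256 * (R + 1))"
      unfolding quota_exp_def eval_exp.simps(5)[of w m "Mul (cell 9) (cell 9)"] P eval_exp.simps(3)[of w m "Mul low_exp _"]
        eval_exp.simps(5)[of w m low_exp] eval_exp.simps(5)[of w m "Sub (Imm 1) low_exp"] m1 e ev16 B if_not_P[OF False]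
        mult_1_left mult_zero_left add_0_left mod_0 mod_less[OF b(7)] mod_less[OF b(4)] by (rule refl)
    then show ?thesis using False by (simp add: quota_def p4)
  qed
qed

lemma exec_step:
  assumes L: "loaded m K \<sigma>" and W: "65536 * (4 ^ R) ^ 3 \<le> (2::nat) ^ w"
    and st: "stage \<sigma> < R" "focus \<sigma> \<le> stage \<sigma>" "level \<sigma> \<le> stage \<sigma>"
    and n: "pulls \<sigma> + 1 \<le> 4 ^ R" and s: "gain \<sigma> \<le> pulls \<sigma> * grid R" and v: "bar \<sigma> \<le> grid R"
    and a: "arm \<sigma> + 1 < 2 ^ w"
    and z: "z = m ! 1 div ((2 ^ w - 1) div grid R)" "z \<le> grid R"
  shows "\<exists>m'. exec w (step_prog (grid R) (256 * (R + 1))) m = Some m' \<and> length m' = length m \<and>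
     loaded m' K (play_step K R \<sigma> z)"
proof -
  define a0 n0 s0 l r v0 f b where "a0 = arm \<sigma>" and "n0 = pulls \<sigma> + 1" and "s0 = gain \<sigma> + z" and "l = level \<sigma>"
    and "r = stage \<sigma>" and "v0 = bar \<sigma>" and "f = focus \<sigma>" and "b = champ \<sigma>"
  note defs = a0_def n0_def s0_def l_def r_def v0_def f_def b_def
  let ?Q = "grid R"
  have s0: "s0 \<le> n0 * ?Q" using s z(2) by (simp add: s0_def n0_def)
  note B = word_bounds[OF W n[folded n0_def] s0, of l f r v0]
  have pre: "l < R" "f \<le> R" "r \<le> R" "v0 \<le> ?Q" using st v by (simp_all add: defs)
  note B = B[OF pre]
  note w = B(1)
  have L0: "stored m K a0 (pulls \<sigma>) (gain \<sigma>) l (2 ^ l) (slack f l) r v0 f b"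
    using L by (simp add: loaded_def defs)
  have len: "15 \<le> length m" using L0 by (simp add: stored_def)
  have w1: "(1::nat) < 2 ^ w" using w by (intro one_less_power) auto
  have c15: "(1::nat) < 15" by simp
  have "eval_exp w m (Sub (Imm 0) (Imm 1)) = 2 ^ w - 1"
    unfolding eval_exp.simps(1,4) mod_word_simps[OF w] add_0_left using w1 by (intro mod_less) linarith
  then have Z: "eval_exp w m (reward_exp ?Q) = z"
    unfolding reward_exp_def z(1) eval_exp.simps(6) eval_cell[OF len w c15]
    by (simp only: eval_exp.simps(1) mod_less[OF B(11)])
  have e1: "eval_exp w m (Add (cell 7) (reward_exp ?Q)) = s0"
    unfolding eval_exp.simps(3) Z eval_cells[OF L0 w] s0_def[symmetric] by (rule mod_less[OF B(22)])
  define m1 where "m1 = m[7 := s0]"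
  have L1: "stored m1 K a0 (pulls \<sigma>) s0 l (2 ^ l) (slack f l) r v0 f b"
    using L0 by (simp add: stored_def m1_def)
  have x1: "exec w (Store (Imm 7) (Add (cell 7) (reward_exp ?Q))) m = Some m1"
    unfolding m1_def by (rule exec_store[OF w _ e1]) simp
  have e2: "eval_exp w m1 (Add (cell 6) (Imm 1)) = n0"
    unfolding eval_exp.simps(1,3) eval_cells[OF L1 w] mod_word_simps[OF w] n0_def[symmetric] by (rule mod_less[OF B(23)])
  define m2 where "m2 = m1[6 := n0]"
  have L2: "stored m2 K a0 n0 s0 l (2 ^ l) (slack f l) r v0 f b"
    using L1 by (simp add: stored_def m2_def)
  have x2: "exec w (Store (Imm 6) (Add (cell 6) (Imm 1))) m1 = Some m2"
    unfolding m2_def by (rule exec_store[OF w _ e2]) simp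
  have len2: "length m2 = length m" by (simp add: m1_def m2_def)
  have exec: "exec w (step_prog ?Q (256 * (R + 1))) m =
     (if n0 \<noteq> quota R f r l then Some m2 else exec w (check_prog ?Q) m2)"
  proof -
    have q: "eval_exp w m2 (quota_exp (256 * (R + 1))) = quota R f r l"
      by (rule eval_quota[OF L2 w B(2,3,24-28)])
    have "quota R f r l < 2 ^ w"
    proof -
      have "eval_exp w m2 (quota_exp (256 * (R + 1))) < 2 ^ w" unfolding quota_exp_def eval_exp.simps(5) by (rule mod_less_divisor) simp
      then show ?thesis by (simp only: q)
    qed
    then have "eval_exp w m2 (Sub (cell 6) (quota_exp (256 * (R + 1)))) = 0 \<longleftrightarrow> n0 = quota R f r l"
      unfolding eval_exp.simps(4) q eval_cells[OF L2 w] by (rule sub_word_eq_0[OF B(23)])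
    then show ?thesis
      unfolding step_prog_def exec.simps(1,3,4) x1 x2 bind.bind_lunit by (simp only: if_True if_False simp_thms)
  qed
  have play: "play_step K R \<sigma> z = (if n0 \<noteq> quota R f r l then \<sigma>\<lparr>pulls := n0, gain := s0\<rparr>
        else if fails R v0 n0 s0 l then
          next_arm K (\<sigma>\<lparr>focus := if f + r \<le> 2 * l \<and> v0 * n0 * 2 ^ l \<le> s0 * 2 ^ l + 16 * n0 * grid R then l else f\<rparr>)
        else if l < r then \<sigma>\<lparr>pulls := n0, gain := s0, level := l + 1\<rparr>
        else next_arm K
          (if (v0 + 1) * n0 * 2 ^ l + n0 * grid R \<le> s0 * 2 ^ l
           then \<sigma>\<lparr>bar := (s0 * 2 ^ l - n0 * grid R) div (n0 * 2 ^ l), champ := a0\<rparr>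
           else \<sigma>))"
    using st(1) unfolding play_step_def Let_def defs by (simp only: if_False not_le[symmetric] not_True_eq_False)
  have fl: "eval_exp w m2 (Less (Add gain_exp (Mul (Imm 2) (grid_exp ?Q))) bar_exp) = (if fails R v0 n0 s0 l then 1 else 0)"
    unfolding eval_exp.simps(1,3,5,8) eval_exps(2)[OF L2 w B(7)] eval_exps(3)[OF L2 w B(8,9)] eval_exps(4)[OF L2 w B(10,11)]
      mod_word_simps[OF w] mod_less[OF B(12)] mod_less[OF B(13)] fails_def mult.assoc[of 2] by (rule refl)
  have lr: "eval_exp w m2 (Less (cell 8) (cell 11)) = (if l < r then 1 else 0)"
    unfolding eval_exp.simps(8) eval_cells[OF L2 w] by (rule refl)
  have check: "exec w (check_prog ?Q) m2 = (if fails R v0 n0 s0 l then exec w (reject_prog ?Q) m2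
     else if l < r then exec w up_prog m2 else exec w (accept_prog ?Q) m2)"
    unfolding check_prog_def exec.simps(4) fl lr by (simp only: if_True if_False simp_thms one_neq_zero split: if_split) simp
  have a0: "a0 + 1 < 2 ^ w" using a by (simp add: a0_def)
  consider (go) "n0 \<noteq> quota R f r l" | (rej) "n0 = quota R f r l" "fails R v0 n0 s0 l"
    | (up) "n0 = quota R f r l" "\<not> fails R v0 n0 s0 l" "l < r"
    | (acc) "n0 = quota R f r l" "\<not> fails R v0 n0 s0 l" "\<not> l < r" by blast
  then show ?thesis
  proof cases
    case go
    have "loaded m2 K (\<sigma>\<lparr>pulls := n0, gain := s0\<rparr>)" using L2 by (simp add: loaded_def defs)
    then show ?thesis unfolding exec play if_P[OF go] using len2 by simp
  next
    case rej
    let ?\<sigma> = "\<sigma>\<lparr>focus := if f + r \<le> 2 * l \<and> v0 * n0 * 2 ^ l \<le> s0 * 2 ^ l + 16 * n0 * grid R then l else f\<rparr>"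
    obtain m' where m': "exec w (reject_prog ?Q) m2 = Some m'" "length m' = length m2"
      "stored m' K (if a0 + 1 < K then a0 + 1 else 0) 0 0 0 1 0 (if a0 + 1 < K then r else r + 1) v0
        (if f + r \<le> 2 * l \<and> v0 * n0 * 2 ^ l \<le> s0 * 2 ^ l + 16 * (n0 * ?Q) then l else f) b"
      using exec_reject[OF L2 w a0 B(4) B(2,3,7-11,14,15)] by blast
    have sel: "arm ?\<sigma> = a0" "stage ?\<sigma> = r" "bar ?\<sigma> = v0" "champ ?\<sigma> = b"
      "focus ?\<sigma> = (if f + r \<le> 2 * l \<and> v0 * n0 * 2 ^ l \<le> s0 * 2 ^ l + 16 * (n0 * ?Q) then l else f)"
      by (simp_all add: a0_def r_def v0_def b_def mult.assoc)
    have "loaded m' K (next_arm K ?\<sigma>)"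
      by (rule next_arm_loaded) (simp only: sel m'(3))
    with m' have "\<exists>m'. exec w (reject_prog ?Q) m2 = Some m' \<and> length m' = length m2 \<and> loaded m' K (next_arm K ?\<sigma>)"
      by blast
    then show ?thesis unfolding exec play check using rej len2 by simp
  next
    case up
    let ?\<sigma> = "\<sigma>\<lparr>pulls := n0, gain := s0, level := l + 1\<rparr>"
    have "\<exists>m'. exec w up_prog m2 = Some m' \<and> length m' = length m2 \<and> loaded m' K ?\<sigma>"
      using exec_up[OF L2 w B(5,6,21)] by (simp add: loaded_def defs)
    then show ?thesis unfolding exec play check using up len2 by simp
  next
    case acc
    let ?\<sigma> = "if (v0 + 1) * n0 * 2 ^ l + n0 * grid R \<le> s0 * 2 ^ l
           then \<sigma>\<lparr>bar := (s0 * 2 ^ l - n0 * grid R) div (n0 * 2 ^ l), champ := a0\<rparr>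
           else \<sigma>"
    let ?c = "(v0 + 1) * n0 * 2 ^ l + n0 * ?Q \<le> s0 * 2 ^ l"
    obtain m' where m': "exec w (accept_prog ?Q) m2 = Some m'" "length m' = length m2"
      "stored m' K (if a0 + 1 < K then a0 + 1 else 0) 0 0 0 1 0 (if a0 + 1 < K then r else r + 1)
        (if ?c then (s0 * 2 ^ l - n0 * ?Q) div (n0 * 2 ^ l) else v0) f (if ?c then a0 else b)"
      using exec_accept[OF L2 w a0 B(4) B(7,16-18,10,11,19,20)] by blast
    have sel: "arm ?\<sigma> = a0" "stage ?\<sigma> = r" "bar ?\<sigma> = (if ?c then (s0 * 2 ^ l - n0 * ?Q) div (n0 * 2 ^ l) else v0)"
      "champ ?\<sigma> = (if ?c then a0 else b)" "focus ?\<sigma> = f"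
      by (simp_all add: a0_def r_def v0_def b_def f_def)
    have "loaded m' K (next_arm K ?\<sigma>)"
      by (rule next_arm_loaded) (simp only: sel m'(3))
    with m' have "\<exists>m'. exec w (accept_prog ?Q) m2 = Some m' \<and> length m' = length m2 \<and> loaded m' K (next_arm K ?\<sigma>)"
      by blast
    then show ?thesis unfolding exec play check using acc len2 by simp
  qed
qed

lemma stored_update_io: "i < 3 \<Longrightarrow> stored (m[i := x]) K a n s l P q r v f b = stored m K a n s l P q r v f b"
  by (auto simp: stored_def)

lemma loaded_update_io: "i < 3 \<Longrightarrow> loaded (m[i := x]) K \<sigma> = loaded m K \<sigma>"
  by (simp add: loaded_def stored_update_io)

lemma exec_output:
  assumes L: "loaded m K \<sigma>" and w: "16 \<le> w" "R < 2 ^ w"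
  shows "exec w (Cond (Less (cell 11) (Imm R)) (Store (Imm 0) (cell 5)) (Store (Imm 0) (cell 14))) m
    = Some (m[0 := pull R \<sigma>])"
proof -
  note ev = eval_cells[OF L[unfolded loaded_def] w(1)]
  have c: "eval_exp w m (Less (cell 11) (Imm R)) = (if stage \<sigma> < R then 1 else 0)"
    unfolding eval_exp.simps(1,8) ev mod_less[OF w(2)] by (rule refl)
  have x: "exec w (Store (Imm 0) (cell 5)) m = Some (m[0 := arm \<sigma>])"
    "exec w (Store (Imm 0) (cell 14)) m = Some (m[0 := champ \<sigma>])"
    by (rule exec_store[OF w(1)]; simp only: ev; simp)+
  show ?thesis unfolding exec.simps(4) c x pull_def by simp
qed

lemma exec_player_init:
  assumes m: "stored m K 0 0 0 0 0 0 0 0 0 0" and w: "16 \<le> w" "R < 2 ^ w"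
  shows "\<exists>m'. exec w (player_prog R) m = Some m' \<and> length m' = length m \<and> loaded m' K start \<and> m' ! 0 = pull R start"
proof -
  have L: "loaded (m[9 := 1]) K start"
    using m by (simp add: loaded_def stored_def start_def slack_def)
  have z: "eval_exp w m (cell 9) = 0" using eval_cells(6)[OF m w(1)] .
  have x: "exec w (Store (Imm 9) (Imm 1)) m = Some (m[9 := 1])"
  proof (rule exec_store[OF w(1)])
    show "eval_exp w m (Imm 1) = 1" by (simp only: eval_exp.simps(1) mod_word_simps[OF w(1)])
  qed simp
  have "exec w (player_prog R) m = Some (m[9 := 1, 0 := pull R start])"
    unfolding player_prog_def exec.simps(3) exec.simps(4)[of w "cell 9"] z x simp_thms if_False bind.bind_lunit
    by (rule exec_output[OF L w])
  moreover have "15 \<le> length m" using m by (simp add: stored_def)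
  then have "0 < length m" by linarith
  ultimately show ?thesis using L by (simp add: loaded_update_io)
qed

lemma word_room:
  assumes W: "65536 * (4 ^ R) ^ 3 \<le> (2::nat) ^ w"
  shows "16 \<le> w" "R < 2 ^ w"
proof -
  have "(2::nat) ^ 16 \<le> 65536 * (4 ^ R) ^ 3" by simp
  then have "(2::nat) ^ 16 \<le> 2 ^ w" using W by (rule order_trans)
  then show "16 \<le> w" by (simp only: power_increasing_iff[of "2::nat"])
  have "R < 2 ^ R" by (rule less_exp)
  also have "(2::nat) ^ R \<le> 4 ^ R" by (rule power_mono) auto
  also have "(4::nat) ^ R \<le> (4 ^ R) ^ 3" by (rule self_le_power) auto
  also have "\<dots> \<le> 65536 * (4 ^ R) ^ 3" by simp
  also have "\<dots> \<le> 2 ^ w" by (rule W)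
  finally show "R < 2 ^ w" .
qed

lemma exec_player:
  assumes L: "loaded m K \<sigma>" and W: "65536 * (4 ^ R) ^ 3 \<le> (2::nat) ^ w"
    and st: "focus \<sigma> \<le> stage \<sigma>" "level \<sigma> \<le> stage \<sigma>"
    and n: "pulls \<sigma> + 1 \<le> 4 ^ R" and s: "gain \<sigma> \<le> pulls \<sigma> * grid R" and v: "bar \<sigma> \<le> grid R"
    and a: "arm \<sigma> + 1 < 2 ^ w"
    and z: "z = m ! 1 div ((2 ^ w - 1) div grid R)" "z \<le> grid R"
  shows "\<exists>m'. exec w (player_prog R) m = Some m' \<and> length m' = length m \<and>
     loaded m' K (play_step K R \<sigma> z) \<and> m' ! 0 = pull R (play_step K R \<sigma> z)"
proof -
  note w = word_room[OF W]
  note ev = eval_cells[OF L[unfolded loaded_def] w(1)]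
  have c: "eval_exp w m (Less (cell 11) (Imm R)) = (if stage \<sigma> < R then 1 else 0)"
    unfolding eval_exp.simps(1,8) ev mod_less[OF w(2)] by (rule refl)
  have nz: "eval_exp w m (cell 9) \<noteq> 0" unfolding ev by simp
  let ?\<sigma>' = "play_step K R \<sigma> z"
  obtain m1 where m1: "(if stage \<sigma> < R then exec w (step_prog (grid R) (256 * (R + 1))) m else Some m) = Some m1"
    "length m1 = length m" "loaded m1 K ?\<sigma>'"
  proof (cases "stage \<sigma> < R")
    case True
    from exec_step[OF L W True st n s v a z] that show ?thesis unfolding if_P[OF True] by blast
  next
    case False
    then have "?\<sigma>' = \<sigma>" by (simp add: play_step_def)
    with L that[of m] False show ?thesis by simp
  qed
  have "exec w (player_prog R) m = Option.bind (if stage \<sigma> < R then exec w (step_prog (grid R) (256 * (R + 1))) m else Some m)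
     (exec w (Cond (Less (cell 11) (Imm R)) (Store (Imm 0) (cell 5)) (Store (Imm 0) (cell 14))))"
    unfolding player_prog_def exec.simps(3) exec.simps(4)[of w "cell 9"] if_P[OF nz]
      exec.simps(4)[of w "Less (cell 11) (Imm R)" "step_prog (grid R) (256 * (R + 1))"] exec.simps(1) c
    by (cases "stage \<sigma> < R") (simp_all only: if_True if_False simp_thms one_neq_zero)
  also have "\<dots> = Some (m1[0 := pull R ?\<sigma>'])"
    unfolding m1(1) bind.bind_lunit by (rule exec_output[OF m1(3) w])
  finally have "exec w (player_prog R) m = Some (m1[0 := pull R ?\<sigma>'])" .
  moreover have "15 \<le> length m1" using m1(3) by (simp add: loaded_def stored_def)
  then have "0 < length m1" by linarith
  ultimately show ?thesis using m1 by (simp add: loaded_update_io)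
qed

section \<open>Quantized rewards and whole runs of the program\<close>

definition quantized :: "nat \<Rightarrow> nat \<Rightarrow> real \<Rightarrow> nat" where
  "quantized w R x = reward_word w x div ((2 ^ w - 1) div grid R)"

definition table :: "nat \<Rightarrow> nat \<Rightarrow> (nat \<times> nat \<Rightarrow> real) \<Rightarrow> nat \<times> nat \<Rightarrow> nat" where
  "table w R x = (\<lambda>p. quantized w R (x p))"

text \<open>A bucket is at least \<open>grid R\<close> words wide, so the remainder left by the
  division of 2^w - 1 is smaller than one bucket.\<close>

lemma grid_word:
  assumes "65536 * (4 ^ R) ^ 3 \<le> (2::nat) ^ w"
  shows "grid R \<le> (2 ^ w - 1) div grid R" "(2 ^ w - 1) div grid R > 0" "(2::nat) ^ w - 1 > 0"
proof -
  have x: "1 \<le> (4::nat) ^ R" by simp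
  have "grid R * grid R + 1 \<le> 4097 * (4 ^ R * 4 ^ R)" using x by (simp add: grid_def)
  also have "\<dots> \<le> 65536 * (4 ^ R * 4 ^ R * 4 ^ R)" by (intro mult_le_mono) auto
  also have "\<dots> = 65536 * (4 ^ R) ^ 3" by (simp add: power3_eq_cube)
  finally have 1: "grid R * grid R + 1 \<le> 2 ^ w" using assms by linarith
  have g: "grid R > 0" by (simp add: grid_def)
  have "grid R * grid R \<le> 2 ^ w - 1" using 1 by simp
  then show a: "grid R \<le> (2 ^ w - 1) div grid R" using g by (simp add: less_eq_div_iff_mult_less_eq)
  then show "(2 ^ w - 1) div grid R > 0" using g by simp
  have "0 < grid R * grid R" using g by simp
  with 1 show "(2::nat) ^ w - 1 > 0" by linarith
qed

text \<open>The remainder fills less than one further bucket. All real x are covered, thanks to the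
  reduction modulo 2^w in \<open>reward_word\<close>, because legality quantifies over all sample
  points.\<close>

lemma quantized_le:
  assumes "65536 * (4 ^ R) ^ 3 \<le> (2::nat) ^ w"
  shows "quantized w R x \<le> grid R"
proof -
  define B where "B = (2 ^ w - 1 :: nat) div grid R"
  note g = grid_word[OF assms, folded B_def]
  have Q: "grid R > 0" by (simp add: grid_def)
  have "reward_word w x < 2 ^ w" by (simp add: reward_word_def)
  then have r: "reward_word w x \<le> 2 ^ w - 1" by simp
  have "2 ^ w - 1 = grid R * B + (2 ^ w - 1) mod grid R" unfolding B_def by simp
  moreover have "(2 ^ w - 1) mod grid R < grid R" using Q by simp
  ultimately have "2 ^ w - 1 < grid R * B + grid R" by linarith
  then have "reward_word w x < grid R * B + B" using r g(1) by linarith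
  then have "reward_word w x < (grid R + 1) * B" by simp
  then have "reward_word w x div B < grid R + 1" using g(2) by (simp add: div_less_iff_less_mult)
  then show ?thesis by (simp add: quantized_def B_def)
qed

lemma bar_le_grid:
  assumes "K > 0" "\<And>p. y p \<le> grid R"
  shows "bar (traj K R y u) \<le> grid R"
proof (induction u)
  case 0
  then show ?case by (simp add: start_def)
next
  case (Suc u)
  show ?case
  proof (cases "stage (traj K R y u) < R")
    case True
    show ?thesis
    proof (cases rule: traj_cases[OF True assms(1)])
      case 3
      let ?n = "pulls (traj K R y u) + 1" and ?P = "2 ^ level (traj K R y u) :: nat"
      let ?S = "psum y (arm (traj K R y u)) (u - pulls (traj K R y u)) ?n"
      have "?S \<le> (\<Sum>l=1..?n. grid R)" unfolding psum_def by (intro sum_mono assms)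
      then have "?S \<le> grid R * ?n" by (simp add: mult.commute)
      then have "?S * ?P \<le> grid R * ?n * ?P" by (rule mult_le_mono1)
      then have "?S * ?P - ?n * grid R \<le> grid R * (?n * ?P)"
        unfolding mult.assoc[of "grid R"] by (rule order_trans[OF diff_le_self])
      then have "(?S * ?P - ?n * grid R) div (?n * ?P) \<le> grid R * (?n * ?P) div (?n * ?P)"
        by (rule div_le_mono)
      also have "\<dots> = grid R" by (rule nonzero_mult_div_cancel_right) simp
      finally have "(?S * ?P - ?n * grid R) div (?n * ?P) \<le> grid R" .
      then show ?thesis using 3(4) Suc by (simp del: traj.simps)
    qed (use Suc in \<open>simp_all del: traj.simps\<close>)
  next
    case False
    then show ?thesis using traj_frozen[of R K y u] Suc by (simp del: traj.simps)
  qed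
qed

text \<open>After run \<open>Suc t\<close> the memory holds the state after t steps: the first run
  has no reward to process. Its output is the pull of time \<open>Suc t\<close>, whose reward then
  enters cell 1.\<close>

lemma run_player:
  assumes K: "K > 0" "K < 2 ^ w" and T: "T \<le> 4 ^ R" and W: "65536 * (4 ^ R) ^ 3 \<le> (2::nat) ^ w" and S: "15 \<le> S"
    and t: "t < T"
  shows "\<exists>m. run (player_prog R) S w K T \<omega> (Suc t) = Some m \<and> loaded m K (traj K R (table w R (fst \<omega>)) t) \<and>
     m ! 0 = pull R (traj K R (table w R (fst \<omega>)) t) \<and>
     m ! 1 = reward_word w (fst \<omega> (pull R (traj K R (table w R (fst \<omega>)) t), Suc t))"
  using t
proof (induction t)
  case 0
  let ?m = "(init_mem S K T)[2 := snd \<omega> (Suc 0) mod 2 ^ w]"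
  have st: "stored ?m K 0 0 0 0 0 0 0 0 0 0"
    using S by (simp add: stored_def init_mem_def)
  note w = word_room[OF W]
  from exec_player_init[OF st w] obtain m' where m': "exec w (player_prog R) ?m = Some m'"
    "length m' = length ?m" "loaded m' K start" "m' ! 0 = pull R start" by blast
  have "15 \<le> length m'" using m'(3) by (simp add: loaded_def stored_def)
  then have "1 < length m'" by linarith
  then show ?case using m' by (simp add: loaded_update_io)
next
  case (Suc t)
  let ?y = "table w R (fst \<omega>)"
  let ?\<sigma> = "traj K R ?y t"
  obtain m where m: "run (player_prog R) S w K T \<omega> (Suc t) = Some m" "loaded m K ?\<sigma>"
    "m ! 0 = pull R ?\<sigma>" "m ! 1 = reward_word w (fst \<omega> (pull R ?\<sigma>, Suc t))"
    using Suc by auto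
  define m0 where "m0 = m[2 := snd \<omega> (Suc (Suc t)) mod 2 ^ w]"
  have L: "loaded m0 K ?\<sigma>" using m(2) by (simp add: m0_def loaded_update_io)
  have yle: "?y p \<le> grid R" for p by (simp add: table_def quantized_le[OF W])
  have I: "inv K R ?y t ?\<sigma>" by (rule inv_traj[OF K(1)])
  have n: "pulls ?\<sigma> + 1 \<le> 4 ^ R" using I Suc.prems T by (simp add: inv_def)
  have g: "gain ?\<sigma> \<le> pulls ?\<sigma> * grid R"
  proof -
    have "gain ?\<sigma> = (\<Sum>l=1..pulls ?\<sigma>. ?y (arm ?\<sigma>, t - pulls ?\<sigma> + l))" using I by (simp add: inv_def psum_def)
    also have "\<dots> \<le> (\<Sum>l=1..pulls ?\<sigma>. grid R)" by (intro sum_mono yle)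
    finally show ?thesis by simp
  qed
  have z: "?y (pull R ?\<sigma>, Suc t) = m0 ! 1 div ((2 ^ w - 1) div grid R)"
    using m(4) by (simp add: m0_def table_def quantized_def)
  have a: "arm ?\<sigma> + 1 < 2 ^ w" "focus ?\<sigma> \<le> stage ?\<sigma>" "level ?\<sigma> \<le> stage ?\<sigma>"
    using I K(2) by (simp_all add: inv_def)
  from exec_player[OF L W a(2,3) n g bar_le_grid[OF K(1) yle] a(1) z yle] obtain m' where
    m': "exec w (player_prog R) m0 = Some m'" "loaded m' K (traj K R ?y (Suc t))"
      "m' ! 0 = pull R (traj K R ?y (Suc t))" by auto
  have "15 \<le> length m'" using m'(2) by (simp add: loaded_def stored_def)
  then have "1 < length m'" by linarith
  then show ?case
    unfolding run.simps(2)[of _ _ _ _ _ _ "Suc t"] m(1) bind.bind_lunit m0_def[symmetric] m'(1)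
    using m'(2,3) by (simp add: loaded_update_io del: traj.simps)
qed

section \<open>From real rewards to quantized ones\<close>

text \<open>Only entries of existing arms at times 1 to t are ever read. This identifies plays on
  \<open>table\<close>, which quantizes all coordinates, with plays on \<open>observed\<close>,
  which is 0 off the index set.\<close>

lemma traj_cong_pulled:
  assumes "K > 0" "\<And>i s. i < K \<Longrightarrow> 1 \<le> s \<Longrightarrow> s \<le> t \<Longrightarrow> y (i, s) = y' (i, s)"
  shows "traj K R y t = traj K R y' t"
  using assms(2)
proof (induction t)
  case (Suc t)
  have e: "traj K R y t = traj K R y' t" by (rule Suc.IH) (rule Suc.prems; simp)
  have "pull R (traj K R y' t) < K"
    using inv_traj[OF assms(1), of R y' t] by (auto simp: inv_def pull_def)
  then show ?case using Suc.prems[of "pull R (traj K R y' t)" "Suc t"] by (simp add: e)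
qed simp

lemma measurable_quantized [measurable]: "quantized w R \<in> borel \<rightarrow>\<^sub>M count_space UNIV"
proof -
  have "(\<lambda>x::real. \<lfloor>x * (2 ^ w - 1)\<rfloor>) \<in> borel \<rightarrow>\<^sub>M count_space UNIV" by measurable
  then have "(\<lambda>x::real. (\<lambda>z. nat z mod 2 ^ w div ((2 ^ w - 1) div grid R)) \<lfloor>x * (2 ^ w - 1 :: real)\<rfloor>) \<in> borel \<rightarrow>\<^sub>M count_space UNIV"
    by (rule measurable_compose) simp
  then show ?thesis unfolding quantized_def reward_word_def .
qed

text \<open>For N = 2^w - 1 and bucket width B, N lies between \<open>grid R\<close> and
  \<open>grid R + 1\<close> buckets, so x * N amounts to between x * grid R and x * grid R + 1 of
  them.\<close>

lemma quantized_close: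
  assumes W: "65536 * (4 ^ R) ^ 3 \<le> (2::nat) ^ w" and x: "x \<in> {0..1}"
  shows "\<bar>real (quantized w R x) - x * real (grid R)\<bar> \<le> 2"
proof -
  define B where "B = (2 ^ w - 1 :: nat) div grid R"
  note g = grid_word[OF W, folded B_def]
  have Q: "grid R > 0" by (simp add: grid_def)
  define N :: real where "N = 2 ^ w - 1"
  have N: "real (2 ^ w - 1 :: nat) = N" "0 \<le> N" by (simp_all add: N_def of_nat_diff)
  have f: "0 \<le> \<lfloor>x * N\<rfloor>" using x N by simp
  have "x * N \<le> N" using x N mult_right_mono[of x 1 N] by simp
  then have "\<lfloor>x * N\<rfloor> < 2 ^ w" unfolding N_def by (simp add: floor_less_iff)
  then have "nat \<lfloor>x * N\<rfloor> < 2 ^ w" using f by (metis nat_less_iff of_nat_numeral of_nat_power)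
  then have rw: "real (reward_word w x) = of_int \<lfloor>x * N\<rfloor>" using f by (simp add: reward_word_def N_def)
  define r where "r = reward_word w x"
  have r1: "real r \<le> x * N" "x * N < real r + 1" unfolding r_def rw by linarith+
  define d where "d = quantized w R x"
  have d: "d = r div B" by (simp add: d_def r_def quantized_def B_def)
  have "d * B \<le> r" by (simp add: d)
  then have d1: "real d * real B \<le> real r" by (metis of_nat_le_iff of_nat_mult)
  have "r < (d + 1) * B" unfolding d using dividend_less_times_div[OF g(2), of r] by (simp add: algebra_simps)
  then have "real r < real ((d + 1) * B)" by (simp only: of_nat_less_iff)
  \<comment> \<open>Integrality of r absorbs the floor in the reward word, as x * N < r + 1.\<close>
  then have "real r + 1 \<le> real ((d + 1) * B)" using \<open>r < (d + 1) * B\<close> by linarith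
  then have d2: "x * N < (real d + 1) * real B" using r1 unfolding of_nat_mult of_nat_add of_nat_1 by linarith
  have N1: "real (grid R) * real B \<le> N"
  proof -
    have "grid R * B \<le> 2 ^ w - 1" by (simp add: B_def)
    then have "real (grid R * B) \<le> real (2 ^ w - 1 :: nat)" by (simp only: of_nat_le_iff)
    then show ?thesis unfolding N(1) of_nat_mult .
  qed
  have N2: "N \<le> (real (grid R) + 1) * real B"
  proof -
    have "2 ^ w - 1 = grid R * B + (2 ^ w - 1) mod grid R" unfolding B_def by simp
    moreover have "(2 ^ w - 1) mod grid R < grid R" using Q by simp
    ultimately have "2 ^ w - 1 \<le> grid R * B + B" using g(1) by linarith
    then have "real (2 ^ w - 1 :: nat) \<le> real (grid R * B + B)" by (simp only: of_nat_le_iff)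
    then have "N \<le> real (grid R) * real B + real B" unfolding N(1) of_nat_add of_nat_mult .
    then show ?thesis by (simp add: algebra_simps)
  qed
  have B0: "0 < real B" using g(2) by simp
  have "real d * real B \<le> x * ((real (grid R) + 1) * real B)"
    using d1 r1(1) mult_left_mono[OF N2, of x] x by simp
  then have "real d * real B \<le> (x * (real (grid R) + 1)) * real B" by (simp only: mult.assoc)
  then have u: "real d \<le> x * (real (grid R) + 1)" using B0 by (rule mult_right_le_imp_le)
  have "x * (real (grid R) * real B) < (real d + 1) * real B"
    using d2 mult_left_mono[OF N1, of x] x by simp
  then have "(x * real (grid R)) * real B < (real d + 1) * real B" by (simp only: mult.assoc)
  then have l: "x * real (grid R) < real d + 1" using B0 by simp
  have "x * (real (grid R) + 1) \<le> x * real (grid R) + 1" using x by (simp add: algebra_simps)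
  with u l show ?thesis unfolding d_def[symmetric] by linarith
qed

section \<open>The product measure and the law of the quantized table\<close>

locale arms =
  fixes K T w R :: nat and D :: "nat \<Rightarrow> real measure"
  assumes K_pos: "K > 0" and inst: "bandit_instance K D" and W: "65536 * (4 ^ R) ^ 3 \<le> (2::nat) ^ w"
begin

text \<open>Padded by point masses, since the locale for product measures asks for a probability
  measure at every index.\<close>

definition arm_law :: "nat \<Rightarrow> real measure" where
  "arm_law i = (if i < K then D i else return borel 0)"

definition idx :: "(nat \<times> nat) set" where "idx = {..<K} \<times> {1..T}"

lemma finite_idx [simp]: "finite idx"
  by (simp add: idx_def)

abbreviation rewards :: "(nat \<times> nat \<Rightarrow> real) measure" where
  "rewards \<equiv> PiM idx (\<lambda>p. arm_law (fst p))"

lemma arm_law: "prob_space (arm_law i)" "sets (arm_law i) = sets borel" "AE x in arm_law i. x \<in> {0..1}"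
proof -
  have "real_distribution (D i) \<and> (AE x in D i. x \<in> {0..1})" if "i < K"
    using inst that by (simp add: bandit_instance_def)
  moreover have "AE x in return borel (0::real). x \<in> {0..1}" by (subst AE_return) auto
  moreover have "prob_space (return borel (0::real))" by (rule prob_space_return) simp
  ultimately show "prob_space (arm_law i)" "sets (arm_law i) = sets borel" "AE x in arm_law i. x \<in> {0..1}"
    unfolding arm_law_def real_distribution_def real_distribution_axioms_def by simp_all
qed

lemma space_arm_law [simp]: "space (arm_law i) = UNIV"
  using sets_eq_imp_space_eq[OF arm_law(2)[of i]] by simp

lemma borel_arm_law: "f \<in> borel_measurable borel \<Longrightarrow> f \<in> borel_measurable (arm_law i)"
  using measurable_cong_sets[OF arm_law(2) refl] by blast

lemma arm_law_measurable: "f \<in> borel \<rightarrow>\<^sub>M N \<Longrightarrow> f \<in> arm_law i \<rightarrow>\<^sub>M N"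
  using measurable_cong_sets[OF arm_law(2) refl] by blast

lemma integrable_reward: "integrable (arm_law i) (\<lambda>x. x)"
proof -
  interpret P: prob_space "arm_law i" by (rule arm_law)
  show ?thesis
    by (rule P.integrable_const_bound[of _ 1]) (use arm_law(3)[of i] in \<open>auto intro: borel_arm_law elim: eventually_mono\<close>)
qed

lemma reward_mean_bounds: "0 \<le> (\<integral>x. x \<partial>arm_law i)" "(\<integral>x. x \<partial>arm_law i) \<le> 1"
proof -
  interpret P: prob_space "arm_law i" by (rule arm_law)
  show "0 \<le> (\<integral>x. x \<partial>arm_law i)"
    by (rule integral_nonneg_AE) (use arm_law(3)[of i] in \<open>auto elim: eventually_mono\<close>)
  show "(\<integral>x. x \<partial>arm_law i) \<le> 1"
    by (rule P.integral_le_const[OF integrable_reward]) (use arm_law(3)[of i] in \<open>auto elim: eventually_mono\<close>)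
qed

definition \<rho> :: "nat \<Rightarrow> nat pmf" where
  "\<rho> i = Abs_pmf (distr (arm_law i) (count_space UNIV) (quantized w R))"

text \<open>On a countable type the points of measure zero form a null set, so the image measure is
  discrete and \<open>Abs_pmf\<close> is faithful.\<close>

lemma \<rho>: "measure_pmf (\<rho> i) = distr (arm_law i) (count_space UNIV) (quantized w R)"
proof -
  interpret P: prob_space "arm_law i" by (rule arm_law)
  let ?N = "distr (arm_law i) (count_space UNIV) (quantized w R)"
  have m: "quantized w R \<in> arm_law i \<rightarrow>\<^sub>M count_space UNIV" by (rule arm_law_measurable) simp
  interpret N: prob_space ?N by (rule P.prob_space_distr[OF m])
  have "AE x in ?N. measure ?N {x} \<noteq> 0"
  proof -
    have "AE x in ?N. x \<noteq> z" if "measure ?N {z} = 0" for z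
      by (rule AE_I[of _ _ "{z}"]) (auto simp: that N.emeasure_eq_measure)
    then have "AE x in ?N. measure ?N {z} = 0 \<longrightarrow> x \<noteq> z" for z
      by (cases "measure ?N {z} = 0") auto
    then have "AE x in ?N. \<forall>z. measure ?N {z} = 0 \<longrightarrow> x \<noteq> z" by (simp add: AE_all_countable)
    then show ?thesis by (rule eventually_mono) blast
  qed
  then show ?thesis unfolding \<rho>_def
    by (intro Abs_pmf_inverse) (simp add: N.prob_space_axioms)
qed

lemma \<rho>_supp: "set_pmf (\<rho> i) \<subseteq> {..grid R}"
proof
  fix z assume "z \<in> set_pmf (\<rho> i)"
  then have "measure (\<rho> i) {z} \<noteq> 0" by (simp add: set_pmf_iff pmf.rep_eq)
  moreover have "measure (\<rho> i) {z} = measure (arm_law i) (quantized w R -` {z} \<inter> space (arm_law i))"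
    unfolding \<rho> by (rule measure_distr) (auto intro: arm_law_measurable)
  ultimately have "quantized w R -` {z} \<inter> space (arm_law i) \<noteq> {}" by (metis measure_empty)
  then show "z \<in> {..grid R}" using quantized_le[OF W] by auto
qed

lemma \<rho>_mean: "\<bar>measure_pmf.expectation (\<rho> i) real / real (grid R) - (\<integral>x. x \<partial>arm_law i)\<bar> \<le> 2 / real (grid R)"
proof -
  interpret P: prob_space "arm_law i" by (rule arm_law)
  have Q: "0 < real (grid R)" by (simp add: grid_def)
  have m: "quantized w R \<in> arm_law i \<rightarrow>\<^sub>M count_space UNIV" by (rule arm_law_measurable) simp
  have mr: "(\<lambda>x. real (quantized w R x)) \<in> borel_measurable (arm_law i)"
    by (rule measurable_compose[OF m]) simp
  have i1: "integrable (arm_law i) (\<lambda>x. real (quantized w R x))"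
    by (rule P.integrable_const_bound[of _ "real (grid R)"]) (auto simp: mr quantized_le[OF W])
  have i2: "integrable (arm_law i) (\<lambda>x. x * real (grid R))" using integrable_reward by simp
  have "measure_pmf.expectation (\<rho> i) real = (\<integral>x. real (quantized w R x) \<partial>arm_law i)"
    unfolding \<rho> by (rule integral_distr[OF m]) simp
  then have "measure_pmf.expectation (\<rho> i) real - (\<integral>x. x \<partial>arm_law i) * real (grid R)
     = (\<integral>x. real (quantized w R x) - x * real (grid R) \<partial>arm_law i)"
    using i1 i2 by simp
  also have "\<bar>\<dots>\<bar> \<le> (\<integral>x. \<bar>real (quantized w R x) - x * real (grid R)\<bar> \<partial>arm_law i)"
    by (rule integral_abs_bound)
  also have "\<dots> \<le> 2"
    using i1 i2 arm_law(3)[of i] quantized_close[OF W]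
    by (intro P.integral_le_const) (auto elim: eventually_mono)
  finally have "\<bar>measure_pmf.expectation (\<rho> i) real - (\<integral>x. x \<partial>arm_law i) * real (grid R)\<bar> / real (grid R) \<le> 2 / real (grid R)"
    using Q by (intro divide_right_mono) auto
  moreover have "(measure_pmf.expectation (\<rho> i) real - (\<integral>x. x \<partial>arm_law i) * real (grid R)) / real (grid R)
    = measure_pmf.expectation (\<rho> i) real / real (grid R) - (\<integral>x. x \<partial>arm_law i)"
    using Q by (simp add: diff_divide_distrib)
  then have "\<bar>measure_pmf.expectation (\<rho> i) real / real (grid R) - (\<integral>x. x \<partial>arm_law i)\<bar>
    = \<bar>measure_pmf.expectation (\<rho> i) real - (\<integral>x. x \<partial>arm_law i) * real (grid R)\<bar> / real (grid R)"
    using Q by (metis abs_divide abs_of_pos)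
  ultimately show ?thesis by simp
qed

sublocale finite_product_prob_space "\<lambda>p. arm_law (fst p)" idx
proof -
  interpret A: product_prob_space "\<lambda>p. arm_law (fst p)" idx
    by (rule product_prob_spaceI) (rule arm_law)
  show "finite_product_prob_space (\<lambda>p. arm_law (fst p)) idx"
    by unfold_locales simp
qed

text \<open>Zero off the index set, to agree with the default value of
  \<open>Pi_pmf\<close>.\<close>

definition observed :: "(nat \<times> nat \<Rightarrow> real) \<Rightarrow> nat \<times> nat \<Rightarrow> nat" where
  "observed x = (\<lambda>p. if p \<in> idx then quantized w R (x p) else 0)"

definition outcomes :: "(nat \<times> nat \<Rightarrow> nat) set" where
  "outcomes = PiE_dflt idx 0 (\<lambda>_. {..grid R})"

lemma outcomes_iff: "y \<in> outcomes \<longleftrightarrow> (\<forall>p\<in>idx. y p \<le> grid R) \<and> (\<forall>p. p \<notin> idx \<longrightarrow> y p = 0)"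
  unfolding outcomes_def PiE_dflt_def by blast

lemma outcomes_outside: "y \<in> outcomes \<Longrightarrow> p \<notin> idx \<Longrightarrow> y p = 0"
  unfolding outcomes_iff by blast

lemma finite_outcomes: "finite outcomes"
  unfolding outcomes_def by (rule finite_PiE_dflt) simp_all

lemma observed_outcomes: "observed x \<in> outcomes"
  unfolding outcomes_iff observed_def using quantized_le[OF W] by simp

lemma observed_eq_iff:
  assumes "y \<in> outcomes"
  shows "observed x = y \<longleftrightarrow> (\<forall>p\<in>idx. quantized w R (x p) = y p)"
proof
  assume "observed x = y"
  then show "\<forall>p\<in>idx. quantized w R (x p) = y p" by (auto simp: observed_def)
next
  assume a: "\<forall>p\<in>idx. quantized w R (x p) = y p"
  show "observed x = y"
  proof
    fix p
    show "observed x p = y p" using a assms by (cases "p \<in> idx") (simp_all add: observed_def outcomes_outside)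
  qed
qed

lemma sets_quantized: "quantized w R -` {z} \<in> sets (arm_law i)"
  unfolding arm_law(2) using measurable_sets[OF measurable_quantized, of "{z}"] by simp

lemma observed_preimage:
  assumes "y \<in> outcomes"
  shows "observed -` {y} \<inter> space rewards = PiE idx (\<lambda>p. quantized w R -` {y p})"
proof -
  have "space rewards = PiE idx (\<lambda>_. UNIV)" by (simp add: space_PiM)
  then show ?thesis using observed_eq_iff[OF assms] by (auto simp: PiE_def Pi_def)
qed

lemma measurable_observed: "observed \<in> rewards \<rightarrow>\<^sub>M count_space UNIV"
proof -
  have "observed -` {y} \<inter> space rewards \<in> sets rewards" if "y \<in> outcomes" for y
    unfolding observed_preimage[OF that] by (rule sets_PiM_I_finite) (simp_all add: sets_quantized)
  then have "observed \<in> rewards \<rightarrow>\<^sub>M count_space outcomes"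
    unfolding measurable_count_space_eq2[OF finite_outcomes] using observed_outcomes by blast
  moreover have "(\<lambda>y. y) \<in> count_space outcomes \<rightarrow>\<^sub>M count_space UNIV" by simp
  ultimately show ?thesis by (rule measurable_compose)
qed

text \<open>Both measures live on the finite set \<open>outcomes\<close>, and a single table has a
  box as preimage, whose measure factorizes.\<close>

lemma distr_observed: "distr rewards (count_space UNIV) observed = measure_pmf (Pi_pmf idx 0 (\<lambda>p. \<rho> (fst p)))"
proof (rule measure_eqI_countable_AE)
  show "countable outcomes" using finite_outcomes by (rule countable_finite)
  show "AE y in distr rewards (count_space UNIV) observed. y \<in> outcomes"
    by (subst AE_distr_iff) (auto simp: measurable_observed observed_outcomes)
  show "AE y in measure_pmf (Pi_pmf idx 0 (\<lambda>p. \<rho> (fst p))). y \<in> outcomes"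
  proof (rule AE_pmfI)
    fix y assume "y \<in> set_pmf (Pi_pmf idx 0 (\<lambda>p. \<rho> (fst p)))"
    then show "y \<in> outcomes"
      using \<rho>_supp unfolding outcomes_iff by (subst (asm) set_Pi_pmf) (auto simp: PiE_dflt_def)
  qed
  fix y assume y: "y \<in> outcomes"
  have "emeasure (distr rewards (count_space UNIV) observed) {y} = emeasure rewards (PiE idx (\<lambda>p. quantized w R -` {y p}))"
    by (subst emeasure_distr) (auto simp: measurable_observed observed_preimage[OF y])
  also have "\<dots> = (\<Prod>p\<in>idx. emeasure (arm_law (fst p)) (quantized w R -` {y p}))"
    by (rule emeasure_PiM) (auto intro: sets_quantized)
  also have "\<dots> = (\<Prod>p\<in>idx. ennreal (pmf (\<rho> (fst p)) (y p)))"
  proof (rule prod.cong)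
    fix p
    have "ennreal (pmf (\<rho> (fst p)) (y p)) = emeasure (measure_pmf (\<rho> (fst p))) {y p}" by (rule emeasure_pmf_single[symmetric])
    also have "\<dots> = emeasure (arm_law (fst p)) (quantized w R -` {y p} \<inter> space (arm_law (fst p)))"
      unfolding \<rho> by (rule emeasure_distr) (auto intro: arm_law_measurable)
    finally show "emeasure (arm_law (fst p)) (quantized w R -` {y p}) = ennreal (pmf (\<rho> (fst p)) (y p))" by simp
  qed simp
  also have "\<dots> = ennreal (\<Prod>p\<in>idx. pmf (\<rho> (fst p)) (y p))" by (rule prod_ennreal) simp
  also have "\<dots> = ennreal (pmf (Pi_pmf idx 0 (\<lambda>p. \<rho> (fst p))) y)"
    using outcomes_outside[OF y] by (subst pmf_Pi') simp_all
  finally show "emeasure (distr rewards (count_space UNIV) observed) {y}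
    = emeasure (measure_pmf (Pi_pmf idx 0 (\<lambda>p. \<rho> (fst p)))) {y}" by (simp add: emeasure_pmf_single)
qed auto

lemma integral_observed:
  fixes h :: "(nat \<times> nat \<Rightarrow> nat) \<Rightarrow> real"
  shows "(\<integral>x. h (observed x) \<partial>rewards) = measure_pmf.expectation (Pi_pmf idx 0 (\<lambda>p. \<rho> (fst p))) h"
  unfolding distr_observed[symmetric] by (rule integral_distr[symmetric, OF measurable_observed]) simp

lemma integrable_coordinate:
  assumes "p \<in> idx"
  shows "integrable rewards (\<lambda>x. x p)"
proof -
  have "AE x in rewards. x p \<in> {0..1}"
    by (rule AE_component[OF assms]) (rule arm_law)
  moreover have "(\<lambda>x. x p) \<in> borel_measurable rewards"
    using measurable_component_singleton[OF assms, of "\<lambda>p. arm_law (fst p)"] measurable_cong_sets[OF refl arm_law(2)] by blast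
  ultimately show ?thesis
    by (intro integrable_const_bound[of _ 1]) (auto elim: eventually_mono)
qed

lemma integral_coordinate:
  assumes "p \<in> idx"
  shows "(\<integral>x. x p \<partial>rewards) = (\<integral>x. x \<partial>arm_law (fst p))"
proof -
  have "(\<integral>x. x \<partial>arm_law (fst p)) = (\<integral>x. x \<partial>distr rewards (arm_law (fst p)) (\<lambda>x. x p))"
    using PiM_component[OF assms] by simp
  also have "\<dots> = (\<integral>x. x p \<partial>rewards)"
    by (rule integral_distr) (auto intro: measurable_component_singleton assms borel_arm_law)
  finally show ?thesis by simp
qed

text \<open>The event ignores coordinate p, so Fubini integrates that coordinate out first and
  leaves its mean as a factor.\<close>

lemma integral_indep_coordinate:
  assumes p: "p \<in> idx" and g: "\<And>y z. g (y(p := z)) = g y"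
  shows "(\<integral>x. x p * of_bool (g (observed x)) \<partial>rewards)
    = (\<integral>x. (\<integral>z. z \<partial>arm_law (fst p)) * of_bool (g (observed x)) \<partial>rewards)"
proof -
  define J where "J = idx - {p}"
  have J: "idx = insert p J" "p \<notin> J" "finite J" using p by (auto simp: J_def)
  define G where "G = (\<lambda>x. of_bool (g (observed x)) :: real)"
  have mG: "G \<in> borel_measurable rewards"
    unfolding G_def by (rule measurable_compose[OF measurable_observed]) simp
  have Gp: "G (x(p := z)) = G x" for x z
  proof -
    have "observed (x(p := z)) = (observed x)(p := quantized w R z)"
      using p by (auto simp: observed_def fun_eq_iff)
    then show ?thesis by (simp add: G_def g)
  qed
  have iG: "integrable rewards (\<lambda>x. c * G x)" for c
    using mG by (intro integrable_const_bound[of _ "\<bar>c\<bar>"]) (auto simp: G_def)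
  have ixG: "integrable rewards (\<lambda>x. x p * G x)"
    by (rule Bochner_Integration.integrable_bound[OF integrable_coordinate[OF p]])
       (use mG integrable_coordinate[OF p] in \<open>auto simp: G_def\<close>)
  have one: "measure (arm_law (fst p)) UNIV = 1"
    using prob_space.prob_space[OF arm_law(1)] by simp
  have "(\<integral>x. x p * G x \<partial>rewards) = (\<integral>x. (\<integral>z. (x(p := z)) p * G (x(p := z)) \<partial>arm_law (fst p)) \<partial>PiM J (\<lambda>p. arm_law (fst p)))"
    unfolding J(1) by (rule product_integral_insert[OF J(3,2)]) (use ixG in \<open>simp add: J(1)[symmetric]\<close>)
  also have "\<dots> = (\<integral>x. (\<integral>z. z \<partial>arm_law (fst p)) * G x \<partial>PiM J (\<lambda>p. arm_law (fst p)))"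
    by (simp add: Gp)
  \<comment> \<open>Integrating a constant over a probability measure restores coordinate p, so that
    the full product returns.\<close>
  also have "\<dots> = (\<integral>x. (\<integral>z'. (\<integral>z. z \<partial>arm_law (fst p)) * G (x(p := z')) \<partial>arm_law (fst p)) \<partial>PiM J (\<lambda>p. arm_law (fst p)))"
    unfolding Gp by (simp add: one)
  also have "\<dots> = (\<integral>x. (\<integral>z. z \<partial>arm_law (fst p)) * G x \<partial>rewards)"
    unfolding J(1) by (rule product_integral_insert[OF J(3,2), symmetric]) (use iG in \<open>simp add: J(1)[symmetric]\<close>)
  finally show ?thesis by (simp add: G_def)
qed

end

section \<open>The pseudo-regret as an expectation over tables\<close>

context arms
begin

definition mean :: "nat \<Rightarrow> real" where
  "mean i = (\<integral>x. x \<partial>arm_law i)"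

lemma mean_eq: "i < K \<Longrightarrow> mean i = arm_mean D i"
  by (simp add: mean_def arm_mean_def arm_law_def)

abbreviation words :: "(nat \<Rightarrow> nat) measure" where
  "words \<equiv> PiM {1..T} (\<lambda>t. measure_pmf (pmf_of_set {..<2 ^ w}))"

lemma bandit_space_eq: "bandit_space w K T D = rewards \<Otimes>\<^sub>M words"
proof -
  have "PiM ({..<K} \<times> {1..T}) (\<lambda>p. D (fst p)) = rewards"
    unfolding idx_def by (rule PiM_cong) (auto simp: arm_law_def)
  then show ?thesis by (simp add: bandit_space_def)
qed

text \<open>The player is deterministic: the random words form a probability space of their own and
  are projected away.\<close>

lemma integral_fst:
  assumes "h \<in> borel_measurable rewards"
  shows "(\<integral>\<omega>. h (fst \<omega>) \<partial>bandit_space w K T D) = (\<integral>x. h x \<partial>rewards :: real)"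
proof -
  interpret N: prob_space words by (rule prob_space_PiM) (rule measure_pmf.prob_space_axioms)
  have "(\<integral>x. h x \<partial>rewards) = (\<integral>x. h x \<partial>distr (rewards \<Otimes>\<^sub>M words) rewards fst)"
    by (simp only: N.distr_pair_fst)
  also have "\<dots> = (\<integral>\<omega>. h (fst \<omega>) \<partial>(rewards \<Otimes>\<^sub>M words))"
    by (rule integral_distr[OF measurable_fst assms])
  finally show ?thesis by (simp add: bandit_space_eq)
qed

lemma measurable_coordinate: "p \<in> idx \<Longrightarrow> (\<lambda>x. x p) \<in> borel_measurable rewards"
  using integrable_coordinate by (rule borel_measurable_integrable)

lemma mem_idx: "i < K \<Longrightarrow> t \<in> {1..T} \<Longrightarrow> (i, t) \<in> idx"
  by (simp add: idx_def)

abbreviation law where "law \<equiv> Pi_pmf idx 0 (\<lambda>p. \<rho> (fst p))"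

lemma integral_arm:
  assumes "i < K"
  shows "(\<integral>\<omega>. (\<Sum>t=1..T. fst \<omega> (i, t)) \<partial>bandit_space w K T D) = real T * mean i"
proof -
  have "(\<integral>\<omega>. (\<Sum>t=1..T. fst \<omega> (i, t)) \<partial>bandit_space w K T D) = (\<integral>x. (\<Sum>t=1..T. x (i, t)) \<partial>rewards)"
    by (rule integral_fst[of "\<lambda>x. \<Sum>t=1..T. x (i, t)"]) (intro borel_measurable_sum measurable_coordinate mem_idx assms)
  also have "\<dots> = (\<Sum>t=1..T. \<integral>x. x (i, t) \<partial>rewards)"
    by (rule Bochner_Integration.integral_sum) (intro integrable_coordinate mem_idx assms)
  also have "\<dots> = (\<Sum>t=1..T. mean i)"
    by (intro sum.cong refl) (simp add: integral_coordinate mem_idx assms mean_def)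
  finally show ?thesis by simp
qed

text \<open>Split by the arm i chosen at time t. The choice depends on rewards before t and is
  independent of \<open>x (i, t)\<close>, which may hence be replaced by its mean.\<close>

lemma integral_policy:
  assumes c: "\<And>y t. c t y < K" and cong: "\<And>y y' t. t \<in> {1..T} \<Longrightarrow> (\<And>p. snd p < t \<Longrightarrow> y p = y' p) \<Longrightarrow> c t y = c t y'"
  shows "(\<integral>x. (\<Sum>t=1..T. x (c t (observed x), t)) \<partial>rewards)
    = measure_pmf.expectation law (\<lambda>y. \<Sum>t=1..T. mean (c t y))"
proof -
  have split: "(\<Sum>i<K. f i * of_bool (c t y = i)) = f (c t y)" for f :: "nat \<Rightarrow> real" and t y
  proof -
    have "(\<Sum>i<K. f i * of_bool (c t y = i)) = (\<Sum>i\<in>{c t y}. f i * of_bool (c t y = i))"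
      using c[of t y] by (intro sum.mono_neutral_right) auto
    then show ?thesis by simp
  qed
  have mb: "(\<lambda>x. of_bool (g (observed x)) :: real) \<in> borel_measurable rewards" for g
    by (rule measurable_compose[OF measurable_observed]) simp
  have int: "integrable rewards (\<lambda>x. x (i, t) * of_bool (c t (observed x) = i))" if "i < K" "t \<in> {1..T}" for i t
    by (rule Bochner_Integration.integrable_bound[OF integrable_coordinate[OF mem_idx[OF that]]])
       (use mb[of "\<lambda>y. c t y = i"] measurable_coordinate[OF mem_idx[OF that]] in auto)
  have int': "integrable rewards (\<lambda>x. mean i * of_bool (c t (observed x) = i))" for i t
    by (rule integrable_const_bound[of _ "\<bar>mean i\<bar>"]) (use mb[of "\<lambda>y. c t y = i"] in auto)
  have "(\<integral>x. (\<Sum>t=1..T. x (c t (observed x), t)) \<partial>rewards)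
    = (\<integral>x. (\<Sum>t=1..T. \<Sum>i<K. x (i, t) * of_bool (c t (observed x) = i)) \<partial>rewards)"
    by (intro Bochner_Integration.integral_cong sum.cong refl) (rule split[symmetric])
  also have "\<dots> = (\<Sum>t=1..T. \<integral>x. (\<Sum>i<K. x (i, t) * of_bool (c t (observed x) = i)) \<partial>rewards)"
    by (rule Bochner_Integration.integral_sum) (rule Bochner_Integration.integrable_sum, rule int, simp only: lessThan_iff)
  also have "\<dots> = (\<Sum>t=1..T. \<Sum>i<K. \<integral>x. x (i, t) * of_bool (c t (observed x) = i) \<partial>rewards)"
    by (intro sum.cong refl Bochner_Integration.integral_sum int) (simp only: lessThan_iff)
  also have "\<dots> = (\<Sum>t=1..T. \<Sum>i<K. \<integral>x. mean i * of_bool (c t (observed x) = i) \<partial>rewards)"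
  proof (intro sum.cong refl)
    fix t i assume a: "t \<in> {1..T}" "i \<in> {..<K}"
    have "c t (y((i, t) := z)) = c t y" for y z
      by (rule cong[OF a(1)]) auto
    then show "(\<integral>x. x (i, t) * of_bool (c t (observed x) = i) \<partial>rewards)
      = (\<integral>x. mean i * of_bool (c t (observed x) = i) \<partial>rewards)"
      using integral_indep_coordinate[OF mem_idx, of i t "\<lambda>y. c t y = i"] a by (simp add: mean_def)
  qed
  also have "\<dots> = (\<Sum>t=1..T. \<integral>x. (\<Sum>i<K. mean i * of_bool (c t (observed x) = i)) \<partial>rewards)"
    by (intro sum.cong refl Bochner_Integration.integral_sum[symmetric] int')
  also have "\<dots> = (\<integral>x. (\<Sum>t=1..T. \<Sum>i<K. mean i * of_bool (c t (observed x) = i)) \<partial>rewards)"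
    by (rule Bochner_Integration.integral_sum[symmetric]) (rule Bochner_Integration.integrable_sum, rule int')
  also have "\<dots> = (\<integral>x. (\<Sum>t=1..T. mean (c t (observed x))) \<partial>rewards)"
    by (simp only: split)
  also have "\<dots> = measure_pmf.expectation law (\<lambda>y. \<Sum>t=1..T. mean (c t y))"
    by (rule integral_observed)
  finally show ?thesis .
qed

lemma traj_observed: "t \<le> T \<Longrightarrow> traj K R (table w R x) t = traj K R (observed x) t"
  by (rule traj_cong_pulled[OF K_pos]) (simp add: table_def observed_def idx_def)

lemma pull_less: "pull R (traj K R y t) < K"
  using inv_traj[OF K_pos, of R y t] by (auto simp: inv_def pull_def)

lemma pseudo_regret_le:
  assumes KW: "K < 2 ^ w" and T: "T \<le> 4 ^ R" and S: "15 \<le> S" and opt: "\<And>i. i < K \<Longrightarrow> mean i \<le> mean opt"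
  shows "pseudo_regret (player_prog R) S w K T D
    \<le> measure_pmf.expectation law (\<lambda>y. \<Sum>t<T. mean opt - mean (pull R (traj K R y t)))"
proof -
  define c where "c = (\<lambda>t y. pull R (traj K R y (t - 1)))"
  have chosen: "chosen_arm (player_prog R) S w K T t \<omega> = c t (observed (fst \<omega>))" if t: "t \<in> {1..T}" for t \<omega>
  proof -
    obtain u where u: "t = Suc u" "u < T" using t by (cases t) auto
    from run_player[OF K_pos KW T W S u(2), of \<omega>] obtain m where
      "run (player_prog R) S w K T \<omega> (Suc u) = Some m" "m ! 0 = pull R (traj K R (table w R (fst \<omega>)) u)"
      by blast
    moreover have "traj K R (table w R (fst \<omega>)) u = traj K R (observed (fst \<omega>)) u"
      using u(2) by (intro traj_observed) simp
    ultimately show ?thesis by (simp only: chosen_arm_def c_def u(1) option.sel diff_Suc_1)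
  qed
  have cK: "c t y < K" for t y by (simp add: c_def pull_less)
  have cong: "c t y = c t y'" if "t \<in> {1..T}" "\<And>p. snd p < t \<Longrightarrow> y p = y' p" for t y y'
  proof -
    have "traj K R y (t - 1) = traj K R y' (t - 1)"
    proof (rule traj_cong)
      fix p :: "nat \<times> nat" assume "snd p \<le> t - 1"
      with that(1) have "snd p < t" unfolding atLeastAtMost_iff by linarith
      then show "y p = y' p" by (rule that(2))
    qed
    then show ?thesis by (simp only: c_def)
  qed
  \<comment> \<open>The coordinate read varies with x, but takes finitely many values, each on a
    measurable set.\<close>
  have mb: "(\<lambda>x. x (c t (observed x), t)) \<in> borel_measurable rewards" if "t \<in> {1..T}" for t
  proof -
    have "(\<lambda>x. x (i, t)) \<in> borel_measurable rewards" if "i \<in> {..<K}" for i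
      using \<open>t \<in> {1..T}\<close> that by (intro measurable_coordinate mem_idx) auto
    moreover have "(\<lambda>x. c t (observed x)) \<in> rewards \<rightarrow>\<^sub>M count_space {..<K}"
      by (rule measurable_compose[OF measurable_observed]) (simp add: cK)
    ultimately show ?thesis
      by (rule measurable_compose_countable'[where f = "\<lambda>i x. x (i, t)" and I = "{..<K}"])
        (assumption, rule countable_finite, rule finite_lessThan)
  qed
  let ?X = "measure_pmf.expectation law (\<lambda>y. \<Sum>t=1..T. mean (c t y))"
  have X: "(\<integral>\<omega>. (\<Sum>t=1..T. fst \<omega> (chosen_arm (player_prog R) S w K T t \<omega>, t)) \<partial>bandit_space w K T D) = ?X"
  proof -
    have "(\<integral>\<omega>. (\<Sum>t=1..T. fst \<omega> (chosen_arm (player_prog R) S w K T t \<omega>, t)) \<partial>bandit_space w K T D)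
      = (\<integral>\<omega>. (\<Sum>t=1..T. fst \<omega> (c t (observed (fst \<omega>)), t)) \<partial>bandit_space w K T D)"
      by (intro Bochner_Integration.integral_cong refl sum.cong) (simp only: chosen)
    also have "\<dots> = (\<integral>x. (\<Sum>t=1..T. x (c t (observed x), t)) \<partial>rewards)"
      by (rule integral_fst[of "\<lambda>x. \<Sum>t=1..T. x (c t (observed x), t)"]) (intro borel_measurable_sum mb)
    also have "\<dots> = ?X" by (rule integral_policy[OF cK cong])
    finally show ?thesis .
  qed
  have fin: "finite (set_pmf law)"
    by (subst set_Pi_pmf) (auto intro!: finite_PiE_dflt finite_subset[OF \<rho>_supp])
  have "pseudo_regret (player_prog R) S w K T D \<le> real T * mean opt - ?X"
    unfolding pseudo_regret_def X
  proof (rule Max.boundedI)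
    fix z assume "z \<in> (\<lambda>i. (\<integral>\<omega>. (\<Sum>t=1..T. fst \<omega> (i, t)) \<partial>bandit_space w K T D) - ?X) ` {..<K}"
    then obtain i where i: "i < K" "z = real T * mean i - ?X" by (auto simp: integral_arm simp del: One_nat_def)
    show "z \<le> real T * mean opt - ?X" unfolding i(2) using opt[OF i(1)] by (simp add: mult_left_mono)
  qed (use K_pos in auto)
  also have "\<dots> = measure_pmf.expectation law (\<lambda>y. real T * mean opt - (\<Sum>t=1..T. mean (c t y)))"
    by (subst Bochner_Integration.integral_diff) (auto intro: integrable_measure_pmf_finite[OF fin])
  also have "\<dots> = measure_pmf.expectation law (\<lambda>y. \<Sum>t<T. mean opt - mean (pull R (traj K R y t)))"
  proof (rule Bochner_Integration.integral_cong[OF refl])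
    fix y
    have "(\<Sum>t=1..T. mean (c t y)) = (\<Sum>t<T. mean (pull R (traj K R y t)))"
      unfolding c_def by (rule sum.reindex_bij_witness[of _ Suc "\<lambda>t. t - 1"]) auto
    then show "real T * mean opt - (\<Sum>t=1..T. mean (c t y)) = (\<Sum>t<T. mean opt - mean (pull R (traj K R y t)))"
      by (simp add: sum_subtractf)
  qed
  finally show ?thesis .
qed

end

lemma legal_player_prog:
  assumes "K > 0" "K < 2 ^ w" "T \<le> 4 ^ R" "65536 * (4 ^ R) ^ 3 \<le> (2::nat) ^ w" "15 \<le> S"
  shows "legal_player (player_prog R) S w K T"
  unfolding legal_player_def
proof (intro allI ballI)
  fix \<omega> t assume "t \<in> {1..T}"
  then obtain u where u: "t = Suc u" "u < T" by (cases t) auto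
  from run_player[OF assms u(2), of \<omega>] obtain m where
    m: "run (player_prog R) S w K T \<omega> (Suc u) = Some m" "m ! 0 = pull R (traj K R (table w R (fst \<omega>)) u)"
    by blast
  moreover have "pull R (traj K R (table w R (fst \<omega>)) u) < K"
    using inv_traj[OF assms(1), of R "table w R (fst \<omega>)" u] by (auto simp: inv_def pull_def)
  ultimately show "run (player_prog R) S w K T \<omega> t \<noteq> None \<and> chosen_arm (player_prog R) S w K T t \<omega> < K"
    by (simp only: chosen_arm_def u(1) option.sel option.distinct not_False_eq_True simp_thms)
qed

section \<open>Comparison with the logarithmic bound\<close>

lemma log_ge1_ge: "1 \<le> log_ge1 x" "ln x \<le> log_ge1 x"
  by (simp_all add: log_ge1_def)

text \<open>The width bound \<open>sqrt (min k (h - k))\<close> fits into the budget for every \<open>\<gamma>\<close>: for \<open>\<gamma> \<ge> 1\<close> the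
  first summand pays for \<open>k\<close>, for \<open>\<gamma> < 1\<close> the second one pays for \<open>sqrt (h - k)\<close>.\<close>

lemma width_le_budget:
  fixes \<Delta> \<delta> \<gamma> :: real
  assumes \<gamma>: "0 < \<gamma>" and \<delta>: "0 < \<delta>" "\<delta> \<le> \<Delta>"
    and k: "1 / 2 ^ k \<le> \<Delta>" "\<Delta> < 2 * (1 / 2 ^ k)" and h: "\<delta> < 2 * (1 / 2 ^ h)"
  shows "1 + real (floor_sqrt (min k (h - k)))
     \<le> 4 * (log_ge1 (1 / \<Delta>) powr \<gamma> + ln (\<Delta> / \<delta>) / (\<gamma> * log_ge1 (ln (\<Delta> / \<delta>))))"
proof -
  define f where "f = real (floor_sqrt (min k (h - k)))"
  define A where "A = log_ge1 (1 / \<Delta>)"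
  define z where "z = ln (\<Delta> / \<delta>)"
  define L where "L = log_ge1 z"
  have ln2: "1 / 2 \<le> ln (2::real)" using ln_le_minus_one[of "1 / 2 :: real"] by (simp add: ln_div)
  have \<Delta>: "0 < \<Delta>" using \<delta> by simp
  have A1: "1 \<le> A" unfolding A_def by (rule log_ge1_ge)
  have L1: "1 \<le> L" unfolding L_def by (rule log_ge1_ge)
  have z0: "0 \<le> z" using \<delta> by (simp add: z_def)
  define q where "q = z / (\<gamma> * L)"
  have sec: "0 \<le> q" unfolding q_def using z0 L1 \<gamma> by simp
  show ?thesis
  proof (cases "1 \<le> \<gamma>")
    case True
    \<comment> \<open>With ln 2 \<ge> 1/2 this bounds k by 1 + 2 A, and the crude estimate f \<le> k
      then suffices.\<close>
    have "2 ^ k < 2 / \<Delta>" using k(2) \<Delta> by (simp add: field_simps)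
    then have "ln (2 ^ k) < ln (2 / \<Delta>)" using \<Delta> by simp
    then have "real k * ln 2 < ln 2 + ln (1 / \<Delta>)" using \<Delta> by (simp add: ln_realpow ln_div)
    moreover have "ln (1 / \<Delta>) \<le> A" unfolding A_def by (rule log_ge1_ge)
    ultimately have kl: "(real k - 1) * ln 2 \<le> A" by (simp add: algebra_simps)
    have "real k \<le> 1 + 2 * A"
    proof (cases "1 \<le> real k")
      case True
      then have "(real k - 1) * (1 / 2) \<le> (real k - 1) * ln 2" using ln2 by (intro mult_left_mono) auto
      then have "(real k - 1) * (1 / 2) \<le> A" using kl by (rule order_trans)
      then show ?thesis by simp
    qed (use A1 in linarith)
    moreover have "floor_sqrt (min k (h - k)) \<le> k"
      by (rule order_trans[OF floor_sqrt_le]) simp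
    then have "f \<le> real k" by (simp only: f_def of_nat_le_iff)
    ultimately have "1 + f \<le> 4 * A" using A1 by linarith
    moreover have "A \<le> A powr \<gamma>" using powr_mono[OF True A1] A1 by simp
    ultimately show ?thesis using sec unfolding A_def[symmetric] z_def[symmetric] L_def[symmetric] q_def[symmetric] f_def[symmetric] distrib_left by linarith
  next
    case False
    let ?d = "real (h - k)"
    have d: "?d \<le> 1 + 2 * z"
    proof (cases "k \<le> h")
      case True
      have "2 ^ h < 2 / \<delta>" using h \<delta> by (simp add: field_simps)
      moreover have "1 \<le> \<Delta> * 2 ^ k" using k(1) by (simp add: field_simps)
      then have "2 ^ (h - k) * 1 \<le> 2 ^ (h - k) * (\<Delta> * 2 ^ k)" by (intro mult_left_mono) auto
      then have "2 ^ (h - k) \<le> \<Delta> * 2 ^ h" using True by (simp add: power_diff mult.commute)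
      moreover have "\<Delta> * 2 ^ h < \<Delta> * (2 / \<delta>)" using calculation(1) \<Delta> by (rule mult_strict_left_mono)
      ultimately have "2 ^ (h - k) < 2 * (\<Delta> / \<delta>)" by (simp add: mult.commute)
      moreover have "0 < \<Delta> / \<delta>" using \<Delta> \<delta> by simp
      ultimately have "ln (2 ^ (h - k)) < ln (2 * (\<Delta> / \<delta>))" by (subst ln_less_cancel_iff) auto
      then have "?d * ln 2 < ln 2 + z"
        using \<Delta> \<delta> unfolding z_def by (subst (asm) ln_mult) (auto simp: ln_realpow)
      then have zl: "(?d - 1) * ln 2 \<le> z" by (simp add: algebra_simps)
      show ?thesis
      proof (cases "1 \<le> ?d")
        case True
        then have "(?d - 1) * (1 / 2) \<le> (?d - 1) * ln 2" using ln2 by (intro mult_left_mono) auto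
        then have "(?d - 1) * (1 / 2) \<le> z" using zl by (rule order_trans)
        then show ?thesis by simp
      qed (use z0 in linarith)
    qed (use z0 in simp)
    have "(floor_sqrt (min k (h - k)))\<^sup>2 \<le> h - k"
      using floor_sqrt_power2_le[of "min k (h - k)"] by simp
    then have "real ((floor_sqrt (min k (h - k)))\<^sup>2) \<le> ?d" by (simp only: of_nat_le_iff)
    then have "f\<^sup>2 \<le> ?d" by (simp only: f_def of_nat_power)
    then have f2: "f\<^sup>2 \<le> 1 + 2 * z" using d by linarith
    \<comment> \<open>A factor \<gamma> < 1 in the denominator can only enlarge the second
      summand.\<close>
    have zL: "z / L \<le> q" unfolding q_def
      using z0 L1 \<gamma> False by (intro divide_left_mono) (auto intro: mult_left_le_one_le)
    have "1 \<le> A powr \<gamma>" using A1 \<gamma> by (intro ge_one_powr_ge_zero) auto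
    moreover have "1 + f \<le> 4 * (1 + z / L)"
    proof (cases "1 \<le> z")
      case False
      have "f\<^sup>2 \<le> 3\<^sup>2" using f2 False by simp
      then have "f \<le> 3" by (rule power2_le_imp_le) simp
      moreover have "0 \<le> z / L" using z0 L1 by simp
      ultimately show ?thesis unfolding distrib_left by linarith
    next
      case True
      have s1: "1 \<le> sqrt z" using True by simp
      \<comment> \<open>Hence L \<le> 2 sqrt z, so z / L is at least sqrt z / 2 and pays for a
        square root of order sqrt z.\<close>
      have "ln z = 2 * ln (sqrt z)" using True by (simp add: ln_sqrt)
      also have "\<dots> \<le> 2 * (sqrt z - 1)" using s1 by (intro mult_left_mono ln_le_minus_one) auto
      finally have "L \<le> 2 * sqrt z"
        using s1 unfolding L_def log_ge1_def right_diff_distrib by (intro max.boundedI) linarith+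
      then have "z / (2 * sqrt z) \<le> z / L" using L1 z0 True by (intro divide_left_mono mult_pos_pos) auto
      moreover have "z / (2 * sqrt z) = sqrt z / 2" using True by (simp add: real_div_sqrt)
      ultimately have zs: "sqrt z \<le> 2 * (z / L)" by linarith
      have "1 + 2 * z \<le> (2 * sqrt z)\<^sup>2" using True by (simp add: power_mult_distrib)
      then have "f\<^sup>2 \<le> (2 * sqrt z)\<^sup>2" using f2 by linarith
      then have "f \<le> 2 * sqrt z" by (rule power2_le_imp_le) (use s1 in simp)
      with zs show ?thesis unfolding distrib_left by linarith
    qed
    ultimately have "1 + f \<le> 4 * (A powr \<gamma> + q)"
      using zL unfolding distrib_left by linarith
    then show ?thesis by (simp only: q_def A_def z_def L_def f_def)
  qed
qed

lemma dyadic_level: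
  assumes "0 < (\<Delta>::real)" "\<Delta> \<le> 1"
  shows "\<exists>k. 1 / 2 ^ k \<le> \<Delta> \<and> \<Delta> < 2 * (1 / 2 ^ k)"
proof -
  define k where "k = (LEAST k. 1 / 2 ^ k \<le> \<Delta>)"
  have "\<exists>k. (1 / 2) ^ k < \<Delta>" using assms(1) by (intro real_arch_pow_inv) auto
  then obtain k0 where "1 / 2 ^ k0 \<le> \<Delta>" by (auto simp: power_one_over intro: less_imp_le)
  then have 1: "1 / 2 ^ k \<le> \<Delta>" unfolding k_def by (rule LeastI)
  have "\<Delta> < 2 * (1 / 2 ^ k)"
  proof (cases k)
    case 0
    then show ?thesis using assms(2) by simp
  next
    case (Suc j)
    then have "\<not> 1 / 2 ^ j \<le> \<Delta>" using not_less_Least[of j "\<lambda>k. 1 / 2 ^ k \<le> \<Delta>"] by (simp add: k_def)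
    then show ?thesis by (simp add: Suc)
  qed
  with 1 show ?thesis by blast
qed

lemma horizon_exponent:
  assumes "(T::nat) > 0"
  shows "\<exists>R. T \<le> 4 ^ R \<and> 4 ^ R \<le> 4 * T"
proof -
  define R where "R = (LEAST R. T \<le> 4 ^ R)"
  have "T < 2 ^ T" by (rule less_exp)
  also have "(2::nat) ^ T \<le> 4 ^ T" by (rule power_mono) auto
  finally have "T \<le> 4 ^ T" by simp
  then have 1: "T \<le> 4 ^ R" unfolding R_def by (rule LeastI)
  have "4 ^ R \<le> 4 * T"
  proof (cases R)
    case (Suc j)
    then have "\<not> T \<le> 4 ^ j" using not_less_Least[of j "\<lambda>R. T \<le> 4 ^ R"] by (simp add: R_def)
    then show ?thesis by (simp add: Suc)
  qed (use assms in simp)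
  with 1 show ?thesis by blast
qed

lemma exponent_le_log:
  assumes "T > 0" "4 ^ R \<le> 4 * T"
  shows "real R + 1 \<le> 3 * log_ge1 (real T)"
proof -
  have e: "exp 1 \<le> (4::real)" using exp_le by simp
  then have l4: "1 \<le> ln (4::real)" by (subst ln_ge_iff) auto
  have "real (4 ^ R) \<le> real (4 * T)" using assms(2) by (simp only: of_nat_le_iff)
  then have "(4::real) ^ R \<le> 4 * real T" by simp
  then have "ln ((4::real) ^ R) \<le> ln (4 * real T)" using assms(1) by (subst ln_le_cancel_iff) auto
  then have "real R * ln 4 \<le> ln 4 + ln (real T)" using assms(1) by (simp add: ln_realpow ln_mult)
  then have r: "(real R - 1) * ln 4 \<le> ln (real T)" by (simp add: algebra_simps)
  have "0 \<le> ln (real T)" using assms(1) by simp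
  have "real R \<le> 1 + ln (real T)"
  proof (cases "1 \<le> real R")
    case True
    then have "(real R - 1) * 1 \<le> (real R - 1) * ln 4" using l4 by (intro mult_left_mono) auto
    then have "(real R - 1) * 1 \<le> ln (real T)" using r by (rule order_trans)
    then show ?thesis by simp
  qed (use \<open>0 \<le> ln (real T)\<close> in linarith)
  then show ?thesis using log_ge1_ge[of "real T"] by linarith
qed

text \<open>The room required is 65536 (4 T)^3 = 2^22 T^3. Both 2 and T are at most 2^b, so 22 + 3 =
  25 copies of b bits are enough.\<close>

lemma word_bits_bounds:
  assumes K: "K > 0" and T: "T > 0" and R: "4 ^ R \<le> 4 * T"
  shows "K < 2 ^ word_bits 25 K T" "65536 * (4 ^ R) ^ 3 \<le> (2::nat) ^ word_bits 25 K T"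
proof -
  define b where "b = nat \<lceil>log 2 (real (K * T + 1))\<rceil>"
  have w: "(2::nat) ^ word_bits 25 K T = (2 ^ b) ^ 25"
    unfolding word_bits_def b_def[symmetric] by (subst mult.commute) (rule power_mult)
  have pos: "0 < real (K * T + 1)" by (rule of_nat_0_less_iff[THEN iffD2]) simp
  have "log 2 (real (K * T + 1)) \<le> real b" unfolding b_def by linarith
  then have "real (K * T + 1) \<le> 2 powr real b" by (rule iffD1[OF log_le_iff[OF _ pos], rotated]) simp
  then have "real (K * T + 1) \<le> real (2 ^ b)" by (simp add: powr_realpow)
  then have B: "K * T + 1 \<le> 2 ^ b" by (simp only: of_nat_le_iff)
  have KT: "K \<le> K * T" "T \<le> K * T" using K T by auto
  have B2: "2 \<le> (2::nat) ^ b" using B KT K by linarith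
  have "K < 2 ^ b" using B KT by linarith
  also have "(2::nat) ^ b \<le> (2 ^ b) ^ 25" by (rule self_le_power) simp_all
  finally show "K < 2 ^ word_bits 25 K T" by (simp only: w)
  have Tb: "T \<le> 2 ^ b" using B KT by linarith
  have "65536 * (4 ^ R) ^ 3 \<le> 65536 * (4 * T) ^ 3" using R by (intro mult_left_mono power_mono) auto
  also have "\<dots> = 2 ^ 22 * T ^ 3" by (simp add: power_mult_distrib)
  also have "\<dots> \<le> (2 ^ b) ^ 22 * (2 ^ b) ^ 3" using B2 Tb by (intro mult_mono power_mono) auto
  also have "\<dots> = (2 ^ b) ^ (22 + 3)" by (rule power_add[symmetric])
  also have "\<dots> = (2 ^ b) ^ 25" by simp
  finally show "65536 * (4 ^ R) ^ 3 \<le> (2::nat) ^ word_bits 25 K T" by (simp only: w)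
qed

text \<open>\<open>R\<close> enters the program only through immediate operands, each of length
  one.\<close>

lemma prog_length_player: "prog_length (player_prog R) = prog_length (player_prog 0)"
  by (simp add: player_prog_def step_prog_def check_prog_def reject_prog_def accept_prog_def up_prog_def
      root_prog_def next_prog_def quota_exp_def low_exp_def gain_exp_def bar_exp_def grid_exp_def reward_exp_def)

section \<open>Assembly of the final bound\<close>

definition budget :: "real \<Rightarrow> real \<Rightarrow> real \<Rightarrow> real" where
  "budget \<gamma> \<delta> \<Delta> = log_ge1 (1 / \<Delta>) powr \<gamma> + ln (\<Delta> / \<delta>) / (\<gamma> * log_ge1 (ln (\<Delta> / \<delta>)))"

lemma budget_ge_1:
  assumes "0 < \<gamma>" "0 < \<delta>" "\<delta> \<le> \<Delta>"
  shows "1 \<le> budget \<gamma> \<delta> \<Delta>"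
proof -
  have "1 \<le> log_ge1 (1 / \<Delta>) powr \<gamma>" using assms log_ge1_ge by (intro ge_one_powr_ge_zero) auto
  moreover have "0 \<le> ln (\<Delta> / \<delta>)" using assms by simp
  then have "0 \<le> ln (\<Delta> / \<delta>) / (\<gamma> * log_ge1 (ln (\<Delta> / \<delta>)))"
    using assms log_ge1_ge(1)[of "ln (\<Delta> / \<delta>)"] by simp
  ultimately show ?thesis unfolding budget_def by linarith
qed

text \<open>From \<Delta> 2^k \<le> 2 follows \<Delta> 4^k \<le> 4 / \<Delta>, and 48 = 4 * 3 * 4
  collects this factor and those of r and q.\<close>

lemma level_term_le:
  fixes \<Delta> r L q X :: real
  assumes \<Delta>: "0 < \<Delta>" "\<Delta> < 2 * (1 / 2 ^ k)" and r: "0 \<le> r" "r \<le> 3 * L" and q: "0 \<le> q" "q \<le> 4 * X"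
  shows "\<Delta> * (2 ^ 38 * r * 4 ^ k * q) \<le> 2 ^ 38 * 48 * (1 / \<Delta> * X * L)"
proof -
  have "\<Delta> * 2 ^ k \<le> 2" using \<Delta>(2) by (simp add: field_simps)
  then have "(\<Delta> * 2 ^ k) * (\<Delta> * 2 ^ k) \<le> 2 * 2" using \<Delta>(1) by (intro mult_mono) auto
  moreover have "(\<Delta> * 2 ^ k) * (\<Delta> * 2 ^ k) = \<Delta> * 4 ^ k * \<Delta>"
    by (simp add: power_mult_distrib[symmetric] mult.assoc mult.left_commute)
  ultimately have "\<Delta> * 4 ^ k * \<Delta> \<le> 4" by linarith
  then have k: "\<Delta> * 4 ^ k \<le> 4 * (1 / \<Delta>)" using \<Delta>(1) by (simp add: pos_le_divide_eq)
  have rq: "r * q \<le> (3 * L) * (4 * X)" using r q by (intro mult_mono) auto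
  have "(\<Delta> * 4 ^ k) * (r * q) \<le> (4 * (1 / \<Delta>)) * ((3 * L) * (4 * X))"
    by (rule mult_mono[OF k rq]) (use r q \<Delta>(1) in auto)
  then have "2 ^ 38 * ((\<Delta> * 4 ^ k) * (r * q)) \<le> 2 ^ 38 * ((4 * (1 / \<Delta>)) * ((3 * L) * (4 * X)))"
    by (rule mult_left_mono) simp
  moreover have "\<Delta> * (2 ^ 38 * r * 4 ^ k * q) = 2 ^ 38 * ((\<Delta> * 4 ^ k) * (r * q))"
    by (simp only: ac_simps)
  moreover have "2 ^ 38 * ((4 * (1 / \<Delta>)) * ((3 * L) * (4 * X))) = 2 ^ 38 * 48 * (1 / \<Delta> * X * L)"
    by simp
  ultimately show ?thesis by (simp only:)
qed

lemma (in arms) pseudo_regret_le_budget: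
  assumes KW: "K < 2 ^ w" and T: "T > 0" "T \<le> 4 ^ R" "4 ^ R \<le> 4 * T" and S: "15 \<le> S" and \<gamma>: "\<gamma> > 0"
  shows "pseudo_regret (player_prog R) S w K T D
    \<le> 2 ^ 44 * (\<Sum>i | i < K \<and> gap K D i > 0. 1 / gap K D i * budget \<gamma> (min_gap K D) (gap K D i) * log_ge1 (real T))"
proof -
  have mean: "0 \<le> mean i" "mean i \<le> 1" for i
    unfolding mean_def by (rule reward_mean_bounds)+
  have "Max (mean ` {..<K}) \<in> mean ` {..<K}" using K_pos by (intro Max_in) auto
  then obtain opt where opt: "opt < K" "Max (mean ` {..<K}) = mean opt" by auto
  have opt_max: "mean i \<le> mean opt" if "i < K" for i
    unfolding opt(2)[symmetric] using that by (intro Max_ge) auto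
  have im: "arm_mean D ` {..<K} = mean ` {..<K}" by (intro image_cong refl) (simp add: mean_eq)
  have gap: "gap K D i = mean opt - mean i" if "i < K" for i
    unfolding gap_def best_mean_def im opt(2) mean_eq[OF that] ..
  define Sub where "Sub = {i. i < K \<and> gap K D i > 0}"
  have Sub: "Sub = {i. i < K \<and> mean i < mean opt}" unfolding Sub_def using gap by auto
  have fin: "finite Sub" by (simp add: Sub_def)
  note regret = pseudo_regret_le[OF KW T(2) S opt_max]
  show ?thesis
  proof (cases "Sub = {}")
    case True
    \<comment> \<open>All arms are optimal: the sum in the bound is empty, so the additive 1 could
      not be absorbed, but every pull has regret 0.\<close>
    have z: "mean opt - mean (pull R (traj K R y t)) = 0" for y t
    proof -
      have "\<not> mean (pull R (traj K R y t)) < mean opt" using True pull_less unfolding Sub by blast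
      then show ?thesis using opt_max[OF pull_less[of y t]] by simp
    qed
    have "pseudo_regret (player_prog R) S w K T D \<le> 0" using regret by (simp add: z)
    then show ?thesis using True unfolding Sub_def[symmetric] by simp
  next
    case False
    have "Max (mean ` Sub) \<in> mean ` Sub" using False fin by (intro Max_in) auto
    then obtain g where g: "g \<in> Sub" "Max (mean ` Sub) = mean g" by auto
    have g_max: "mean i \<le> mean g" if "i \<in> Sub" for i
      unfolding g(2)[symmetric] using that fin by (intro Max_ge) auto
    have gK: "g < K" "mean g < mean opt" using g(1) unfolding Sub by auto
    have min_gap: "min_gap K D = gap K D g"
    proof -
      have "{gap K D i | i. i < K \<and> gap K D i > 0} = gap K D ` Sub" by (auto simp: Sub_def)
      moreover have "Min (gap K D ` Sub) = gap K D g"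
      proof (rule Min_eqI)
        fix z assume "z \<in> gap K D ` Sub"
        then obtain i where i: "i \<in> Sub" "z = gap K D i" by auto
        have "i < K" using i(1) by (simp add: Sub_def)
        then show "gap K D g \<le> z" using g_max[OF i(1)] by (simp add: i(2) gap gK(1))
      qed (use fin g(1) in auto)
      ultimately show ?thesis by (simp add: min_gap_def)
    qed
    define lev where "lev i = (SOME k. 1 / 2 ^ k \<le> mean opt - mean i \<and> mean opt - mean i < 2 * (1 / 2 ^ k))" for i
    have lev: "1 / 2 ^ lev i \<le> mean opt - mean i \<and> mean opt - mean i < 2 * (1 / 2 ^ lev i)"
      if "mean i < mean opt" for i
      unfolding lev_def
    proof (rule someI_ex, rule dyadic_level)
      show "0 < mean opt - mean i" using that by simp
      show "mean opt - mean i \<le> 1" using mean(1)[of i] mean(2)[of opt] by simp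
    qed
    interpret G: gapped_game K T R opt "\<lambda>i. measure_pmf.expectation (\<rho> i) real / real (grid R)" mean \<rho> g lev
    proof unfold_locales
      show "\<bar>measure_pmf.expectation (\<rho> i) real / real (grid R) - mean i\<bar> \<le> 2 / real (grid R)" for i
        unfolding mean_def by (rule \<rho>_mean)
      show "mean i \<le> mean g" if "i < K" "mean i < mean opt" for i
        using that by (intro g_max) (simp add: Sub)
    qed (simp_all only: K_pos opt opt_max mean \<rho>_supp T(2) gK lev)
    have "measure_pmf.expectation law (\<lambda>y. \<Sum>t<T. mean opt - mean (pull R (traj K R y t)))
      \<le> 1 + (\<Sum>i\<in>Sub. (mean opt - mean i) * (2 ^ 38 * (real R + 1) * 4 ^ lev i * (1 + real (G.width i))))"
      using G.expected_regret_le unfolding G.pm_def idx_def Sub .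
    with regret have "pseudo_regret (player_prog R) S w K T D
      \<le> 1 + (\<Sum>i\<in>Sub. (mean opt - mean i) * (2 ^ 38 * (real R + 1) * 4 ^ lev i * (1 + real (G.width i))))"
      by (rule order_trans)
    also have "\<dots> \<le> 1 + (\<Sum>i\<in>Sub. 2 ^ 38 * 48 * (1 / gap K D i * budget \<gamma> (min_gap K D) (gap K D i) * log_ge1 (real T)))"
    proof (intro add_left_mono sum_mono)
      fix i assume i: "i \<in> Sub"
      then have iK: "i < K" "mean i < mean opt" unfolding Sub by auto
      have "1 + real (G.width i) \<le> 4 * budget \<gamma> (min_gap K D) (gap K D i)"
        unfolding G.width_def budget_def min_gap
      proof (rule width_le_budget[OF \<gamma>])
        show "0 < gap K D g" using g(1) by (simp add: Sub_def)
        show "gap K D g \<le> gap K D i" using g_max[OF i] unfolding gap[OF gK(1)] gap[OF iK(1)] by simp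
        show "1 / 2 ^ lev i \<le> gap K D i" "gap K D i < 2 * (1 / 2 ^ lev i)"
          using lev[OF iK(2)] by (simp_all add: gap iK(1))
        show "gap K D g < 2 * (1 / 2 ^ lev g)" using lev[OF gK(2)] by (simp add: gap gK(1))
      qed
      then show "(mean opt - mean i) * (2 ^ 38 * (real R + 1) * 4 ^ lev i * (1 + real (G.width i)))
        \<le> 2 ^ 38 * 48 * (1 / gap K D i * budget \<gamma> (min_gap K D) (gap K D i) * log_ge1 (real T))"
        unfolding gap[OF iK(1)] using iK(2) lev[OF iK(2)] exponent_le_log[OF T(1,3)]
        by (intro level_term_le) auto
    qed
    also have "\<dots> = 1 + 2 ^ 38 * 48 * (\<Sum>i\<in>Sub. 1 / gap K D i * budget \<gamma> (min_gap K D) (gap K D i) * log_ge1 (real T))"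
      by (simp only: sum_distrib_left)
    also have "\<dots> \<le> 2 ^ 44 * (\<Sum>i\<in>Sub. 1 / gap K D i * budget \<gamma> (min_gap K D) (gap K D i) * log_ge1 (real T))"
    proof -
      let ?X = "\<lambda>i. 1 / gap K D i * budget \<gamma> (min_gap K D) (gap K D i) * log_ge1 (real T)"
      \<comment> \<open>Every summand is at least 1, so the additive 1 of the bad plays is absorbed:
        1 + 48 * 2^38 \<le> 2^44.\<close>
      have X: "1 \<le> ?X i" if i: "i \<in> Sub" for i
      proof -
        have iK: "i < K" "0 < gap K D i" using i by (auto simp: Sub_def)
        have "gap K D i \<le> 1" using mean(1)[of i] mean(2)[of opt] by (simp add: gap iK(1))
        then have "1 \<le> 1 / gap K D i" using iK(2) by simp
        moreover have "1 \<le> budget \<gamma> (min_gap K D) (gap K D i)"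
          using g_max[OF i] gK(2) unfolding min_gap gap[OF gK(1)] gap[OF iK(1)] by (intro budget_ge_1 \<gamma>) simp_all
        ultimately have "1 * 1 * 1 \<le> ?X i" using iK(2) log_ge1_ge(1)[of "real T"] by (intro mult_mono) auto
        then show ?thesis by simp
      qed
      have "1 \<le> ?X g" using g(1) by (rule X)
      also have "?X g \<le> (\<Sum>i\<in>Sub. ?X i)" using X by (intro member_le_sum g(1) fin) force
      finally show ?thesis by simp
    qed
    finally show ?thesis by (simp only: Sub_def)
  qed
qed

theorem theorem4:
  shows "\<exists>C > (0::real). \<exists>(c::nat) > 0. \<exists>S::nat.
    \<forall>(\<gamma>::real) > 0. \<forall>(T::nat) > 0.
    \<exists>p::prog. prog_length p \<le> S \<and>
      (\<forall>(K::nat) > 0.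
         legal_player p S (word_bits c K T) K T \<and>
         (\<forall>D. bandit_instance K D \<longrightarrow>
            pseudo_regret p S (word_bits c K T) K T D
              \<le> C * (\<Sum>i | i < K \<and> gap K D i > 0.
                       1 / gap K D i *
                       (log_ge1 (1 / gap K D i) powr \<gamma>
                        + ln (gap K D i / min_gap K D)
                            / (\<gamma> * log_ge1 (ln (gap K D i / min_gap K D))))
                       * log_ge1 (real T))))"
proof (intro exI conjI allI impI)
  \<comment> \<open>One constant bounds the program text and also provides the 15 memory
    cells.\<close>
  let ?S = "prog_length (player_prog 0) + 15"
  \<comment> \<open>The exponent depends on T alone, so the program is fixed before K and D are
    given.\<close>
  define e :: "nat \<Rightarrow> nat" where "e T = (SOME R. T \<le> 4 ^ R \<and> 4 ^ R \<le> 4 * T)" for T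
  fix \<gamma> :: real and T :: nat assume \<gamma>: "\<gamma> > 0" and T: "T > 0"
  have e: "T \<le> 4 ^ e T" "4 ^ e T \<le> 4 * T"
    using someI_ex[OF horizon_exponent[OF T]] unfolding e_def by blast+
  show "prog_length (player_prog (e T)) \<le> ?S" using prog_length_player[of "e T"] by linarith
  fix K :: nat assume K: "K > 0"
  note wb = word_bits_bounds[OF K T e(2)]
  show "legal_player (player_prog (e T)) ?S (word_bits 25 K T) K T"
    by (rule legal_player_prog[OF K wb(1) e(1) wb(2)]) simp
  fix D assume "bandit_instance K D"
  then interpret arms K T "word_bits 25 K T" "e T" D
    by unfold_locales (use K wb in auto)
  show "pseudo_regret (player_prog (e T)) ?S (word_bits 25 K T) K T D
    \<le> 2 ^ 44 * (\<Sum>i | i < K \<and> gap K D i > 0. 1 / gap K D i *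
        (log_ge1 (1 / gap K D i) powr \<gamma>
          + ln (gap K D i / min_gap K D) / (\<gamma> * log_ge1 (ln (gap K D i / min_gap K D)))) * log_ge1 (real T))"
    by (rule pseudo_regret_le_budget[OF wb(1) T e _ \<gamma>, unfolded budget_def]) simp
qed simp_all

end
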